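(* Let $d$ be a positive integer and let $H$ be a separable real Hilbert space with inner product $\langle\cdot,\cdot\rangle$ and norm $\|\cdot\|_H$. Let $X:=(X_k,k\in\mathbb{Z}^d)$ be a strictly stationary $\rho'$-mixing random field of $H$-valued random variables such that $EX_0=0_H$ and $E\|X_0\|_H^2<\infty$. Let $\{e_i\}_{i\ge1}$ be an orthonormal basis of $H$ and let $X_{ki}:=\langle X_k,e_i\rangle$ for each pair $(k,i)$. For $L=(L_1,\ldots,L_d)\in\mathbb{N}^d$ and $i\in\mathbb{N}$ let $$S_{L,i}:=\sum_k X_{ki},\qquad S(X,L):=\sum_k X_k,$$ the sums being over all $k=(k_1,\ldots,k_d)\in\mathbb{N}^d$ with $1\le k_u\le L_u$ for all $u\in\{1,\ldots,d\}$. Then the following statements hold: (I) For each $i\in\mathbb{N}$, the quantity $$\sigma_{ii}=\lim_{\min\{L_1,\ldots,L_d\}\to\infty}\frac{E\,S_{L,i}^2}{L_1\cdot L_2\cdots L_d}$$ exists in $[0,\infty)$. (II) For any two distinct elements $i,j\in\mathbb{N}$, the quantity $$\gamma(i,j)=\lim_{\min\{L_1,\ldots,L_d\}\to\infty}\frac{E(S_{L,i}-S_{L,j})^2}{L_1\cdot L_2\cdots L_d}$$ exists in $[0,\infty)$. (III) Let $\Sigma^{(\infty)}:=(\sigma_{ij}, i\ge1, j\ge1)$ be defined by the $\sigma_{ii}$ of (I) and, for $i\ne j$, $$\sigma_{ij}=\tfrac12\big(\sigma_{ii}+\sigma_{jj}-\gamma(i,j)\big),$$ with $\gamma(i,j)$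 given in (II). Then the "covariance operator" $\Sigma^{(\infty)}$ is symmetric, nonnegative definite and has finite trace, and as $\min\{L_1,L_2,\ldots,L_d\}\to\infty$, $$\frac{S(X,L)}{\sqrt{L_1\cdot L_2\cdots L_d}}\Rightarrow N\big(0_H,\Sigma^{(\infty)}\big),$$ where $\Rightarrow$ denotes convergence in distribution (of $H$-valued random variables).
   Context: $\mathbb{N}=\{1,2,3,\ldots\}$. All random variables are defined on a probability space $(\Omega,\mathcal{F},P)$; $H$ carries its Borel $\sigma$-field, and $0_H$ is the zero element of $H$. A random field $X=(X_k,k\in\mathbb{Z}^d)$ is strictly stationary if its joint distributions are invariant under shifts of the index by elements of $\mathbb{Z}^d$. For $\sigma$-fields $\mathcal{A},\mathcal{B}\subseteq\mathcal{F}$, the maximal coefficient of correlation is $$\rho(\mathcal{A},\mathcal{B}):=\sup|\mathrm{Corr}(f,g)|,\quad f\in L^2_{\mathrm{real}}(\mathcal{A}),\ g\in L^2_{\mathrm{real}}(\mathcal{B}),$$ where $L^2_{\mathrm{real}}(\mathcal{A})$ is the set of real-valued, square-integrable, $\mathcal{A}$-measurable random variables (pairs with a degenerate member contribute $0$). For a strictly stationary random field $X=(X_k,k\in\mathbb{Z}^d)$ and a positive integer $n$, $$\rho'(n)=\rho'(X,n):=\sup\rho(\sigma(X_k,k\in Q),\sigma(X_k,k\in S)),$$ where the supremum is over all pairs of nonempty, finite, disjoint sets $Q,S\subset\mathbb{Z}^d$ with the following property: there exist $u\in\{1,\ldots,d\}$ and nonempty disjoint sets $A,B\subset\mathbb{Z}$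 with $\mathrm{dist}(A,B):=\min_{a\in A,b\in B}|a-b|\ge n$ such that $Q\subset\{k=(k_1,\ldots,k_d)\in\mathbb{Z}^d: k_u\in A\}$ and $S\subset\{k=(k_1,\ldots,k_d)\in\mathbb{Z}^d: k_u\in B\}$. The random field $X$ is $\rho'$-mixing if $\rho'(n)\to0$ as $n\to\infty$. Covariance operator: for an $H$-valued random variable $Z$ with $EZ=0_H$ and $E\|Z\|_H^2<\infty$, with coordinates $Z_i=\langle Z,e_i\rangle$, the "covariance operator" (relative to the given orthonormal basis) is represented by the $\mathbb{N}\times\mathbb{N}$ "covariance matrix" $(EZ_iZ_j, i\ge1,j\ge1)$. Accordingly, symmetric means $\sigma_{ij}=\sigma_{ji}$ for all $i,j$; nonnegative definite means $\sum_{i,j=1}^m r_ir_j\sigma_{ij}\ge0$ for all $m\ge1$ and $(r_1,\ldots,r_m)\in\mathbb{R}^m$; finite trace means $\sum_{i=1}^\infty\sigma_{ii}<\infty$. $N(0_H,\Sigma^{(\infty)})$ denotes the law of a centered normal (possibly degenerate) $H$-valued random variable $Y$ whose covariance matrix relative to $\{e_i\}$ is $\Sigma^{(\infty)}$, i.e. every finite linear combination of the coordinates $\langle Y,e_i\rangle$ is a centered (possibly degenerate) normal real random variable and $E\langle Y,e_i\rangle\langle Y,e_j\rangle=\sigma_{ij}$ for all $i,j\ge1$. For an array $(a(L),L\in\mathbb{N}^d)$, the limit as $\min\{L_1,\ldots,L_d\}\to\infty$ is taken along all $L\in\mathbb{N}^d$ with all coordinates tending to infinity, in an arbitrary manner relative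 to each other. *)

theory Defs
  imports "HOL-Probability.Probability"
begin

section \<open>Strictly stationary random fields on $\mathbb{Z}^d$\<close>

text \<open>The lattice $\mathbb{Z}^d$ is the type \<^typ>\<open>int ^ 'd\<close>, where the finite index type has \<open>d\<close> elements.\<close>

definition strictly_stationary ::
  "'w measure \<Rightarrow> (int ^ 'd \<Rightarrow> 'w \<Rightarrow> 'h::topological_space) \<Rightarrow> bool" where
  "strictly_stationary M X \<longleftrightarrow>
     (\<forall>h K. finite K \<longrightarrow>
        distr M (PiM K (\<lambda>_. borel)) (\<lambda>\<omega>. \<lambda>k\<in>K. X (k + h) \<omega>) =
        distr M (PiM K (\<lambda>_. borel)) (\<lambda>\<omega>. \<lambda>k\<in>K. X k \<omega>))"

definition sigma_gen_by ::
  "'w measure \<Rightarrow> ('k \<Rightarrow> 'w \<Rightarrow> 'h::topological_space) \<Rightarrow> 'k set \<Rightarrow> 'w measure" where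
  "sigma_gen_by M X Q =
     sigma (space M) (\<Union>k\<in>Q. {X k -` A \<inter> space M | A. A \<in> sets borel})"

section \<open>Maximal correlation and the mixing coefficient\<close>

definition covar :: "'w measure \<Rightarrow> ('w \<Rightarrow> real) \<Rightarrow> ('w \<Rightarrow> real) \<Rightarrow> real" where
  "covar M f g =
     (\<integral>x. (f x - (\<integral>y. f y \<partial>M)) * (g x - (\<integral>y. g y \<partial>M)) \<partial>M)"

text \<open>Division by zero being zero, a pair with a degenerate member has correlation 0.\<close>

definition corr :: "'w measure \<Rightarrow> ('w \<Rightarrow> real) \<Rightarrow> ('w \<Rightarrow> real) \<Rightarrow> real" where
  "corr M f g = covar M f g / (sqrt (covar M f f) * sqrt (covar M g g))"

text \<open>A sub-\<open>\<sigma>\<close>-field is given as a measure \<open>A\<close> of which only the measurable sets matter;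
  integrals are always taken with respect to the ambient probability measure \<open>M\<close>.\<close>

definition L2_real :: "'w measure \<Rightarrow> 'w measure \<Rightarrow> ('w \<Rightarrow> real) set" where
  "L2_real M A = {f. f \<in> borel_measurable A \<and> integrable M (\<lambda>x. (f x)\<^sup>2)}"

text \<open>The real suprema below are over nonempty sets of numbers in $[0,1]$
  (by Cauchy--Schwarz), as long as \<open>M\<close> is a probability space and the fields are sub-fields of it.\<close>

definition max_corr :: "'w measure \<Rightarrow> 'w measure \<Rightarrow> 'w measure \<Rightarrow> real" where
  "max_corr M A B = Sup {\<bar>corr M f g\<bar> | f g. f \<in> L2_real M A \<and> g \<in> L2_real M B}"

definition separated_sets :: "nat \<Rightarrow> (int ^ 'd) set \<Rightarrow> (int ^ 'd) set \<Rightarrow> bool" where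
  "separated_sets n Q S \<longleftrightarrow>
     Q \<noteq> {} \<and> finite Q \<and> S \<noteq> {} \<and> finite S \<and> Q \<inter> S = {} \<and>
     (\<exists>u A B. A \<noteq> {} \<and> B \<noteq> {} \<and> A \<inter> B = {} \<and> real n \<le> setdist A B \<and>
        Q \<subseteq> {k. k $ u \<in> A} \<and> S \<subseteq> {k. k $ u \<in> B})"

definition rho_prime ::
  "'w measure \<Rightarrow> (int ^ 'd \<Rightarrow> 'w \<Rightarrow> 'h::topological_space) \<Rightarrow> nat \<Rightarrow> real" where
  "rho_prime M X n =
     Sup {max_corr M (sigma_gen_by M X Q) (sigma_gen_by M X S) | Q S. separated_sets n Q S}"

definition rho_prime_mixing ::
  "'w measure \<Rightarrow> (int ^ 'd \<Rightarrow> 'w \<Rightarrow> 'h::topological_space) \<Rightarrow> bool" where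
  "rho_prime_mixing M X \<longleftrightarrow> (\<lambda>n. rho_prime M X n) \<longlonglongrightarrow> 0"

section \<open>Rectangular sums and the limit over rectangles\<close>

text \<open>Elements of $\mathbb{N}^d$ are vectors of type \<^typ>\<open>nat ^ 'd\<close>; the filter below
  eventually excludes those with a zero coordinate.\<close>

definition min_at_top :: "(nat ^ 'd) filter" where
  "min_at_top = filtercomap (\<lambda>L. Min (range (\<lambda>u. L $ u))) at_top"

lemma min_at_top_neq_bot: "(min_at_top :: (nat ^ 'd) filter) \<noteq> bot"
  unfolding min_at_top_def
proof (rule filtercomap_neq_bot)
  fix P :: "nat \<Rightarrow> bool"
  assume "eventually P at_top"
  then obtain n where "P n"
    by (auto simp: eventually_at_top_linorder)
  then show "\<exists>L::nat ^ 'd. P (Min (range (\<lambda>u. L $ u)))"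
    by (intro exI[of _ "\<chi> u. n"]) simp
qed

definition rect :: "nat ^ 'd \<Rightarrow> (int ^ 'd) set" where
  "rect L = {k. \<forall>u. 1 \<le> k $ u \<and> k $ u \<le> int (L $ u)}"

definition vol :: "nat ^ 'd \<Rightarrow> real" where
  "vol L = (\<Prod>u\<in>UNIV. real (L $ u))"

definition rect_sum ::
  "(int ^ 'd \<Rightarrow> 'w \<Rightarrow> 'h::comm_monoid_add) \<Rightarrow> nat ^ 'd \<Rightarrow> 'w \<Rightarrow> 'h" where
  "rect_sum X L \<omega> = (\<Sum>k\<in>rect L. X k \<omega>)"

definition coord_sum ::
  "(int ^ 'd \<Rightarrow> 'w \<Rightarrow> 'h::real_inner) \<Rightarrow> (nat \<Rightarrow> 'h) \<Rightarrow> nat ^ 'd \<Rightarrow> nat \<Rightarrow> 'w \<Rightarrow> real" where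
  "coord_sum X e L i \<omega> = (\<Sum>k\<in>rect L. X k \<omega> \<bullet> e i)"

definition norm_var ::
  "'w measure \<Rightarrow> (int ^ 'd \<Rightarrow> 'w \<Rightarrow> 'h::real_inner) \<Rightarrow> (nat \<Rightarrow> 'h) \<Rightarrow> nat \<Rightarrow> nat ^ 'd \<Rightarrow> real" where
  "norm_var M X e i L = (\<integral>\<omega>. (coord_sum X e L i \<omega>)\<^sup>2 \<partial>M) / vol L"

definition norm_var_diff ::
  "'w measure \<Rightarrow> (int ^ 'd \<Rightarrow> 'w \<Rightarrow> 'h::real_inner) \<Rightarrow> (nat \<Rightarrow> 'h) \<Rightarrow> nat \<Rightarrow> nat \<Rightarrow> nat ^ 'd \<Rightarrow> real" where
  "norm_var_diff M X e i j L =
     (\<integral>\<omega>. (coord_sum X e L i \<omega> - coord_sum X e L j \<omega>)\<^sup>2 \<partial>M) / vol L"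

definition Sigma_lim ::
  "'w measure \<Rightarrow> (int ^ 'd \<Rightarrow> 'w \<Rightarrow> 'h::real_inner) \<Rightarrow> (nat \<Rightarrow> 'h) \<Rightarrow> nat \<Rightarrow> nat \<Rightarrow> real" where
  "Sigma_lim M X e i j =
     (if i = j then Lim min_at_top (norm_var M X e i)
      else (Lim min_at_top (norm_var M X e i) + Lim min_at_top (norm_var M X e j)
            - Lim min_at_top (norm_var_diff M X e i j)) / 2)"

section \<open>Orthonormal bases, covariance matrices and normal laws on a Hilbert space\<close>

text \<open>Sequences and matrices are indexed by $\{1,2,\ldots\}$; values at index 0 are irrelevant.\<close>

definition orthonormal_basis :: "(nat \<Rightarrow> 'h::real_inner) \<Rightarrow> bool" where
  "orthonormal_basis e \<longleftrightarrow>
     (\<forall>i\<ge>1. \<forall>j\<ge>1. e i \<bullet> e j = (if i = j then 1 else 0)) \<and>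
     closure (span (e ` {1..})) = UNIV"

definition symmetric_matrix :: "(nat \<Rightarrow> nat \<Rightarrow> real) \<Rightarrow> bool" where
  "symmetric_matrix \<sigma> \<longleftrightarrow> (\<forall>i\<ge>1. \<forall>j\<ge>1. \<sigma> i j = \<sigma> j i)"

definition nonneg_definite :: "(nat \<Rightarrow> nat \<Rightarrow> real) \<Rightarrow> bool" where
  "nonneg_definite \<sigma> \<longleftrightarrow>
     (\<forall>m\<ge>1. \<forall>r::nat \<Rightarrow> real. 0 \<le> (\<Sum>i=1..m. \<Sum>j=1..m. r i * r j * \<sigma> i j))"

definition finite_trace :: "(nat \<Rightarrow> nat \<Rightarrow> real) \<Rightarrow> bool" where
  "finite_trace \<sigma> \<longleftrightarrow> (\<lambda>i. \<sigma> i i) summable_on {1..}"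

definition centered_normal :: "'w measure \<Rightarrow> ('w \<Rightarrow> real) \<Rightarrow> bool" where
  "centered_normal M Z \<longleftrightarrow>
     Z \<in> borel_measurable M \<and>
     ((AE x in M. Z x = 0) \<or> (\<exists>s>0. distributed M lborel Z (normal_density 0 s)))"

text \<open>\<open>\<nu>\<close> is the law $N(0_H,\sigma)$: the underlying random variable is taken to be the
  identity on \<open>H\<close>.\<close>

definition is_normal_law ::
  "(nat \<Rightarrow> 'h::real_inner) \<Rightarrow> (nat \<Rightarrow> nat \<Rightarrow> real) \<Rightarrow> 'h measure \<Rightarrow> bool" where
  "is_normal_law e \<sigma> \<nu> \<longleftrightarrow>
     prob_space \<nu> \<and> sets \<nu> = sets borel \<and>
     (\<forall>m\<ge>1. \<forall>r::nat \<Rightarrow> real. centered_normal \<nu> (\<lambda>y. \<Sum>i=1..m. r i * (y \<bullet> e i))) \<and>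
     (\<forall>i\<ge>1. \<forall>j\<ge>1. (\<integral>y. (y \<bullet> e i) * (y \<bullet> e j) \<partial>\<nu>) = \<sigma> i j)"

text \<open>Convergence in distribution along a filter, by bounded continuous test functions.\<close>

definition conv_in_distr ::
  "'w measure \<Rightarrow> ('l \<Rightarrow> 'w \<Rightarrow> 'h::topological_space) \<Rightarrow> 'h measure \<Rightarrow> 'l filter \<Rightarrow> bool" where
  "conv_in_distr M Z \<nu> F \<longleftrightarrow>
     (\<forall>f::'h \<Rightarrow> real. continuous_on UNIV f \<and> bounded (range f) \<longrightarrow>
        ((\<lambda>L. \<integral>\<omega>. f (Z L \<omega>) \<partial>M) \<longlongrightarrow> (\<integral>y. f y \<partial>\<nu>)) F)"

end

theory Submission imports Defs begin

text \<open>Mixing without a rate means that \<open>rho n\<close> can be made as small as one likes by taking the distance \<open>n\<close>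
large; the proof rests on this and on taking limits in the right order.

The basic tool is a comparison of variances. If \<open>f\<close> and \<open>g\<close> are centred with correlation at most
\<open>r < 1\<close>, then the second moments of \<open>f + g\<close> and \<open>f - g\<close> differ by a factor of at most
\<open>(1 + r) / (1 - r)\<close>. Apply this to a sum of blocks, every two disjoint groups of which have correlation
at most \<open>r\<close>, and average over all choices of signs: the variance of the sum is, up to that factor, the
sum of the variances (\<open>sign_averaging\<close>, \<open>psum_variance_labelled\<close>). It matters here that the two
groups of blocks may be interlaced in an arbitrary way, which is what \<open>\<rho>'\<close>-mixing allows. Two
consequences follow. Slicing into residue classes and hyperplanes, one direction at a time, gives
\<open>E (S\<^sub>Q)\<^sup>2 \<le> C |Q| E (Y\<^sub>0)\<^sup>2\<close> for the sum \<open>S\<^sub>Q\<close> over any finite \<open>Q\<close> of the centred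
variables \<open>Y\<^sub>k = \<phi> (X k)\<close> (\<open>psum_variance_bound\<close>). And cutting one side of a
rectangle into slabs of length \<open>l\<close>, separated by gaps that are large but much shorter than \<open>l\<close>, shows
that the normalised variance hardly changes when that side is replaced by \<open>l\<close>; doing this in every
direction compares all large rectangles with one cube, so the normalised variances converge
(\<open>var_rect_tendsto\<close>).

For the central limit theorem of a real functional, cut the rectangle in a single direction into a
fixed number \<open>p\<close> of slabs with gaps of length \<open>g\<close> between them. The characteristic function of the sum
differs from the \<open>p\<close>-th power of that of one slab by at most \<open>4 p rho g\<close>, plus an error
that vanishes as the rectangle grows (\<open>slabs_decouple\<close>). One slab carries the fraction \<open>1 / p\<close> of the
variance, so its characteristic function is \<open>1 - t\<^sup>2 q / (2 p)\<close> up to an error \<open>o(1 / p)\<close> that is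
uniform in the rectangle (\<open>char_expansion\<close>). Letting first the rectangle and then \<open>g\<close> and \<open>p\<close> tend
to infinity yields \<open>exp (- t\<^sup>2 q / 2)\<close> (\<open>central_limit_real\<close>). The uniformity is that of the squared
normalised sums being uniformly integrable; it comes from truncation and a fourth moment bound for
bounded fields, which is proved by repeated halving (\<open>fourth_moment_spaced\<close>).

In the Hilbert space, the functionals \<open>x \<bullet> h\<close> are covered by the real case. The variance bound,
summed over the coordinates beyond \<open>m\<close>, makes the mean square distance of the normalised sums from
their projections onto the first \<open>m\<close> basis vectors small, uniformly in the rectangle. Hence it is enough to
have convergence of the characteristic functionals on the span of the basis
(\<open>bounded_continuous_convergence\<close>); the several-dimensional continuity theorem hidden in this step is
reduced to the one-dimensional theorem of Levy by using weighted measures. The limit law is constructed from a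
triangular factorisation of the covariance matrix and a sequence of independent standard normal variables
(\<open>normal_law_exists\<close>).\<close>

section \<open>Square-integrable random variables\<close>

text \<open>The leading coefficient \<open>b\<close> may vanish. Both the Cauchy--Schwarz inequality for integrals and the one for
nonnegative definite matrices are instances.\<close>

lemma quadratic_nonneg_imp_discriminant:
  fixes a b c :: real
  assumes "\<And>t. 0 \<le> a + 2 * t * c + t\<^sup>2 * b"
  shows "c\<^sup>2 \<le> a * b"
proof (cases "b = 0")
  case True
  have "c = 0"
  proof (rule ccontr)
    assume "c \<noteq> 0"
    with assms[of "- (a + 1) / (2 * c)"] True show False
      by (simp add: field_simps)
  qed
  with True show ?thesis by simp
next
  case False
  have "0 \<le> b"
  proof (rule ccontr)
    assume b: "\<not> 0 \<le> b"
    define t where "t = (2 * \<bar>c\<bar> + \<bar>a\<bar> + 1) / \<bar>b\<bar> + 1"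
    have t: "t \<ge> 1" "t * \<bar>b\<bar> = 2 * \<bar>c\<bar> + \<bar>a\<bar> + 1 + \<bar>b\<bar>"
      using b by (auto simp: t_def field_simps)
    have "t\<^sup>2 * b = - t * (t * \<bar>b\<bar>)"
      using b by (simp add: power2_eq_square)
    also have "\<dots> = - t * (2 * \<bar>c\<bar>) - t * (\<bar>a\<bar> + 1 + \<bar>b\<bar>)"
      unfolding t(2) by (simp add: algebra_simps)
    finally have "t\<^sup>2 * b = - t * (2 * \<bar>c\<bar>) - t * (\<bar>a\<bar> + 1 + \<bar>b\<bar>)" .
    moreover have "t * (\<bar>a\<bar> + 1 + \<bar>b\<bar>) \<ge> 1 * (\<bar>a\<bar> + 1 + \<bar>b\<bar>)"
      using t(1) by (intro mult_right_mono) auto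
    moreover have "t * c \<le> t * \<bar>c\<bar>"
      using t(1) by (intro mult_left_mono) auto
    moreover have "- t * (2 * \<bar>c\<bar>) = - 2 * (t * \<bar>c\<bar>)" "2 * t * c = 2 * (t * c)" by simp_all
    moreover have "1 * (\<bar>a\<bar> + 1 + \<bar>b\<bar>) > a" by simp
    ultimately have "a + 2 * t * c + t\<^sup>2 * b < 0" by (smt (verit))
    with assms[of t] show False by simp
  qed
  with False have b: "b > 0" by simp
  have "0 \<le> a + 2 * (- c / b) * c + (- c / b)\<^sup>2 * b" by (rule assms)
  also have "\<dots> = a - c\<^sup>2 / b" using b by (simp add: field_simps power2_eq_square)
  finally show ?thesis using b by (simp add: field_simps)
qed

definition l2norm :: "'a measure \<Rightarrow> ('a \<Rightarrow> real) \<Rightarrow> real" where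
  "l2norm M f = sqrt (\<integral>x. (f x)\<^sup>2 \<partial>M)"

lemma l2norm_nonneg [simp]: "0 \<le> l2norm M f"
  by (simp add: l2norm_def)

lemma l2norm_power2: "(l2norm M f)\<^sup>2 = (\<integral>x. (f x)\<^sup>2 \<partial>M)"
  by (simp add: l2norm_def)

lemma L2_realD:
  assumes "f \<in> L2_real M M"
  shows "f \<in> borel_measurable M" "integrable M (\<lambda>x. (f x)\<^sup>2)"
  using assms by (auto simp: L2_real_def)

lemma L2_realI:
  "f \<in> borel_measurable M \<Longrightarrow> integrable M (\<lambda>x. (f x)\<^sup>2) \<Longrightarrow> f \<in> L2_real M M"
  by (simp add: L2_real_def)

lemma integrable_L2_mult:
  assumes f: "f \<in> L2_real M M" and g: "g \<in> L2_real M M"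
  shows "integrable M (\<lambda>x. f x * g x)"
proof (rule Bochner_Integration.integrable_bound[of _ "\<lambda>x. (f x)\<^sup>2 + (g x)\<^sup>2"])
  note [measurable] = L2_realD(1)[OF f] L2_realD(1)[OF g]
  show "integrable M (\<lambda>x. (f x)\<^sup>2 + (g x)\<^sup>2)"
    using L2_realD(2)[OF f] L2_realD(2)[OF g] by simp
  show "(\<lambda>x. f x * g x) \<in> borel_measurable M" by measurable
  have "norm (f x * g x) \<le> norm ((f x)\<^sup>2 + (g x)\<^sup>2)" for x
  proof -
    have "2 * \<bar>f x\<bar> * \<bar>g x\<bar> \<le> \<bar>f x\<bar>\<^sup>2 + \<bar>g x\<bar>\<^sup>2" by (rule sum_squares_bound)
    moreover have "0 \<le> \<bar>f x\<bar> * \<bar>g x\<bar>" by simp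
    ultimately have "\<bar>f x\<bar> * \<bar>g x\<bar> \<le> (f x)\<^sup>2 + (g x)\<^sup>2"
      using power2_abs[of "f x"] power2_abs[of "g x"] by linarith
    then show ?thesis by (simp add: abs_mult)
  qed
  then show "AE x in M. norm (f x * g x) \<le> norm ((f x)\<^sup>2 + (g x)\<^sup>2)" by simp
qed

lemma L2_real_add:
  assumes f: "f \<in> L2_real M M" and g: "g \<in> L2_real M M"
  shows "(\<lambda>x. f x + g x) \<in> L2_real M M"
proof (rule L2_realI)
  note [measurable] = L2_realD(1)[OF f] L2_realD(1)[OF g]
  show "(\<lambda>x. f x + g x) \<in> borel_measurable M" by measurable
  have "integrable M (\<lambda>x. (f x)\<^sup>2 + (g x)\<^sup>2 + 2 * (f x * g x))"
    using L2_realD(2)[OF f] L2_realD(2)[OF g] integrable_L2_mult[OF f g] by simp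
  then show "integrable M (\<lambda>x. (f x + g x)\<^sup>2)"
    by (simp add: power2_sum mult.assoc)
qed

lemma L2_real_cmult:
  assumes f: "f \<in> L2_real M M"
  shows "(\<lambda>x. c * f x) \<in> L2_real M M"
proof (rule L2_realI)
  note [measurable] = L2_realD(1)[OF f]
  show "(\<lambda>x. c * f x) \<in> borel_measurable M" by measurable
  show "integrable M (\<lambda>x. (c * f x)\<^sup>2)"
    using L2_realD(2)[OF f] by (simp add: power_mult_distrib)
qed

lemma L2_real_diff:
  assumes f: "f \<in> L2_real M M" and g: "g \<in> L2_real M M"
  shows "(\<lambda>x. f x - g x) \<in> L2_real M M"
  using L2_real_add[OF f L2_real_cmult[OF g, of "-1"]] by simp

lemma L2_real_zero [simp]: "(\<lambda>x. 0) \<in> L2_real M M"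
  by (auto intro!: L2_realI)

lemma L2_real_sum:
  assumes "\<And>i. i \<in> A \<Longrightarrow> f i \<in> L2_real M M"
  shows "(\<lambda>x. \<Sum>i\<in>A. f i x) \<in> L2_real M M"
  using assms
  by (induction A rule: infinite_finite_induct) (auto intro: L2_real_add)

lemma l2norm_add_power2:
  assumes f: "f \<in> L2_real M M" and g: "g \<in> L2_real M M"
  shows "(\<integral>x. (f x + g x)\<^sup>2 \<partial>M) =
    (\<integral>x. (f x)\<^sup>2 \<partial>M) + (\<integral>x. (g x)\<^sup>2 \<partial>M) + 2 * (\<integral>x. f x * g x \<partial>M)"
proof -
  have "(\<integral>x. (f x + g x)\<^sup>2 \<partial>M) = (\<integral>x. (f x)\<^sup>2 + (g x)\<^sup>2 + 2 * (f x * g x) \<partial>M)"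
    by (simp add: power2_sum mult.assoc)
  also have "\<dots> = (\<integral>x. (f x)\<^sup>2 \<partial>M) + (\<integral>x. (g x)\<^sup>2 \<partial>M) + 2 * (\<integral>x. f x * g x \<partial>M)"
    using L2_realD(2)[OF f] L2_realD(2)[OF g] integrable_L2_mult[OF f g] by simp
  finally show ?thesis .
qed

lemma Cauchy_Schwarz_L2:
  assumes f: "f \<in> L2_real M M" and g: "g \<in> L2_real M M"
  shows "\<bar>\<integral>x. f x * g x \<partial>M\<bar> \<le> l2norm M f * l2norm M g"
proof -
  have "(\<integral>x. f x * g x \<partial>M)\<^sup>2 \<le> (\<integral>x. (f x)\<^sup>2 \<partial>M) * (\<integral>x. (g x)\<^sup>2 \<partial>M)"
  proof (rule quadratic_nonneg_imp_discriminant)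
    fix t
    have "0 \<le> (\<integral>x. (f x + t * g x)\<^sup>2 \<partial>M)" by simp
    also have "\<dots> = (\<integral>x. (f x)\<^sup>2 \<partial>M) + (\<integral>x. (t * g x)\<^sup>2 \<partial>M) + 2 * (\<integral>x. f x * (t * g x) \<partial>M)"
      by (rule l2norm_add_power2[OF f L2_real_cmult[OF g]])
    finally show "0 \<le> (\<integral>x. (f x)\<^sup>2 \<partial>M) + 2 * t * (\<integral>x. f x * g x \<partial>M) + t\<^sup>2 * (\<integral>x. (g x)\<^sup>2 \<partial>M)"
      by (simp add: power_mult_distrib mult.left_commute mult.assoc)
  qed
  also have "\<dots> = (l2norm M f * l2norm M g)\<^sup>2"
    by (simp add: power_mult_distrib l2norm_power2)
  finally show ?thesis
    by (metis abs_le_square_iff abs_of_nonneg l2norm_nonneg mult_nonneg_nonneg)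
qed

lemma l2norm_triangle:
  assumes f: "f \<in> L2_real M M" and g: "g \<in> L2_real M M"
  shows "l2norm M (\<lambda>x. f x + g x) \<le> l2norm M f + l2norm M g"
proof -
  have "(l2norm M (\<lambda>x. f x + g x))\<^sup>2 \<le> (l2norm M f + l2norm M g)\<^sup>2"
    unfolding power2_sum[of "l2norm M f"] l2norm_power2 l2norm_add_power2[OF f g]
    using Cauchy_Schwarz_L2[OF f g] by simp
  then show ?thesis by (rule power2_le_imp_le) simp
qed

lemma (in prob_space) L2_real_const [simp]: "(\<lambda>x. c) \<in> L2_real M M"
  by (auto intro!: L2_realI)

lemma (in prob_space) L2_real_integrable:
  assumes f: "f \<in> L2_real M M"
  shows "integrable M f"
  using integrable_L2_mult[OF f L2_real_const[of 1]] by simp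

lemma (in prob_space) abs_expectation_le_l2norm:
  assumes f: "f \<in> L2_real M M"
  shows "(\<integral>x. \<bar>f x\<bar> \<partial>M) \<le> l2norm M f"
proof -
  have "(\<lambda>x. \<bar>f x\<bar>) \<in> L2_real M M"
    using f by (auto simp: L2_real_def)
  from Cauchy_Schwarz_L2[OF this L2_real_const[of 1]] show ?thesis
    by (simp add: l2norm_def prob_space)
qed

lemma (in prob_space) L2_real_bounded:
  assumes "f \<in> borel_measurable M" "\<And>x. x \<in> space M \<Longrightarrow> \<bar>f x\<bar> \<le> B"
  shows "f \<in> L2_real M M"
proof (rule L2_realI)
  have "(f x)\<^sup>2 \<le> B\<^sup>2" if "x \<in> space M" for x
    using assms(2)[OF that] by (simp flip: abs_le_square_iff)
  then show "integrable M (\<lambda>x. (f x)\<^sup>2)"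
    using assms(1) by (intro integrable_const_bound[of _ "B\<^sup>2"] AE_I2) auto
qed fact

lemma (in prob_space) l2norm_bounded:
  assumes "f \<in> borel_measurable M" "\<And>x. x \<in> space M \<Longrightarrow> \<bar>f x\<bar> \<le> B" "0 \<le> B"
  shows "l2norm M f \<le> B"
proof -
  have "(\<integral>x. (f x)\<^sup>2 \<partial>M) \<le> (\<integral>x. B\<^sup>2 \<partial>M)"
    using assms(2,3) L2_realD(2)[OF L2_real_bounded[OF assms(1,2)]]
    by (intro integral_mono) (auto simp flip: abs_le_square_iff)
  then show ?thesis
    unfolding l2norm_def using \<open>0 \<le> B\<close> by (simp add: prob_space real_le_lsqrt)
qed

lemma (in prob_space) centred_L2:
  assumes f: "f \<in> L2_real M M"
  shows "(\<lambda>x. f x - expectation f) \<in> L2_real M M"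
    "covar M f f = (\<integral>x. (f x)\<^sup>2 \<partial>M) - (expectation f)\<^sup>2"
    "sqrt (covar M f f) \<le> l2norm M f"
proof -
  show "(\<lambda>x. f x - expectation f) \<in> L2_real M M"
    using L2_real_diff[OF f L2_real_const] .
  have "covar M f f = (\<integral>x. (f x)\<^sup>2 - 2 * expectation f * f x + (expectation f)\<^sup>2 \<partial>M)"
    unfolding covar_def by (intro Bochner_Integration.integral_cong) (auto simp: power2_eq_square algebra_simps)
  also have "\<dots> = (\<integral>x. (f x)\<^sup>2 \<partial>M) - (expectation f)\<^sup>2"
    using L2_realD(2)[OF f] L2_real_integrable[OF f] by (simp add: prob_space power2_eq_square)
  finally show *: "covar M f f = (\<integral>x. (f x)\<^sup>2 \<partial>M) - (expectation f)\<^sup>2" .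
  show "sqrt (covar M f f) \<le> l2norm M f"
    unfolding * l2norm_def by simp
qed

lemma (in prob_space) covar_eq:
  assumes f: "f \<in> L2_real M M" and g: "g \<in> L2_real M M"
  shows "covar M f g = (\<integral>x. f x * g x \<partial>M) - expectation f * expectation g"
proof -
  have "covar M f g = (\<integral>x. f x * g x - expectation f * g x - expectation g * f x
      + expectation f * expectation g \<partial>M)"
    unfolding covar_def by (intro Bochner_Integration.integral_cong) (auto simp: algebra_simps)
  also have "\<dots> = (\<integral>x. f x * g x \<partial>M) - expectation f * expectation g"
    using integrable_L2_mult[OF f g] L2_real_integrable[OF f] L2_real_integrable[OF g]
    by (simp add: prob_space)
  finally show ?thesis .
qed

lemma (in prob_space) abs_covar_le:
  assumes f: "f \<in> L2_real M M" and g: "g \<in> L2_real M M"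
  shows "\<bar>covar M f g\<bar> \<le> sqrt (covar M f f) * sqrt (covar M g g)"
  using Cauchy_Schwarz_L2[OF centred_L2(1)[OF f] centred_L2(1)[OF g]]
  by (simp add: covar_def l2norm_def power2_eq_square)

text \<open>Bounds the suprema that define the mixing coefficients, so that they are suprema of bounded sets.\<close>

lemma (in prob_space) abs_corr_le_1:
  assumes f: "f \<in> L2_real M M" and g: "g \<in> L2_real M M"
  shows "\<bar>corr M f g\<bar> \<le> 1"
proof (cases "sqrt (covar M f f) * sqrt (covar M g g) = 0")
  case False
  moreover have "sqrt (covar M f f) * sqrt (covar M g g) \<ge> 0"
    using abs_covar_le[OF f g] by linarith
  ultimately have "sqrt (covar M f f) * sqrt (covar M g g) > 0" by linarith
  then show ?thesis
    using abs_covar_le[OF f g] unfolding corr_def abs_divide by simp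
next
  case True
  then show ?thesis unfolding corr_def by (simp only: div_by_0 abs_zero zero_le_one)
qed

section \<open>Averaging over signs\<close>

text \<open>Summed over all choices of signs, the mixed products cancel. The shift \<open>z\<close> is needed for the
induction: adding an index shifts by plus or minus its value.\<close>

lemma sum_Pow_signed_squares:
  fixes x :: "'a \<Rightarrow> real"
  assumes "finite J"
  shows "(\<Sum>A\<in>Pow J. (z + sum x A - sum x (J - A))\<^sup>2) = 2 ^ card J * (z\<^sup>2 + (\<Sum>j\<in>J. (x j)\<^sup>2))"
  using assms
proof (induction J arbitrary: z rule: finite_induct)
  case (insert a J)
  have inj: "inj_on (insert a) (Pow J)"
    using insert.hyps by (auto simp: inj_on_def)
  have "(\<Sum>A\<in>Pow (insert a J). (z + sum x A - sum x (insert a J - A))\<^sup>2)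
      = (\<Sum>A\<in>Pow J. (z + sum x A - sum x (insert a J - A))\<^sup>2)
        + (\<Sum>A\<in>Pow J. (z + sum x (insert a A) - sum x (insert a J - insert a A))\<^sup>2)"
    unfolding Pow_insert using insert.hyps
    by (subst sum.union_disjoint) (auto simp: sum.reindex[OF inj])
  also have "(\<Sum>A\<in>Pow J. (z + sum x A - sum x (insert a J - A))\<^sup>2)
      = (\<Sum>A\<in>Pow J. ((z - x a) + sum x A - sum x (J - A))\<^sup>2)"
  proof (rule sum.cong[OF refl])
    fix A assume A: "A \<in> Pow J"
    then have "insert a J - A = insert a (J - A)" "a \<notin> J - A" "finite (J - A)"
      using insert.hyps by auto
    then show "(z + sum x A - sum x (insert a J - A))\<^sup>2 = ((z - x a) + sum x A - sum x (J - A))\<^sup>2"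
      by (simp add: algebra_simps)
  qed
  also have "(\<Sum>A\<in>Pow J. (z + sum x (insert a A) - sum x (insert a J - insert a A))\<^sup>2)
      = (\<Sum>A\<in>Pow J. ((z + x a) + sum x A - sum x (J - A))\<^sup>2)"
  proof (rule sum.cong[OF refl])
    fix A assume A: "A \<in> Pow J"
    then have "insert a J - insert a A = J - A" "a \<notin> A" "finite A"
      using insert.hyps by (auto intro: finite_subset)
    then show "(z + sum x (insert a A) - sum x (insert a J - insert a A))\<^sup>2
        = ((z + x a) + sum x A - sum x (J - A))\<^sup>2"
      by (simp add: algebra_simps)
  qed
  finally show ?case
    using insert.hyps unfolding insert.IH
    by (simp add: power2_sum power2_diff algebra_simps)
qed auto

text \<open>If \<open>c\<close> is the scalar product of the parts of the sum over \<open>A\<close> and over \<open>J - A\<close>, whose second moments are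
\<open>a\<close> and \<open>b\<close>, then the decorrelation hypothesis gives \<open>2 |c| \<le> r (a + b)\<close>. So the second moment
\<open>a + b + 2 c\<close> of the sum and the second moment \<open>a + b - 2 c\<close> of the sum with the signs changed
outside \<open>A\<close> are within the factor \<open>(1 + r) / (1 - r)\<close> of each other. Averaging over \<open>A\<close> turns the
latter into \<open>D\<close>.\<close>

lemma sign_averaging:
  assumes J: "finite J" and r: "0 \<le> r" "r < 1"
    and L2: "\<And>j. j \<in> J \<Longrightarrow> x j \<in> L2_real M M"
    and dec: "\<And>A. A \<subseteq> J \<Longrightarrow>
      \<bar>\<integral>w. (\<Sum>j\<in>A. x j w) * (\<Sum>j\<in>J - A. x j w) \<partial>M\<bar>
        \<le> r * l2norm M (\<lambda>w. \<Sum>j\<in>A. x j w) * l2norm M (\<lambda>w. \<Sum>j\<in>J - A. x j w)"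
  defines "V \<equiv> (\<integral>w. (\<Sum>j\<in>J. x j w)\<^sup>2 \<partial>M)" and "D \<equiv> (\<Sum>j\<in>J. \<integral>w. (x j w)\<^sup>2 \<partial>M)"
  shows "V \<le> (1 + r) / (1 - r) * D" and "D \<le> (1 + r) / (1 - r) * V"
proof -
  define W where "W A = (\<integral>w. ((\<Sum>j\<in>A. x j w) - (\<Sum>j\<in>J - A. x j w))\<^sup>2 \<partial>M)" for A
  have W: "(1 - r) * V \<le> (1 + r) * W A \<and> (1 - r) * W A \<le> (1 + r) * V" if A: "A \<subseteq> J" for A
  proof -
    let ?f = "\<lambda>w. \<Sum>j\<in>A. x j w" and ?g = "\<lambda>w. \<Sum>j\<in>J - A. x j w"
    have f: "?f \<in> L2_real M M" and g: "?g \<in> L2_real M M"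
      using A by (auto intro!: L2_real_sum L2)
    define a where "a = (\<integral>w. (?f w)\<^sup>2 \<partial>M)"
    define b where "b = (\<integral>w. (?g w)\<^sup>2 \<partial>M)"
    define c where "c = (\<integral>w. ?f w * ?g w \<partial>M)"
    have "(\<Sum>j\<in>J. x j w) = ?f w + ?g w" for w
      using sum.subset_diff[OF A J, of "\<lambda>j. x j w"] by simp
    then have V: "V = a + b + 2 * c"
      unfolding V_def a_def b_def c_def by (simp add: l2norm_add_power2[OF f g])
    have W: "W A = a + b - 2 * c"
      unfolding W_def a_def b_def c_def
      using l2norm_add_power2[OF f L2_real_cmult[OF g, of "-1"]] by simp
    have "2 * \<bar>c\<bar> \<le> r * (2 * l2norm M ?f * l2norm M ?g)"
      using dec[OF A] unfolding c_def by simp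
    also have "\<dots> \<le> r * ((l2norm M ?f)\<^sup>2 + (l2norm M ?g)\<^sup>2)"
      using r by (intro mult_left_mono sum_squares_bound) auto
    finally have c: "2 * \<bar>c\<bar> \<le> r * (a + b)"
      by (simp add: l2norm_power2 a_def b_def)
    show ?thesis
      unfolding V W using c by (auto simp: algebra_simps abs_le_iff)
  qed
  have sumW: "(\<Sum>A\<in>Pow J. W A) = 2 ^ card J * D"
  proof -
    have "(\<Sum>A\<in>Pow J. W A)
        = (\<integral>w. (\<Sum>A\<in>Pow J. ((\<Sum>j\<in>A. x j w) - (\<Sum>j\<in>J - A. x j w))\<^sup>2) \<partial>M)"
      unfolding W_def
      by (rule Bochner_Integration.integral_sum[symmetric])
        (auto intro!: L2_realD(2) L2_real_diff L2_real_sum L2)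
    also have "\<dots> = (\<integral>w. 2 ^ card J * (\<Sum>j\<in>J. (x j w)\<^sup>2) \<partial>M)"
      using sum_Pow_signed_squares[OF J, of 0] by simp
    also have "\<dots> = 2 ^ card J * D"
      unfolding D_def using L2_realD(2)[OF L2] by simp
    finally show ?thesis .
  qed
  have cardP: "real (card (Pow J)) = 2 ^ card J" using J by (simp add: card_Pow)
  have avg: "2 ^ card J * a = (\<Sum>A\<in>Pow J. a)" for a :: real
    by (simp add: cardP)
  have "2 ^ card J * ((1 - r) * V) \<le> (\<Sum>A\<in>Pow J. (1 + r) * W A)"
    unfolding avg using W by (intro sum_mono) auto
  also have "\<dots> = 2 ^ card J * ((1 + r) * D)"
    unfolding sum_distrib_left[symmetric] sumW by simp
  finally have "(1 - r) * V \<le> (1 + r) * D" by simp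
  then show "V \<le> (1 + r) / (1 - r) * D"
    using r by (simp add: field_simps)
  have "(1 - r) * (2 ^ card J * D) = (\<Sum>A\<in>Pow J. (1 - r) * W A)"
    unfolding sum_distrib_left[symmetric] sumW by simp
  also have "\<dots> \<le> 2 ^ card J * ((1 + r) * V)"
    unfolding avg using W by (intro sum_mono) auto
  finally have "2 ^ card J * ((1 - r) * D) \<le> 2 ^ card J * ((1 + r) * V)"
    by (simp only: mult.left_commute)
  then have "(1 - r) * D \<le> (1 + r) * V" by simp
  then show "D \<le> (1 + r) / (1 - r) * V"
    using r by (simp add: field_simps)
qed

section \<open>Random fields that mix\<close>

locale mixing_field = prob_space M
  for M :: "'w measure" +
  fixes X :: "int ^ 'd \<Rightarrow> 'w \<Rightarrow> 'h::topological_space"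
  assumes X_measurable [measurable]: "\<And>k. X k \<in> borel_measurable M"
    and stationary: "strictly_stationary M X"
    and mixing: "rho_prime_mixing M X"
begin

abbreviation rho :: "nat \<Rightarrow> real" where
  "rho n \<equiv> rho_prime M X n"

definition psum :: "('h \<Rightarrow> real) \<Rightarrow> (int ^ 'd) set \<Rightarrow> 'w \<Rightarrow> real" where
  "psum \<phi> Q w = (\<Sum>k\<in>Q. \<phi> (X k w))"

definition centred :: "('h \<Rightarrow> real) \<Rightarrow> bool" where
  "centred \<phi> \<longleftrightarrow> \<phi> \<in> borel_measurable borel \<and> (\<lambda>w. \<phi> (X 0 w)) \<in> L2_real M M
     \<and> (\<integral>w. \<phi> (X 0 w) \<partial>M) = 0"

definition variance0 :: "('h \<Rightarrow> real) \<Rightarrow> real" where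
  "variance0 \<phi> = (\<integral>w. (\<phi> (X 0 w))\<^sup>2 \<partial>M)"

lemma variance0_nonneg [simp]: "0 \<le> variance0 \<phi>"
  by (simp add: variance0_def)

lemma centredD:
  assumes "centred \<phi>"
  shows "\<phi> \<in> borel_measurable borel" "(\<lambda>w. \<phi> (X 0 w)) \<in> L2_real M M"
    "(\<integral>w. \<phi> (X 0 w) \<partial>M) = 0"
  using assms by (auto simp: centred_def)

lemma psum_empty [simp]: "psum \<phi> {} w = 0"
  by (simp add: psum_def)

lemma psum_Un_disjoint:
  "finite Q \<Longrightarrow> finite S \<Longrightarrow> Q \<inter> S = {} \<Longrightarrow> psum \<phi> (Q \<union> S) w = psum \<phi> Q w + psum \<phi> S w"
  unfolding psum_def by (rule sum.union_disjoint)

lemma psum_group: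
  assumes "finite Q" "finite T" "c ` Q \<subseteq> T"
  shows "psum \<phi> Q w = (\<Sum>j\<in>T. psum \<phi> {k \<in> Q. c k = j} w)"
  unfolding psum_def by (rule sum.group[OF assms, symmetric])

lemma psum_measurable [measurable]:
  "\<phi> \<in> borel_measurable borel \<Longrightarrow> psum \<phi> Q \<in> borel_measurable M"
  unfolding psum_def[abs_def]
  by (intro borel_measurable_sum measurable_compose[OF X_measurable])

subsection \<open>The generated fields and the mixing inequality\<close>

lemma generators_subset_sets:
  "(\<Union>k\<in>Q. {X k -` A \<inter> space M | A. A \<in> sets borel}) \<subseteq> sets M"
  by (auto intro: measurable_sets)

lemma generators_subset_Pow:
  "(\<Union>k\<in>Q. {X k -` A \<inter> space M | A. A \<in> sets borel}) \<subseteq> Pow (space M)"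
  by auto

lemma space_sigma_gen_by: "space (sigma_gen_by M X Q) = space M"
  unfolding sigma_gen_by_def by (rule space_measure_of[OF generators_subset_Pow])

lemma sets_sigma_gen_by_subset: "sets (sigma_gen_by M X Q) \<subseteq> sets M"
  unfolding sigma_gen_by_def sets_measure_of[OF generators_subset_Pow]
  by (rule sets.sigma_sets_subset[OF generators_subset_sets])

lemma borel_measurable_sigma_gen_by:
  "f \<in> measurable (sigma_gen_by M X Q) N \<Longrightarrow> f \<in> measurable M N"
  by (erule measurable_from_subalg[rotated])
    (simp only: subalgebra_def space_sigma_gen_by sets_sigma_gen_by_subset simp_thms)

lemma X_measurable_sigma_gen_by:
  assumes "k \<in> Q"
  shows "X k \<in> borel_measurable (sigma_gen_by M X Q)"
proof (rule measurableI)
  fix A :: "'h set" assume "A \<in> sets borel"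
  then have "X k -` A \<inter> space M \<in> sets (sigma_gen_by M X Q)"
    unfolding sigma_gen_by_def using assms
    by (intro in_measure_of[OF generators_subset_Pow]) blast
  then show "X k -` A \<inter> space (sigma_gen_by M X Q) \<in> sets (sigma_gen_by M X Q)"
    by (simp add: space_sigma_gen_by)
qed auto

lemma psum_measurable_sigma_gen_by:
  assumes "Q' \<subseteq> Q" "\<phi> \<in> borel_measurable borel"
  shows "psum \<phi> Q' \<in> borel_measurable (sigma_gen_by M X Q)"
  unfolding psum_def[abs_def]
  using assms by (intro borel_measurable_sum measurable_compose[OF X_measurable_sigma_gen_by]) auto

lemma L2_real_sigma_gen_by: "f \<in> L2_real M (sigma_gen_by M X Q) \<Longrightarrow> f \<in> L2_real M M"
  by (auto simp: L2_real_def borel_measurable_sigma_gen_by)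

lemma max_corr_props:
  fixes Q S :: "(int ^ 'd) set"
  defines "R \<equiv> {\<bar>corr M f g\<bar> | f g. f \<in> L2_real M (sigma_gen_by M X Q) \<and> g \<in> L2_real M (sigma_gen_by M X S)}"
  shows "bdd_above R" "R \<noteq> {}" "max_corr M (sigma_gen_by M X Q) (sigma_gen_by M X S) \<le> 1"
    "0 \<le> max_corr M (sigma_gen_by M X Q) (sigma_gen_by M X S)"
proof -
  have le1: "x \<le> 1" if "x \<in> R" for x
    using that abs_corr_le_1 by (auto simp: R_def dest: L2_real_sigma_gen_by)
  then show bdd: "bdd_above R" by (rule bdd_aboveI)
  have "\<bar>corr M (\<lambda>_. 0) (\<lambda>_. 0)\<bar> \<in> R"
    unfolding R_def by (fastforce simp: L2_real_def)
  then have *: "0 \<in> R" by (simp add: corr_def covar_def)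
  then show ne: "R \<noteq> {}" by auto
  show "max_corr M (sigma_gen_by M X Q) (sigma_gen_by M X S) \<le> 1"
    unfolding max_corr_def using cSup_least[OF ne le1] unfolding R_def by simp
  show "0 \<le> max_corr M (sigma_gen_by M X Q) (sigma_gen_by M X S)"
    unfolding max_corr_def using cSup_upper[OF * bdd] unfolding R_def by simp
qed

lemma max_corr_le_rho:
  assumes "separated_sets n Q S"
  shows "max_corr M (sigma_gen_by M X Q) (sigma_gen_by M X S) \<le> rho n"
  unfolding rho_prime_def
  using assms max_corr_props(3) by (intro cSup_upper bdd_aboveI[of _ 1]) auto

text \<open>The coordinates of the two sets in direction \<open>u\<close> serve as the separating sets \<open>A\<close> and \<open>B\<close>.\<close>

lemma separated_setsI:
  assumes "finite Q" "finite S" "Q \<noteq> {}" "S \<noteq> {}"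
    and "\<And>k l. k \<in> Q \<Longrightarrow> l \<in> S \<Longrightarrow> k $ u \<noteq> l $ u \<and> int n \<le> \<bar>k $ u - l $ u\<bar>"
  shows "separated_sets n Q S"
  unfolding separated_sets_def
proof (intro conjI exI)
  let ?A = "(\<lambda>k. real_of_int (k $ u)) ` Q" and ?B = "(\<lambda>k. real_of_int (k $ u)) ` S"
  show "?A \<inter> ?B = {}" using assms(5) by auto
  show "real n \<le> setdist ?A ?B"
  proof (rule le_setdistI)
    fix x y assume "x \<in> ?A" "y \<in> ?B"
    then obtain k l where kl: "k \<in> Q" "l \<in> S" "x = real_of_int (k $ u)" "y = real_of_int (l $ u)"
      by auto
    then have "int n \<le> \<bar>k $ u - l $ u\<bar>" using assms(5) by auto
    then have "real_of_int (int n) \<le> real_of_int \<bar>k $ u - l $ u\<bar>" by (simp only: of_int_le_iff)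
    then show "real n \<le> dist x y" by (simp add: kl dist_real_def)
  qed (use assms in auto)
  show "Q \<inter> S = {}" using assms(5) by auto
qed (use assms in auto)

lemma rho_nonneg: "0 \<le> rho n"
proof -
  define k :: "int ^ 'd" where "k = (\<chi> u. int n + 1)"
  have "separated_sets n {0} {k}"
    by (rule separated_setsI) (auto simp: k_def)
  from max_corr_le_rho[OF this] max_corr_props(4) show ?thesis by (rule order_trans[rotated])
qed

lemma abs_covar_le_rho:
  assumes sep: "separated_sets n Q S"
    and f: "f \<in> L2_real M (sigma_gen_by M X Q)" and g: "g \<in> L2_real M (sigma_gen_by M X S)"
  shows "\<bar>covar M f g\<bar> \<le> rho n * (sqrt (covar M f f) * sqrt (covar M g g))"
proof (cases "sqrt (covar M f f) * sqrt (covar M g g) = 0")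
  case True
  then show ?thesis
    using abs_covar_le[OF L2_real_sigma_gen_by[OF f] L2_real_sigma_gen_by[OF g]] by (simp only: mult_zero_right)
next
  case False
  have "0 \<le> sqrt (covar M f f) * sqrt (covar M g g)"
    using abs_covar_le[OF L2_real_sigma_gen_by[OF f] L2_real_sigma_gen_by[OF g]] by linarith
  with False have pos: "0 < sqrt (covar M f f) * sqrt (covar M g g)" by linarith
  have "\<bar>corr M f g\<bar> \<le> max_corr M (sigma_gen_by M X Q) (sigma_gen_by M X S)"
    unfolding max_corr_def using max_corr_props(1) f g by (intro cSup_upper) auto
  also have "\<dots> \<le> rho n" by (rule max_corr_le_rho[OF sep])
  finally show ?thesis
    using pos unfolding corr_def abs_divide by (simp add: pos_divide_le_eq)
qed

text \<open>The form in which mixing is used. Second moments about zero replace variances, and a degenerate \<open>f\<close> or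
\<open>g\<close> is harmless because its covariance with everything vanishes.\<close>

lemma mixing_inequality:
  assumes sep: "separated_sets n Q S"
    and f: "f \<in> L2_real M (sigma_gen_by M X Q)" and g: "g \<in> L2_real M (sigma_gen_by M X S)"
  shows "\<bar>(\<integral>w. f w * g w \<partial>M) - expectation f * expectation g\<bar> \<le> rho n * (l2norm M f * l2norm M g)"
proof -
  note f' = L2_real_sigma_gen_by[OF f] and g' = L2_real_sigma_gen_by[OF g]
  have "\<bar>(\<integral>w. f w * g w \<partial>M) - expectation f * expectation g\<bar> = \<bar>covar M f g\<bar>"
    by (simp add: covar_eq[OF f' g'])
  also have "\<dots> \<le> rho n * (sqrt (covar M f f) * sqrt (covar M g g))"
    by (rule abs_covar_le_rho[OF assms])
  also have "\<dots> \<le> rho n * (l2norm M f * l2norm M g)"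
  proof (intro mult_left_mono mult_mono centred_L2 f' g' rho_nonneg)
    have "0 \<le> covar M g g" unfolding covar_def by simp
    then show "0 \<le> sqrt (covar M g g)" by simp
  qed simp
  finally show ?thesis .
qed

lemma rho_small:
  assumes "0 < e"
  obtains n where "1 \<le> n" "rho n < e"
proof -
  have "(\<lambda>n. rho n) \<longlonglongrightarrow> 0" using mixing by (simp add: rho_prime_mixing_def)
  then have "eventually (\<lambda>n. rho n < e) sequentially"
    using order_tendstoD(2)[of _ 0] assms by auto
  then have "eventually (\<lambda>n. 1 \<le> n \<and> rho n < e) sequentially"
    using eventually_ge_at_top[of 1] by eventually_elim auto
  then show ?thesis using that by (auto simp: eventually_sequentially)
qed

subsection \<open>Stationarity\<close>

text \<open>Stationarity enters the proof through this equality of laws: a sum over a translate of \<open>Q\<close> is a fixed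
measurable function of the translated variables.\<close>

lemma distr_psum_translate:
  assumes \<phi>: "\<phi> \<in> borel_measurable borel" and Q: "finite Q"
  shows "distr M borel (psum \<phi> ((\<lambda>k. k + h) ` Q)) = distr M borel (psum \<phi> Q)"
proof -
  let ?P = "PiM Q (\<lambda>_. borel :: 'h measure)"
  let ?F = "\<lambda>x. \<Sum>k\<in>Q. \<phi> (x k)"
  have F: "?F \<in> borel_measurable ?P"
    by (intro borel_measurable_sum measurable_compose[OF _ \<phi>]) (rule measurable_component_singleton)
  have meas: "(\<lambda>w. \<lambda>k\<in>Q. X (k + h') w) \<in> measurable M ?P" for h'
    by (rule measurable_restrict) simp
  have eq: "distr M borel (\<lambda>w. \<Sum>k\<in>Q. \<phi> (X (k + h') w))
      = distr (distr M ?P (\<lambda>w. \<lambda>k\<in>Q. X (k + h') w)) borel ?F" for h'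
    by (subst distr_distr[OF F meas]) (intro distr_cong refl, auto intro!: sum.cong)
  have "psum \<phi> ((\<lambda>k. k + h) ` Q) = (\<lambda>w. \<Sum>k\<in>Q. \<phi> (X (k + h) w))"
    unfolding psum_def by (auto simp: sum.reindex inj_on_def)
  then have "distr M borel (psum \<phi> ((\<lambda>k. k + h) ` Q)) = distr (distr M ?P (\<lambda>w. \<lambda>k\<in>Q. X (k + h) w)) borel ?F"
    using eq[of h] by simp
  also have "distr M ?P (\<lambda>w. \<lambda>k\<in>Q. X (k + h) w) = distr M ?P (\<lambda>w. \<lambda>k\<in>Q. X (k + 0) w)"
    using stationary Q unfolding strictly_stationary_def by simp
  also have "distr \<dots> borel ?F = distr M borel (psum \<phi> Q)"
    using eq[of 0] by (simp add: psum_def[abs_def])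
  finally show ?thesis .
qed

lemma integral_psum_translate:
  fixes F :: "real \<Rightarrow> 'b::{banach, second_countable_topology}"
  assumes \<phi>: "\<phi> \<in> borel_measurable borel" and Q: "finite Q" and F: "F \<in> borel_measurable borel"
  shows "(\<integral>w. F (psum \<phi> ((\<lambda>k. k + h) ` Q) w) \<partial>M) = (\<integral>w. F (psum \<phi> Q w) \<partial>M)"
proof -
  have "(\<integral>w. F (psum \<phi> S w) \<partial>M) = integral\<^sup>L (distr M borel (psum \<phi> S)) F" for S
    by (rule integral_distr[OF psum_measurable[OF \<phi>] F, symmetric])
  then show ?thesis by (simp only: distr_psum_translate[OF \<phi> Q])
qed

lemma distr_X_eq:
  fixes \<phi> :: "'h \<Rightarrow> real"
  assumes \<phi>: "\<phi> \<in> borel_measurable borel"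
  shows "distr M borel (\<lambda>w. \<phi> (X k w)) = distr M borel (\<lambda>w. \<phi> (X 0 w))"
  using distr_psum_translate[OF \<phi>, of "{0}" k, simplified] by (simp add: psum_def[abs_def])

lemma centred_X:
  assumes \<phi>: "centred \<phi>"
  shows "(\<lambda>w. \<phi> (X k w)) \<in> L2_real M M" "(\<integral>w. \<phi> (X k w) \<partial>M) = 0"
    "(\<integral>w. (\<phi> (X k w))\<^sup>2 \<partial>M) = variance0 \<phi>"
proof -
  note [measurable] = centredD(1)[OF \<phi>]
  have m: "(\<lambda>w. \<phi> (X k w)) \<in> borel_measurable M" for k by measurable
  note eq = distr_X_eq[OF centredD(1)[OF \<phi>], of k]
  have "integrable (distr M borel (\<lambda>w. \<phi> (X 0 w))) (\<lambda>x. x\<^sup>2)"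
    using L2_realD(2)[OF centredD(2)[OF \<phi>]] m by (subst integrable_distr_eq) auto
  then have "integrable M (\<lambda>w. (\<phi> (X k w))\<^sup>2)"
    unfolding eq[symmetric] using m by (subst (asm) integrable_distr_eq) auto
  then show "(\<lambda>w. \<phi> (X k w)) \<in> L2_real M M"
    using m by (intro L2_realI)
  have "(\<integral>w. F (\<phi> (X k w)) \<partial>M) = (\<integral>w. F (\<phi> (X 0 w)) \<partial>M)"
    if "F \<in> borel_measurable borel" for F :: "real \<Rightarrow> real"
    using arg_cong[OF eq, of "\<lambda>N. integral\<^sup>L N F"]
    by (simp only: integral_distr[OF m that])
  from this[of "\<lambda>x. x"] this[of "\<lambda>x. x\<^sup>2"]
  show "(\<integral>w. \<phi> (X k w) \<partial>M) = 0" "(\<integral>w. (\<phi> (X k w))\<^sup>2 \<partial>M) = variance0 \<phi>"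
    using centredD(3)[OF \<phi>] by (simp_all add: variance0_def)
qed

lemma psum_L2: "centred \<phi> \<Longrightarrow> psum \<phi> Q \<in> L2_real M M"
  unfolding psum_def[abs_def] by (intro L2_real_sum centred_X)

lemma expectation_psum: "centred \<phi> \<Longrightarrow> expectation (psum \<phi> Q) = 0"
  unfolding psum_def[abs_def]
  by (subst Bochner_Integration.integral_sum) (auto intro: L2_real_integrable centred_X simp: centred_X)

lemma psum_L2_sigma_gen_by:
  "centred \<phi> \<Longrightarrow> Q' \<subseteq> Q \<Longrightarrow> psum \<phi> Q' \<in> L2_real M (sigma_gen_by M X Q)"
  using psum_L2[of \<phi> Q'] psum_measurable_sigma_gen_by[of Q' Q \<phi>] centredD(1)
  by (auto simp: L2_real_def)

section \<open>Variances of partial sums\<close>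

text \<open>The label \<open>c\<close> groups the hyperplanes orthogonal to direction \<open>u\<close> into blocks; different blocks are at
distance at least \<open>n\<close>. Any two disjoint groups of blocks are then separated sets, however they are interlaced,
which is exactly what averaging over signs requires. The identity label gives single hyperplanes, and
integer division by a period gives the slabs of a cut rectangle.\<close>

lemma psum_variance_labelled:
  assumes \<phi>: "centred \<phi>" and Q: "finite Q" and r: "rho n < 1"
    and c: "\<And>k l. k \<in> Q \<Longrightarrow> l \<in> Q \<Longrightarrow> c (k $ u) \<noteq> c (l $ u) \<Longrightarrow> int n \<le> \<bar>k $ u - l $ u\<bar>"
    and J: "finite J" "(\<lambda>k. c (k $ u)) ` Q \<subseteq> J"
  defines "V \<equiv> (\<integral>w. (psum \<phi> Q w)\<^sup>2 \<partial>M)"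
    and "D \<equiv> (\<Sum>j\<in>J. \<integral>w. (psum \<phi> {k \<in> Q. c (k $ u) = j} w)\<^sup>2 \<partial>M)"
  shows "V \<le> (1 + rho n) / (1 - rho n) * D" "D \<le> (1 + rho n) / (1 - rho n) * V"
proof -
  define x where "x j = psum \<phi> {k \<in> Q. c (k $ u) = j}" for j
  have sum_x: "(\<Sum>j\<in>A. x j w) = psum \<phi> {k \<in> Q. c (k $ u) \<in> A} w" if "A \<subseteq> J" for A w
  proof -
    have "psum \<phi> {k \<in> Q. c (k $ u) \<in> A} w
        = (\<Sum>j\<in>A. psum \<phi> {k \<in> {k \<in> Q. c (k $ u) \<in> A}. c (k $ u) = j} w)"
      using Q J that by (intro psum_group) (auto intro: finite_subset)
    also have "\<dots> = (\<Sum>j\<in>A. x j w)"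
      unfolding x_def by (intro sum.cong refl arg_cong[of _ _ "\<lambda>S. psum \<phi> S w"]) auto
    finally show ?thesis by simp
  qed
  have L2: "x j \<in> L2_real M M" for j
    unfolding x_def by (rule psum_L2[OF \<phi>])
  have dec: "\<bar>\<integral>w. (\<Sum>j\<in>A. x j w) * (\<Sum>j\<in>J - A. x j w) \<partial>M\<bar>
      \<le> rho n * l2norm M (\<lambda>w. \<Sum>j\<in>A. x j w) * l2norm M (\<lambda>w. \<Sum>j\<in>J - A. x j w)" if A: "A \<subseteq> J" for A
  proof -
    let ?Q = "{k \<in> Q. c (k $ u) \<in> A}" and ?S = "{k \<in> Q. c (k $ u) \<in> J - A}"
    show ?thesis
    proof (cases "?Q = {} \<or> ?S = {}")
      case True
      moreover have "psum \<phi> {} = (\<lambda>_. 0)" by (rule ext) simp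
      ultimately have "psum \<phi> ?Q = (\<lambda>_. 0) \<or> psum \<phi> ?S = (\<lambda>_. 0)"
        by (elim disjE) (simp_all only: simp_thms)
      then show ?thesis
        unfolding sum_x[OF A] sum_x[OF Diff_subset] by (auto simp: rho_nonneg)
    next
      case False
      have "separated_sets n ?Q ?S"
      proof (rule separated_setsI[of _ _ u])
        fix k l assume kl: "k \<in> ?Q" "l \<in> ?S"
        then have "c (k $ u) \<noteq> c (l $ u)" by auto
        with kl c show "k $ u \<noteq> l $ u \<and> int n \<le> \<bar>k $ u - l $ u\<bar>" by auto
      qed (use False Q in auto)
      from mixing_inequality[OF this psum_L2_sigma_gen_by[OF \<phi> order_refl] psum_L2_sigma_gen_by[OF \<phi> order_refl]]
      show ?thesis
        unfolding sum_x[OF A] sum_x[OF Diff_subset] by (simp add: expectation_psum[OF \<phi>] mult.assoc)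
    qed
  qed
  have "psum \<phi> Q w = (\<Sum>j\<in>J. x j w)" for w
    unfolding x_def using Q J by (rule psum_group)
  then have V: "V = (\<integral>w. (\<Sum>j\<in>J. x j w)\<^sup>2 \<partial>M)" by (simp add: V_def)
  have D: "D = (\<Sum>j\<in>J. \<integral>w. (x j w)\<^sup>2 \<partial>M)" by (simp add: D_def x_def)
  show "V \<le> (1 + rho n) / (1 - rho n) * D" "D \<le> (1 + rho n) / (1 - rho n) * V"
    unfolding V D using sign_averaging[OF J(1) rho_nonneg r L2 dec] by auto
qed

text \<open>Neighbouring hyperplanes may be strongly correlated. Those whose coordinates are congruent modulo \<open>g\<close>
are at distance at least \<open>g\<close>, so the labelled comparison applies to each of the \<open>g\<close> residue classes, with
factor \<open>(1 + 1/2) / (1 - 1/2) = 3\<close>; combining the classes costs another factor \<open>g\<close>.\<close>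

lemma psum_variance_slices:
  assumes g: "1 \<le> g" "rho g \<le> 1/2" and \<phi>: "centred \<phi>" and Q: "finite Q"
  shows "(\<integral>w. (psum \<phi> Q w)\<^sup>2 \<partial>M)
    \<le> 3 * real g * (\<Sum>j\<in>(\<lambda>k. k $ u) ` Q. \<integral>w. (psum \<phi> {k \<in> Q. k $ u = j} w)\<^sup>2 \<partial>M)"
proof -
  define J where "J = (\<lambda>k. k $ u) ` Q"
  define R where "R = {0..<int g}"
  define Qs where "Qs s = {k \<in> Q. k $ u mod int g = s}" for s
  define v where "v j = (\<integral>w. (psum \<phi> {k \<in> Q. k $ u = j} w)\<^sup>2 \<partial>M)" for j
  have fin: "finite J" "finite R" "finite (Qs s)" for s
    using Q by (auto simp: J_def R_def Qs_def)
  have R: "(\<lambda>k. k $ u mod int g) ` Q \<subseteq> R"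
    using g by (auto simp: R_def)
  have class_le: "(\<integral>w. (psum \<phi> (Qs s) w)\<^sup>2 \<partial>M) \<le> 3 * (\<Sum>j\<in>{j \<in> J. j mod int g = s}. v j)" for s
  proof -
    let ?J = "{j \<in> J. j mod int g = s}"
    have D: "(\<Sum>j\<in>?J. \<integral>w. (psum \<phi> {k \<in> Qs s. k $ u = j} w)\<^sup>2 \<partial>M) = (\<Sum>j\<in>?J. v j)"
      unfolding v_def
    proof (intro sum.cong refl)
      fix j assume "j \<in> ?J"
      then have "{k \<in> Qs s. k $ u = j} = {k \<in> Q. k $ u = j}" by (auto simp: Qs_def)
      then show "(\<integral>w. (psum \<phi> {k \<in> Qs s. k $ u = j} w)\<^sup>2 \<partial>M) = (\<integral>w. (psum \<phi> {k \<in> Q. k $ u = j} w)\<^sup>2 \<partial>M)"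
        by simp
    qed
    have sep: "int g \<le> \<bar>k $ u - l $ u\<bar>" if "k \<in> Qs s" "l \<in> Qs s" "k $ u \<noteq> l $ u" for k l
    proof -
      have "int g dvd k $ u - l $ u"
        using that unfolding mod_eq_dvd_iff[symmetric] by (simp add: Qs_def)
      then show ?thesis using that dvd_imp_le_int[of "k $ u - l $ u" "int g"] by simp
    qed
    have "(\<integral>w. (psum \<phi> (Qs s) w)\<^sup>2 \<partial>M) \<le> (1 + rho g) / (1 - rho g) * (\<Sum>j\<in>?J. v j)"
      unfolding D[symmetric]
      by (rule psum_variance_labelled(1)[OF \<phi> fin(3), where c = "\<lambda>j. j"])
        (use g sep fin in \<open>auto simp: J_def Qs_def\<close>)
    also have "\<dots> \<le> 3 * (\<Sum>j\<in>?J. v j)"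
      using g(2) rho_nonneg[of g] by (intro mult_right_mono sum_nonneg) (auto simp: divide_simps v_def)
    finally show ?thesis .
  qed
  have "(\<integral>w. (psum \<phi> Q w)\<^sup>2 \<partial>M) = (\<integral>w. (\<Sum>s\<in>R. psum \<phi> (Qs s) w)\<^sup>2 \<partial>M)"
    unfolding Qs_def using psum_group[OF Q fin(2) R] by simp
  also have "\<dots> \<le> (\<integral>w. (\<Sum>s\<in>R. (psum \<phi> (Qs s) w)\<^sup>2) * real (card R) \<partial>M)"
    using psum_L2[OF \<phi>]
    by (intro integral_mono sum_squared_le_sum_of_squares L2_realD(2) L2_real_sum
        Bochner_Integration.integrable_sum integrable_mult_left)
  also have "\<dots> = real g * (\<Sum>s\<in>R. \<integral>w. (psum \<phi> (Qs s) w)\<^sup>2 \<partial>M)"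
    using L2_realD(2)[OF psum_L2[OF \<phi>]] by (simp add: R_def)
  also have "\<dots> \<le> real g * (\<Sum>s\<in>R. 3 * (\<Sum>j\<in>{j \<in> J. j mod int g = s}. v j))"
    by (intro mult_left_mono sum_mono class_le) simp
  also have "\<dots> = 3 * real g * (\<Sum>j\<in>J. v j)"
    using sum.group[of J R "\<lambda>j. j mod int g" v] fin R
    by (simp add: J_def sum_distrib_left[symmetric] image_image mult.assoc)
  finally show ?thesis by (simp add: J_def v_def)
qed

text \<open>Slicing in every direction of \<open>D\<close> in turn reduces \<open>Q\<close> to single points, each step costing the factor
\<open>3 g\<close>.\<close>

lemma psum_variance_bound_aux:
  assumes g: "1 \<le> g" "rho g \<le> 1/2" and \<phi>: "centred \<phi>"
    and "finite D" "finite Q" "\<And>k l u. k \<in> Q \<Longrightarrow> l \<in> Q \<Longrightarrow> u \<notin> D \<Longrightarrow> k $ u = l $ u"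
  shows "(\<integral>w. (psum \<phi> Q w)\<^sup>2 \<partial>M) \<le> (3 * real g) ^ card D * real (card Q) * variance0 \<phi>"
  using assms(4-6)
proof (induction D arbitrary: Q rule: finite_induct)
  case empty
  have "k = l" if "k \<in> Q" "l \<in> Q" for k l
    unfolding vec_eq_iff using empty.prems(2)[OF that] by blast
  then have "Q = {} \<or> is_singleton Q" using is_singletonI'[of Q] by auto
  then consider "Q = {}" | k where "Q = {k}" by (auto simp: is_singleton_def)
  then show ?case
    by cases (auto simp: psum_def centred_X[OF \<phi>])
next
  case (insert u D)
  let ?J = "(\<lambda>k. k $ u) ` Q"
  have "(\<integral>w. (psum \<phi> Q w)\<^sup>2 \<partial>M)
      \<le> 3 * real g * (\<Sum>j\<in>?J. \<integral>w. (psum \<phi> {k \<in> Q. k $ u = j} w)\<^sup>2 \<partial>M)"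
    by (rule psum_variance_slices[OF g \<phi> insert.prems(1)])
  also have "\<dots> \<le> 3 * real g * (\<Sum>j\<in>?J. (3 * real g) ^ card D * real (card {k \<in> Q. k $ u = j}) * variance0 \<phi>)"
  proof (intro mult_left_mono sum_mono insert.IH)
    fix j k l v assume "k \<in> {k \<in> Q. k $ u = j}" "l \<in> {k \<in> Q. k $ u = j}" "v \<notin> D"
    then show "k $ v = l $ v"
      using insert.prems(2)[of k l v] by (cases "v = u") auto
  qed (use insert.prems in auto)
  also have "\<dots> = (3 * real g) ^ card (insert u D) * (\<Sum>j\<in>?J. real (card {k \<in> Q. k $ u = j})) * variance0 \<phi>"
    using insert.hyps by (simp add: sum_distrib_left sum_distrib_right mult_ac)
  also have "(\<Sum>j\<in>?J. real (card {k \<in> Q. k $ u = j})) = real (card Q)"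
    using sum.group[of Q ?J "\<lambda>k. k $ u" "\<lambda>_. 1::real"] insert.prems(1) by simp
  finally show ?case .
qed

lemma psum_variance_bound_ex:
  "\<exists>C>0. \<forall>\<phi> Q. centred \<phi> \<longrightarrow> finite Q \<longrightarrow>
    (\<integral>w. (psum \<phi> Q w)\<^sup>2 \<partial>M) \<le> C * real (card Q) * variance0 \<phi>"
proof -
  obtain g where g: "1 \<le> g" "rho g < 1/2" using rho_small[of "1/2"] by auto
  show ?thesis
    using psum_variance_bound_aux[of g _ UNIV] g
    by (intro exI[of _ "(3 * real g) ^ CARD('d)"]) auto
qed

text \<open>One constant for all functionals \<open>\<phi>\<close>. This uniformity is what makes the remainders of a truncation, and
the sum of the variances of all coordinates of a Hilbert-space valued field, controllable.\<close>

definition var_const :: real where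
  "var_const = (SOME C. 0 < C \<and> (\<forall>\<phi> Q. centred \<phi> \<longrightarrow> finite Q \<longrightarrow>
    (\<integral>w. (psum \<phi> Q w)\<^sup>2 \<partial>M) \<le> C * real (card Q) * variance0 \<phi>))"

lemma var_const_pos: "0 < var_const"
  and psum_variance_bound: "centred \<phi> \<Longrightarrow> finite Q \<Longrightarrow>
    (\<integral>w. (psum \<phi> Q w)\<^sup>2 \<partial>M) \<le> var_const * real (card Q) * variance0 \<phi>"
  using someI_ex[OF psum_variance_bound_ex] unfolding var_const_def by blast+

end

section \<open>Product sets and rectangles\<close>

definition int_box :: "('d \<Rightarrow> int set) \<Rightarrow> (int ^ 'd) set" where
  "int_box I = {k. \<forall>u. k $ u \<in> I u}"

lemma box_eq_image: "int_box I = vec_lambda ` (PiE UNIV I)"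
proof
  show "int_box I \<subseteq> vec_lambda ` (PiE UNIV I)"
  proof
    fix k assume "k \<in> int_box I"
    then have "k = vec_lambda (vec_nth k)" "vec_nth k \<in> PiE UNIV I" by (auto simp: int_box_def)
    then show "k \<in> vec_lambda ` (PiE UNIV I)" by blast
  qed
qed (auto simp: int_box_def)

lemma finite_box:
  fixes I :: "'d::finite \<Rightarrow> int set"
  shows "(\<And>u. finite (I u)) \<Longrightarrow> finite (int_box I)"
  unfolding box_eq_image by (intro finite_imageI finite_PiE) auto

lemma card_box:
  fixes I :: "'d::finite \<Rightarrow> int set"
  shows "card (int_box I) = (\<Prod>u\<in>UNIV. card (I u))"
proof -
  have "inj_on vec_lambda (PiE UNIV I)"
    by (auto simp: inj_on_def vec_lambda_inject)
  then show ?thesis unfolding box_eq_image by (simp add: card_image card_PiE)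
qed

lemma rect_eq_box: "rect L = int_box (\<lambda>u. {1..int (L $ u)})"
  by (auto simp: rect_def int_box_def)

lemma finite_rect [simp]: "finite (rect L)"
  unfolding rect_eq_box by (rule finite_box) simp

lemma card_rect: "real (card (rect L)) = vol L"
  unfolding rect_eq_box card_box vol_def by simp

definition upd :: "nat ^ 'd \<Rightarrow> 'd \<Rightarrow> nat \<Rightarrow> nat ^ 'd" where
  "upd L u l = (\<chi> v. if v = u then l else L $ v)"

lemma upd_nth [simp]: "upd L u l $ v = (if v = u then l else L $ v)"
  by (simp add: upd_def)

definition cross_volume :: "nat ^ 'd \<Rightarrow> 'd \<Rightarrow> real" where
  "cross_volume L u = (\<Prod>v\<in>UNIV - {u}. real (L $ v))"

lemma vol_eq_cross: "vol L = real (L $ u) * cross_volume L u"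
  unfolding vol_def cross_volume_def by (subst prod.remove[of _ u]) auto

lemma vol_upd: "vol (upd L u l) = real l * cross_volume L u"
  by (simp add: vol_eq_cross[of _ u] cross_volume_def)

lemma vol_nonneg [simp]: "0 \<le> vol L"
  unfolding vol_def by (intro prod_nonneg) auto

lemma vol_pos: "(\<And>v. 1 \<le> L $ v) \<Longrightarrow> 0 < vol L"
  unfolding vol_def by (intro prod_pos) (auto simp: Suc_le_eq)


lemma eventually_min_at_top:
  "eventually P (min_at_top :: (nat ^ 'd) filter) \<longleftrightarrow> (\<exists>N. \<forall>L. (\<forall>u. N \<le> L $ u) \<longrightarrow> P L)"
proof -
  have Min: "n \<le> Min (range (\<lambda>u. L $ u)) \<longleftrightarrow> (\<forall>u. n \<le> L $ u)" for n and L :: "nat ^ 'd"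
    by (subst Min_ge_iff) auto
  show ?thesis
  proof
    assume "eventually P (min_at_top :: (nat ^ 'd) filter)"
    then obtain Q where Q: "eventually Q at_top" "\<And>L. Q (Min (range (\<lambda>u. L $ u))) \<Longrightarrow> P L"
      unfolding min_at_top_def eventually_filtercomap by auto
    then obtain N where "\<And>n. n \<ge> N \<Longrightarrow> Q n" by (auto simp: eventually_at_top_linorder)
    then show "\<exists>N. \<forall>L. (\<forall>u. N \<le> L $ u) \<longrightarrow> P L" using Q(2) Min by blast
  next
    assume "\<exists>N. \<forall>L. (\<forall>u. N \<le> L $ u) \<longrightarrow> P L"
    then obtain N where N: "\<And>L. (\<forall>u. N \<le> L $ u) \<Longrightarrow> P L" by auto
    show "eventually P (min_at_top :: (nat ^ 'd) filter)"
      unfolding min_at_top_def eventually_filtercomap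
      by (rule exI[of _ "\<lambda>n. N \<le> n"]) (use N Min in auto)
  qed
qed

text \<open>Consecutive slabs start \<open>w\<close> apart, so \<open>w - l\<close> hyperplanes are left out between them; this gap is
  what makes different slabs nearly uncorrelated.\<close>

definition slab :: "nat ^ 'd \<Rightarrow> 'd \<Rightarrow> nat \<Rightarrow> nat \<Rightarrow> nat \<Rightarrow> (int ^ 'd) set" where
  "slab L u w l j = {k \<in> rect L. int (j * w) < k $ u \<and> k $ u \<le> int (j * w + l)}"

lemma slab_eq_translate:
  assumes "j < p" "l \<le> w" "p * w \<le> L $ u"
  shows "slab L u w l j = (\<lambda>k. k + (\<chi> v. if v = u then int (j * w) else 0)) ` rect (upd L u l)"
    (is "_ = ?T ` _")
proof -
  have "Suc j * w \<le> p * w" using assms by (intro mult_le_mono1) simp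
  with assms have jw: "j * w + l \<le> L $ u" by simp
  have "k \<in> slab L u w l j \<longleftrightarrow> k - (\<chi> v. if v = u then int (j * w) else 0) \<in> rect (upd L u l)" for k
  proof -
    have split: "(\<forall>v. P v) = ((\<forall>v. v \<noteq> u \<longrightarrow> P v) \<and> P u)" for P by metis
    have *: "k - (\<chi> v. if v = u then int (j * w) else 0) \<in> rect (upd L u l) \<longleftrightarrow>
      (\<forall>v. v \<noteq> u \<longrightarrow> 1 \<le> k $ v \<and> k $ v \<le> int (L $ v)) \<and> 1 \<le> k $ u - int (j * w) \<and> k $ u - int (j * w) \<le> int l"
      unfolding rect_def mem_Collect_eq by (subst split) auto
    have **: "k \<in> slab L u w l j \<longleftrightarrow>
      ((\<forall>v. v \<noteq> u \<longrightarrow> 1 \<le> k $ v \<and> k $ v \<le> int (L $ v)) \<and> 1 \<le> k $ u \<and> k $ u \<le> int (L $ u))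
        \<and> int (j * w) < k $ u \<and> k $ u \<le> int (j * w + l)"
      unfolding slab_def rect_def mem_Collect_eq by (subst split) (rule refl)
    have "int (j * w) + int l \<le> int (L $ u)" using jw by linarith
    moreover have "0 \<le> int (j * w)" by simp
    ultimately have "(1 \<le> k $ u \<and> k $ u \<le> int (L $ u)) \<and> int (j * w) < k $ u \<and> k $ u \<le> int (j * w + l)
        \<longleftrightarrow> 1 \<le> k $ u - int (j * w) \<and> k $ u - int (j * w) \<le> int l"
      by (intro iffI) linarith+
    then show ?thesis
      unfolding * ** by blast
  qed
  moreover have "k \<in> ?T ` rect (upd L u l) \<longleftrightarrow> k - (\<chi> v. if v = u then int (j * w) else 0) \<in> rect (upd L u l)" for k
    by (auto simp: image_iff) (metis diff_add_cancel)
  ultimately show ?thesis by blast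
qed

lemma finite_slab [simp]: "finite (slab L u w l j)"
  unfolding slab_def by simp

text \<open>Integer division by the period is therefore a label that distinguishes the slabs.\<close>

lemma slab_index:
  assumes "k \<in> slab L u w l j" "l \<le> w"
  shows "(k $ u - 1) div int w = int j"
proof -
  have "0 \<le> k $ u - 1 - int w * int j" "k $ u - 1 - int w * int j < int w"
    using assms by (auto simp: slab_def mult.commute)
  then show ?thesis
    by (intro int_div_pos_eq[of _ _ _ "k $ u - 1 - int w * int j"]) auto
qed

context mixing_field
begin

lemma card_slab:
  assumes "j < p" "l \<le> w" "p * w \<le> L $ u"
  shows "real (card (slab L u w l j)) = vol (upd L u l)"
  unfolding slab_eq_translate[OF assms] by (subst card_image) (auto simp: inj_on_def card_rect)

lemma integral_slab:
  fixes F :: "real \<Rightarrow> 'b::{banach, second_countable_topology}"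
  assumes "j < p" "l \<le> w" "p * w \<le> L $ u"
    and "\<phi> \<in> borel_measurable borel" "F \<in> borel_measurable borel"
  shows "(\<integral>x. F (psum \<phi> (slab L u w l j) x) \<partial>M) = (\<integral>x. F (psum \<phi> (rect (upd L u l)) x) \<partial>M)"
  unfolding slab_eq_translate[OF assms(1-3)] by (rule integral_psum_translate) (use assms in auto)

lemma psum_slabs:
  assumes "l \<le> w"
  shows "psum \<phi> (\<Union>j<p. slab L u w l j) x = (\<Sum>j<p. psum \<phi> (slab L u w l j) x)"
  unfolding psum_def
proof (rule sum.UNION_disjoint)
  show "\<forall>i\<in>{..<p}. \<forall>j\<in>{..<p}. i \<noteq> j \<longrightarrow> slab L u w l i \<inter> slab L u w l j = {}"
    using slab_index[OF _ assms] by (metis disjoint_iff of_nat_eq_iff)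
qed auto

lemma card_slabs:
  assumes "l \<le> w" "p * w \<le> L $ u"
  shows "real (card (\<Union>j<p. slab L u w l j)) = real p * vol (upd L u l)"
proof -
  have "card (\<Union>j<p. slab L u w l j) = (\<Sum>j<p. card (slab L u w l j))"
  proof (rule card_UN_disjoint)
    show "\<forall>i\<in>{..<p}. \<forall>j\<in>{..<p}. i \<noteq> j \<longrightarrow> slab L u w l i \<inter> slab L u w l j = {}"
      using slab_index[OF _ assms(1)] by (metis disjoint_iff of_nat_eq_iff)
  qed auto
  then have "real (card (\<Union>j<p. slab L u w l j)) = (\<Sum>j<p. real (card (slab L u w l j)))" by simp
  also have "\<dots> = real p * vol (upd L u l)"
    using assms by (simp add: card_slab)
  finally show ?thesis .
qed

text \<open>The variance bound, applied to the set of points that lie in no slab: removing a small fraction of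
  the rectangle changes the sum little in mean square.\<close>

lemma psum_rect_minus_slabs:
  assumes \<phi>: "centred \<phi>" and "l \<le> w" "p * w \<le> L $ u"
  shows "(\<integral>x. (psum \<phi> (rect L) x - (\<Sum>j<p. psum \<phi> (slab L u w l j) x))\<^sup>2 \<partial>M)
    \<le> var_const * (vol L - real p * vol (upd L u l)) * variance0 \<phi>"
proof -
  let ?K = "\<Union>j<p. slab L u w l j"
  have K: "?K \<subseteq> rect L" by (auto simp: slab_def)
  have "psum \<phi> (rect L) x - (\<Sum>j<p. psum \<phi> (slab L u w l j) x) = psum \<phi> (rect L - ?K) x" for x
  proof -
    have "rect L = (rect L - ?K) \<union> ?K" using K by blast
    then have "psum \<phi> (rect L) x = psum \<phi> (rect L - ?K) x + psum \<phi> ?K x"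
      using psum_Un_disjoint[of "rect L - ?K" ?K \<phi> x] by auto
    then show ?thesis by (simp add: psum_slabs[OF assms(2)])
  qed
  then have "(\<integral>x. (psum \<phi> (rect L) x - (\<Sum>j<p. psum \<phi> (slab L u w l j) x))\<^sup>2 \<partial>M)
      = (\<integral>x. (psum \<phi> (rect L - ?K) x)\<^sup>2 \<partial>M)" by simp
  also have "\<dots> \<le> var_const * real (card (rect L - ?K)) * variance0 \<phi>"
    by (rule psum_variance_bound[OF \<phi>]) simp
  also have "real (card (rect L - ?K)) = vol L - real p * vol (upd L u l)"
    using card_Diff_subset[OF _ K] card_mono[OF _ K]
    by (simp add: of_nat_diff card_rect flip: card_slabs[OF assms(2,3)])
  finally show ?thesis .
qed

section \<open>Convergence of the normalised variances\<close>

definition var_rect :: "('h \<Rightarrow> real) \<Rightarrow> nat ^ 'd \<Rightarrow> real" where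
  "var_rect \<phi> L = (\<integral>x. (psum \<phi> (rect L) x)\<^sup>2 \<partial>M)"

lemma var_rect_nonneg [simp]: "0 \<le> var_rect \<phi> L"
  by (simp add: var_rect_def)

lemma var_rect_le: "centred \<phi> \<Longrightarrow> var_rect \<phi> L \<le> var_const * vol L * variance0 \<phi>"
  using psum_variance_bound[of \<phi> "rect L"] by (simp add: var_rect_def card_rect)

text \<open>Here \<open>f\<close> is the fraction of the rectangle that is lost when it is cut into \<open>p\<close> slabs of length \<open>l\<close> with
gaps of length \<open>g\<close>. Losing it changes the normalised variance by an error of order \<open>sqrt f\<close>; replacing the
variance of the sum over all slabs by \<open>p\<close> times that of one slab costs the relative error
\<open>(1 + rho g) / (1 - rho g) - 1\<close>, whatever \<open>p\<close> is.\<close>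

lemma var_rect_upd:
  fixes L :: "nat ^ 'd" and u :: 'd
  assumes \<phi>: "centred \<phi>" and g: "rho g < 1" and l: "1 \<le> l" and L: "\<And>v. 1 \<le> L $ v"
  defines "p \<equiv> L $ u div (l + g)"
  defines "f \<equiv> 1 - real p * real l / real (L $ u)"
  shows "\<bar>var_rect \<phi> L / vol L - var_rect \<phi> (upd L u l) / vol (upd L u l)\<bar>
    \<le> var_const * variance0 \<phi> * (4 * sqrt f + ((1 + rho g) / (1 - rho g) - 1))"
proof -
  define \<kappa> where "\<kappa> = (1 + rho g) / (1 - rho g)"
  define C where "C = var_const * variance0 \<phi>"
  define L' where "L' = upd L u l"
  define w where "w = l + g"
  define S where "S = psum \<phi> (rect L)"
  define T where "T x = (\<Sum>j<p. psum \<phi> (slab L u w l j) x)" for x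
  have C: "0 \<le> C" using var_const_pos by (simp add: C_def)
  have \<kappa>: "1 \<le> \<kappa>" using g rho_nonneg[of g] by (simp add: \<kappa>_def)
  have pw: "p * w \<le> L $ u" unfolding p_def w_def by (rule div_times_less_eq_dividend)
  have lw: "l \<le> w" by (simp add: w_def)
  have volL: "0 < vol L" using L by (rule vol_pos)
  have volL': "0 < vol L'" unfolding L'_def using L l by (intro vol_pos) auto
  have ratio: "real p * vol L' = (1 - f) * vol L"
    using L[of u] unfolding f_def L'_def vol_upd vol_eq_cross[of L u] by simp
  have "real p * real l \<le> real p * real w" using lw by (intro mult_left_mono) auto
  also have "\<dots> \<le> real (L $ u)" using pw by (metis of_nat_le_iff of_nat_mult)
  finally have f: "0 \<le> f" "f \<le> 1" unfolding f_def using L[of u] by (auto simp: divide_simps)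
  have ST: "(\<integral>x. (S x - T x)\<^sup>2 \<partial>M) \<le> C * (f * vol L)"
  proof -
    have "vol L - real p * vol L' = f * vol L" using ratio by (simp add: algebra_simps)
    then show ?thesis
      using psum_rect_minus_slabs[OF \<phi> lw pw] by (simp add: S_def T_def C_def L'_def mult_ac)
  qed
  have S2: "(\<integral>x. (S x)\<^sup>2 \<partial>M) \<le> C * vol L"
    using var_rect_le[OF \<phi>, of L] by (simp add: S_def C_def var_rect_def mult_ac)
  have SL2: "S \<in> L2_real M M" unfolding S_def by (rule psum_L2[OF \<phi>])
  have TL2: "T \<in> L2_real M M" unfolding T_def by (intro L2_real_sum psum_L2[OF \<phi>])
  have T_eq: "T x = psum \<phi> (\<Union>j<p. slab L u w l j) x" for x
    unfolding T_def psum_slabs[OF lw] ..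
  have T2_le: "(\<integral>x. (T x)\<^sup>2 \<partial>M) \<le> C * vol L"
  proof -
    have "(\<integral>x. (T x)\<^sup>2 \<partial>M) \<le> var_const * (real p * vol L') * variance0 \<phi>"
      unfolding T_eq L'_def card_slabs[OF lw pw, symmetric]
      by (rule psum_variance_bound[OF \<phi>]) simp
    also have "\<dots> = C * ((1 - f) * vol L)" by (simp add: C_def ratio)
    also have "\<dots> \<le> C * (1 * vol L)" using C f by (intro mult_left_mono mult_right_mono) auto
    finally show ?thesis by simp
  qed
  have diff1: "\<bar>(\<integral>x. (S x)\<^sup>2 \<partial>M) - (\<integral>x. (T x)\<^sup>2 \<partial>M)\<bar> \<le> 2 * C * sqrt f * vol L"
  proof -
    have "(\<integral>x. (S x)\<^sup>2 \<partial>M) - (\<integral>x. (T x)\<^sup>2 \<partial>M) = (\<integral>x. (S x - T x) * (S x + T x) \<partial>M)"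
      using L2_realD(2)[OF SL2] L2_realD(2)[OF TL2]
      by (simp add: power2_eq_square algebra_simps flip: Bochner_Integration.integral_diff)
    also have "\<bar>\<dots>\<bar> \<le> l2norm M (\<lambda>x. S x - T x) * l2norm M (\<lambda>x. S x + T x)"
      by (intro Cauchy_Schwarz_L2 L2_real_diff L2_real_add SL2 TL2)
    also have "\<dots> \<le> sqrt (C * (f * vol L)) * (sqrt (C * vol L) + sqrt (C * vol L))"
    proof (intro mult_mono)
      show "l2norm M (\<lambda>x. S x - T x) \<le> sqrt (C * (f * vol L))"
        unfolding l2norm_def using ST by simp
      have "l2norm M (\<lambda>x. S x + T x) \<le> l2norm M S + l2norm M T"
        by (rule l2norm_triangle[OF SL2 TL2])
      also have "\<dots> \<le> sqrt (C * vol L) + sqrt (C * vol L)"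
        unfolding l2norm_def using S2 T2_le by (intro add_mono) auto
      finally show "l2norm M (\<lambda>x. S x + T x) \<le> sqrt (C * vol L) + sqrt (C * vol L)" .
    qed (use C f in auto)
    also have "\<dots> = 2 * sqrt f * (sqrt (C * vol L) * sqrt (C * vol L))"
      by (simp add: real_sqrt_mult mult_ac)
    also have "\<dots> = 2 * C * sqrt f * vol L"
      using C volL by simp
    finally show ?thesis .
  qed
  have diff2: "\<bar>(\<integral>x. (T x)\<^sup>2 \<partial>M) - real p * var_rect \<phi> L'\<bar> \<le> (\<kappa> - 1) * (C * vol L)"
  proof -
    let ?Q = "\<Union>j<p. slab L u w l j" and ?c = "\<lambda>i. (i - 1) div int w"
    have "(\<Sum>j\<in>int ` {..<p}. \<integral>x. (psum \<phi> {k \<in> ?Q. ?c (k $ u) = j} x)\<^sup>2 \<partial>M)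
        = (\<Sum>j<p. \<integral>x. (psum \<phi> {k \<in> ?Q. ?c (k $ u) = int j} x)\<^sup>2 \<partial>M)"
      by (subst sum.reindex) (auto simp: inj_on_def)
    also have "\<dots> = (\<Sum>j<p. var_rect \<phi> L')"
    proof (intro sum.cong refl)
      fix j assume j: "j \<in> {..<p}"
      then have "{k \<in> ?Q. ?c (k $ u) = int j} = slab L u w l j"
        using slab_index[OF _ lw] by fastforce
      then show "(\<integral>x. (psum \<phi> {k \<in> ?Q. ?c (k $ u) = int j} x)\<^sup>2 \<partial>M) = var_rect \<phi> L'"
        unfolding var_rect_def L'_def
        using j integral_slab[OF _ lw pw centredD(1)[OF \<phi>], of j "\<lambda>y. y\<^sup>2"] by simp
    qed
    finally have D: "(\<Sum>j\<in>int ` {..<p}. \<integral>x. (psum \<phi> {k \<in> ?Q. ?c (k $ u) = j} x)\<^sup>2 \<partial>M)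
      = real p * var_rect \<phi> L'" by simp
    have sep: "int g \<le> \<bar>k $ u - m $ u\<bar>"
      if "k \<in> ?Q" "m \<in> ?Q" "?c (k $ u) \<noteq> ?c (m $ u)" for k m
    proof -
      from that obtain i j where ij: "k \<in> slab L u w l i" "m \<in> slab L u w l j" by auto
      with that have "i \<noteq> j" using slab_index[OF _ lw] by metis
      have gap: "int g \<le> m' $ u - k' $ u"
        if "k' \<in> slab L u w l i'" "m' \<in> slab L u w l j'" "i' < j'" for k' m' i' j'
      proof -
        have "Suc i' * w \<le> j' * w" using that by (intro mult_le_mono1) simp
        then have "int (i' * w) + int w \<le> int (j' * w)" by (metis add.commute mult_Suc of_nat_add of_nat_le_iff)
        then show ?thesis using that by (simp add: slab_def w_def)
      qed
      show ?thesis
        using \<open>i \<noteq> j\<close> gap[OF ij] gap[OF ij(2,1)] by (cases "i < j") auto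
    qed
    have im: "(\<lambda>k. ?c (k $ u)) ` ?Q \<subseteq> int ` {..<p}"
    proof
      fix i assume "i \<in> (\<lambda>k. ?c (k $ u)) ` ?Q"
      then obtain k j where kj: "k \<in> slab L u w l j" "j < p" "i = ?c (k $ u)" by auto
      then have "i = int j" using slab_index[OF kj(1) lw] by simp
      then show "i \<in> int ` {..<p}" using kj(2) by simp
    qed
    have T2: "(\<integral>x. (T x)\<^sup>2 \<partial>M) \<le> \<kappa> * (real p * var_rect \<phi> L')"
      and T2': "real p * var_rect \<phi> L' \<le> \<kappa> * (\<integral>x. (T x)\<^sup>2 \<partial>M)"
      using psum_variance_labelled[OF \<phi> _ g sep _ im]
      unfolding D T_eq[symmetric] \<kappa>_def by auto
    have "real p * var_rect \<phi> L' \<le> real p * (C * vol L')"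
      using var_rect_le[OF \<phi>, of L'] by (intro mult_left_mono) (auto simp: C_def mult_ac)
    also have "\<dots> = C * ((1 - f) * vol L)" by (simp add: ratio[symmetric])
    also have "\<dots> \<le> C * (1 * vol L)" using C f by (intro mult_left_mono mult_right_mono) auto
    finally have p_le: "real p * var_rect \<phi> L' \<le> C * vol L" by simp
    have "(\<integral>x. (T x)\<^sup>2 \<partial>M) - real p * var_rect \<phi> L' \<le> (\<kappa> - 1) * (real p * var_rect \<phi> L')"
      using T2 by (simp add: algebra_simps)
    also have "\<dots> \<le> (\<kappa> - 1) * (C * vol L)" using \<kappa> p_le by (intro mult_left_mono) auto
    finally have 1: "(\<integral>x. (T x)\<^sup>2 \<partial>M) - real p * var_rect \<phi> L' \<le> (\<kappa> - 1) * (C * vol L)" .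
    have "real p * var_rect \<phi> L' - (\<integral>x. (T x)\<^sup>2 \<partial>M) \<le> (\<kappa> - 1) * (\<integral>x. (T x)\<^sup>2 \<partial>M)"
      using T2' by (simp add: algebra_simps)
    also have "\<dots> \<le> (\<kappa> - 1) * (C * vol L)" using \<kappa> T2_le by (intro mult_left_mono) auto
    finally show ?thesis using 1 by (simp add: abs_le_iff)
  qed
  have diff3: "real p * var_rect \<phi> L' / vol L = (1 - f) * (var_rect \<phi> L' / vol L')"
  proof -
    have "real p * var_rect \<phi> L' = real p * vol L' * (var_rect \<phi> L' / vol L')"
      using volL' by simp
    then show ?thesis unfolding ratio using volL by simp
  qed
  have v': "0 \<le> var_rect \<phi> L' / vol L'" "var_rect \<phi> L' / vol L' \<le> C"
    using var_rect_le[OF \<phi>, of L'] volL' by (auto simp: C_def divide_simps mult_ac)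
  have "f \<le> sqrt f" using f by (intro real_le_rsqrt) (simp add: power2_eq_square mult_left_le)
  then have "f * (var_rect \<phi> L' / vol L') \<le> sqrt f * C"
    using f v' by (intro mult_mono) auto
  moreover have "0 \<le> f * (var_rect \<phi> L' / vol L')" using f v' by simp
  moreover have "var_rect \<phi> L / vol L - var_rect \<phi> L' / vol L'
      = ((\<integral>x. (S x)\<^sup>2 \<partial>M) - (\<integral>x. (T x)\<^sup>2 \<partial>M)) / vol L
        + ((\<integral>x. (T x)\<^sup>2 \<partial>M) - real p * var_rect \<phi> L') / vol L - f * (var_rect \<phi> L' / vol L')"
    using diff3 by (simp add: var_rect_def[of \<phi> L] S_def diff_divide_distrib algebra_simps)
  moreover have "\<bar>((\<integral>x. (S x)\<^sup>2 \<partial>M) - (\<integral>x. (T x)\<^sup>2 \<partial>M)) / vol L\<bar> \<le> 2 * C * sqrt f"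
    using diff1 volL by (simp add: abs_divide divide_simps)
  moreover have "\<bar>((\<integral>x. (T x)\<^sup>2 \<partial>M) - real p * var_rect \<phi> L') / vol L\<bar> \<le> (\<kappa> - 1) * C"
    using diff2 volL by (simp add: abs_divide divide_simps mult_ac)
  ultimately have "\<bar>var_rect \<phi> L / vol L - var_rect \<phi> L' / vol L'\<bar>
      \<le> 2 * C * sqrt f + (\<kappa> - 1) * C + sqrt f * C" by linarith
  also have "\<dots> \<le> C * (4 * sqrt f + (\<kappa> - 1))"
    using C f by (simp add: algebra_simps)
  finally show ?thesis by (simp add: C_def \<kappa>_def L'_def)
qed

text \<open>Choose first \<open>g\<close> to make \<open>rho g\<close> small, then \<open>l\<close> large compared with \<open>g\<close>, then the side \<open>L $ u\<close> large compared
with \<open>l\<close>. The bound does not involve the other sides, which may have any positive length; this is what allows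
the directions to be treated one after the other.\<close>

lemma var_rect_upd_uniform:
  assumes \<phi>: "centred \<phi>" and e: "0 < e"
  obtains l0 where "1 \<le> l0"
    "\<And>l. l0 \<le> l \<Longrightarrow> \<exists>N\<ge>1. \<forall>L u. (\<forall>v. 1 \<le> L $ v) \<longrightarrow> N \<le> L $ u \<longrightarrow>
      \<bar>var_rect \<phi> L / vol L - var_rect \<phi> (upd L u l) / vol (upd L u l)\<bar> \<le> e"
proof -
  define C where "C = var_const * variance0 \<phi> + 1"
  have C: "1 \<le> C" using var_const_pos by (simp add: C_def)
  define \<delta> where "\<delta> = (e / (8 * C))\<^sup>2"
  have \<delta>: "0 < \<delta>" "sqrt \<delta> = e / (8 * C)" using e C by (auto simp: \<delta>_def)
  define r where "r = min (1/2) (e / (8 * C))"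
  have "0 < r" using e C by (auto simp: r_def)
  from rho_small[OF this] obtain g where g: "1 \<le> g" "rho g < r" .
  have "rho g < 1/2" "rho g < e / (8 * C)" using g by (auto simp: r_def)
  then have rho1: "rho g < 1" and "1 - rho g \<ge> 1/2" by auto
  have "(1 + rho g) / (1 - rho g) - 1 = 2 * rho g / (1 - rho g)"
    using rho1 by (simp add: field_simps)
  also have "\<dots> \<le> 2 * rho g / (1/2)"
    using rho_nonneg[of g] \<open>1 - rho g \<ge> 1/2\<close> by (intro divide_left_mono) auto
  also have "\<dots> \<le> e / (2 * C)" using \<open>rho g < e / (8 * C)\<close> C by (simp add: field_simps)
  finally have \<kappa>: "(1 + rho g) / (1 - rho g) - 1 \<le> e / (2 * C)" .
  obtain l0 :: nat where l0: "real g * 2 / \<delta> \<le> real l0" using real_arch_simple by blast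
  show ?thesis
  proof (rule that[of "max 1 l0"])
    fix l assume l: "max 1 l0 \<le> l"
    obtain N :: nat where N: "real l * 2 / \<delta> \<le> real N" using real_arch_simple by blast
    have gl: "real g / real (l + g) \<le> \<delta> / 2"
    proof -
      have "real g * 2 / \<delta> \<le> real (l + g)" using l0 l by (auto simp: max_def split: if_splits)
      then show ?thesis using \<delta> g by (simp add: field_simps)
    qed
    show "\<exists>N\<ge>1. \<forall>L u. (\<forall>v. 1 \<le> L $ v) \<longrightarrow> N \<le> L $ u \<longrightarrow>
      \<bar>var_rect \<phi> L / vol L - var_rect \<phi> (upd L u l) / vol (upd L u l)\<bar> \<le> e"
    proof (intro exI[of _ "max 1 N"] conjI allI impI)
      fix L :: "nat ^ 'd" and u
      assume L: "\<forall>v. 1 \<le> L $ v" and Lu: "max 1 N \<le> L $ u"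
      define w where "w = l + g"
      define p where "p = L $ u div w"
      define f where "f = 1 - real p * real l / real (L $ u)"
      have w: "0 < w" "l \<le> w" using l by (auto simp: w_def)
      have Lu0: "0 < real (L $ u)" using Lu by simp
      have "L $ u \<le> p * w + w"
        using div_mult_mod_eq[of "L $ u" w] mod_less_divisor[OF w(1), of "L $ u"]
        unfolding p_def by linarith
      then have "real (L $ u) \<le> real p * real w + real w" by (metis of_nat_add of_nat_le_iff of_nat_mult)
      then have "real (L $ u) * (real l / real w) \<le> (real p * real w + real w) * (real l / real w)"
        by (intro mult_right_mono) auto
      also have "\<dots> = real p * real l + real l" using w by (simp add: field_simps)
      finally have "real (L $ u) * (real l / real w) \<le> real p * real l + real l" .
      then have "real l / real w \<le> (real p * real l + real l) / real (L $ u)"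
        using Lu0 by (simp add: field_simps)
      moreover have "real l / real w = (real w - real g) / real w" by (simp add: w_def)
      then have "real l / real w = 1 - real g / real w" using w by (simp add: diff_divide_distrib)
      ultimately have "f \<le> real g / real w + real l / real (L $ u)"
        unfolding f_def by (simp add: add_divide_distrib)
      also have "real l / real (L $ u) \<le> \<delta> / 2"
      proof -
        have "real l * 2 / \<delta> \<le> real (L $ u)" using N Lu by simp
        then show ?thesis using \<delta> Lu0 by (simp add: field_simps)
      qed
      finally have "f \<le> \<delta>" using gl unfolding w_def by linarith
      then have "sqrt f \<le> e / (8 * C)" unfolding \<delta>(2)[symmetric] by simp
      have "\<bar>var_rect \<phi> L / vol L - var_rect \<phi> (upd L u l) / vol (upd L u l)\<bar>
          \<le> var_const * variance0 \<phi> * (4 * sqrt f + ((1 + rho g) / (1 - rho g) - 1))"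
        unfolding f_def p_def w_def using L l by (intro var_rect_upd[OF \<phi> rho1]) auto
      also have "\<dots> \<le> var_const * variance0 \<phi> * (4 * (e / (8 * C)) + e / (2 * C))"
        using \<kappa> \<open>sqrt f \<le> e / (8 * C)\<close> var_const_pos by (intro mult_left_mono add_mono) auto
      also have "\<dots> \<le> C * (4 * (e / (8 * C)) + e / (2 * C))"
        using e C by (intro mult_right_mono) (auto simp: C_def)
      also have "\<dots> = e" using C by (simp add: field_simps)
      finally show "\<bar>var_rect \<phi> L / vol L - var_rect \<phi> (upd L u l) / vol (upd L u l)\<bar> \<le> e" .
    qed simp
  qed simp
qed

text \<open>Replacing the sides by \<open>l\<close> one at a time compares any large rectangle with the cube of side \<open>l\<close>.\<close>

lemma var_rect_cube:
  assumes \<phi>: "centred \<phi>" and e: "0 < e"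
  obtains l0 where
    "\<And>l. l0 \<le> l \<Longrightarrow> \<exists>N. \<forall>L. (\<forall>v. N \<le> L $ v) \<longrightarrow>
      \<bar>var_rect \<phi> L / vol L - var_rect \<phi> (\<chi> v. l) / vol (\<chi> v. l :: nat ^ 'd)\<bar> \<le> e"
proof -
  define e' where "e' = e / CARD('d)"
  have "0 < e'" using e by (simp add: e'_def)
  from var_rect_upd_uniform[OF \<phi> this] obtain l0 where l0: "1 \<le> l0"
    "\<And>l. l0 \<le> l \<Longrightarrow> \<exists>N\<ge>1. \<forall>L u. (\<forall>v. 1 \<le> L $ v) \<longrightarrow> N \<le> L $ u \<longrightarrow>
      \<bar>var_rect \<phi> L / vol L - var_rect \<phi> (upd L u l) / vol (upd L u l)\<bar> \<le> e'" by blast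
  show ?thesis
  proof (rule that[of l0])
    fix l assume l: "l0 \<le> l"
    from l0(2)[OF this] obtain N where N: "1 \<le> N" "\<And>L u. (\<forall>v. 1 \<le> L $ v) \<Longrightarrow> N \<le> L $ u \<Longrightarrow>
      \<bar>var_rect \<phi> L / vol L - var_rect \<phi> (upd L u l) / vol (upd L u l)\<bar> \<le> e'" by blast
    have *: "\<bar>var_rect \<phi> L / vol L - var_rect \<phi> (\<chi> v. if v \<in> D then l else L $ v)
        / vol (\<chi> v. if v \<in> D then l else L $ v)\<bar> \<le> card D * e'"
      if L: "\<forall>v. N \<le> L $ v" and "finite D" for L and D :: "'d set"
      using that(2)
    proof (induction D rule: finite_induct)
      case (insert u D)
      let ?L = "\<lambda>D. \<chi> v. if v \<in> D then l else L $ v"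
      have eq: "?L (insert u D) = upd (?L D) u l"
        by (auto simp: vec_eq_iff)
      have "\<bar>var_rect \<phi> (?L D) / vol (?L D) - var_rect \<phi> (upd (?L D) u l) / vol (upd (?L D) u l)\<bar> \<le> e'"
        using L N(1) l0(1) l insert.hyps by (intro N(2)) (auto intro: order_trans)
      then show ?case
        using insert unfolding eq by (simp add: algebra_simps)
    qed simp
    have "\<bar>var_rect \<phi> L / vol L - var_rect \<phi> (\<chi> v. l) / vol (\<chi> v. l :: nat ^ 'd)\<bar> \<le> e"
      if "\<forall>v. N \<le> L $ v" for L :: "nat ^ 'd"
      using *[OF that, of UNIV] by (simp add: e'_def)
    then show "\<exists>N. \<forall>L. (\<forall>v. N \<le> L $ v) \<longrightarrow>
      \<bar>var_rect \<phi> L / vol L - var_rect \<phi> (\<chi> v. l) / vol (\<chi> v. l :: nat ^ 'd)\<bar> \<le> e" by blast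
  qed
qed

text \<open>Two cubes with large sides \<open>l\<close> and \<open>m\<close> are both close to every sufficiently large rectangle, hence to each
other; so the cubes form a Cauchy sequence, and all rectangles follow its limit.\<close>

lemma var_rect_tendsto:
  assumes \<phi>: "centred \<phi>"
  obtains s where "0 \<le> s" "((\<lambda>L. var_rect \<phi> L / vol L) \<longlongrightarrow> s) min_at_top"
proof -
  define a where "a l = var_rect \<phi> (\<chi> v. l) / vol (\<chi> v. l :: nat ^ 'd)" for l
  have cube: "\<exists>l0. \<forall>l\<ge>l0. \<exists>N. \<forall>L. (\<forall>v. N \<le> L $ v) \<longrightarrow> \<bar>var_rect \<phi> L / vol L - a l\<bar> \<le> e" if "0 < e" for e
    using var_rect_cube[OF \<phi> that] unfolding a_def by metis
  have "Cauchy a"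
  proof (rule CauchyI)
    fix e :: real assume "0 < e"
    then obtain l0 where l0: "\<And>l. l0 \<le> l \<Longrightarrow> \<exists>N. \<forall>L. (\<forall>v. N \<le> L $ v) \<longrightarrow> \<bar>var_rect \<phi> L / vol L - a l\<bar> \<le> e / 3"
      using cube[of "e / 3"] by auto
    have "norm (a m - a n) < e" if "l0 \<le> m" "l0 \<le> n" for m n
    proof -
      obtain N1 N2 where N: "\<And>L. (\<forall>v. N1 \<le> L $ v) \<Longrightarrow> \<bar>var_rect \<phi> L / vol L - a m\<bar> \<le> e / 3"
        "\<And>L. (\<forall>v. N2 \<le> L $ v) \<Longrightarrow> \<bar>var_rect \<phi> L / vol L - a n\<bar> \<le> e / 3"
        using l0 \<open>l0 \<le> m\<close> \<open>l0 \<le> n\<close> by metis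
      have "\<bar>y - z\<bar> < e" if "\<bar>x - y\<bar> \<le> e / 3" "\<bar>x - z\<bar> \<le> e / 3" for x y z :: real
        using that \<open>0 < e\<close> by linarith
      from this[OF N(1)[of "\<chi> v. max N1 N2"] N(2)[of "\<chi> v. max N1 N2"]]
      show ?thesis by simp
    qed
    then show "\<exists>M. \<forall>m\<ge>M. \<forall>n\<ge>M. norm (a m - a n) < e" by blast
  qed
  then obtain s where s: "a \<longlonglongrightarrow> s" by (auto simp: Cauchy_convergent_iff convergent_def)
  have lim: "((\<lambda>L. var_rect \<phi> L / vol L) \<longlongrightarrow> s) min_at_top"
  proof (rule tendstoI)
    fix e :: real assume "0 < e"
    then obtain l0 where l0: "\<And>l. l0 \<le> l \<Longrightarrow> \<exists>N. \<forall>L. (\<forall>v. N \<le> L $ v) \<longrightarrow> \<bar>var_rect \<phi> L / vol L - a l\<bar> \<le> e / 3"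
      using cube[of "e / 3"] by auto
    have "eventually (\<lambda>l. dist (a l) s < e / 3) sequentially"
      using s \<open>0 < e\<close> by (intro tendstoD) auto
    then have "eventually (\<lambda>l. l0 \<le> l \<and> dist (a l) s < e / 3) sequentially"
      using eventually_ge_at_top[of l0] by eventually_elim auto
    then obtain l where l: "l0 \<le> l" "dist (a l) s < e / 3" by (auto simp: eventually_sequentially)
    from l0[OF l(1)] obtain N where N: "\<And>L. (\<forall>v. N \<le> L $ v) \<Longrightarrow> \<bar>var_rect \<phi> L / vol L - a l\<bar> \<le> e / 3" by auto
    show "eventually (\<lambda>L. dist (var_rect \<phi> L / vol L) s < e) min_at_top"
      unfolding eventually_min_at_top
    proof (intro exI[of _ N] allI impI)
      fix L :: "nat ^ 'd" assume "\<forall>v. N \<le> L $ v"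
      have "\<bar>x - z\<bar> < e" if "\<bar>x - y\<bar> \<le> e / 3" "\<bar>y - z\<bar> < e / 3" for x y z :: real
        using that \<open>0 < e\<close> by linarith
      from this[OF N[OF \<open>\<forall>v. N \<le> L $ v\<close>] l(2)[unfolded dist_real_def]]
      show "dist (var_rect \<phi> L / vol L) s < e" by (simp add: dist_real_def)
    qed
  qed
  moreover have "0 \<le> s"
    by (rule tendsto_lowerbound[OF lim _ min_at_top_neq_bot]) simp
  ultimately show ?thesis using that by blast
qed

end

section \<open>Fourth moments of bounded fields\<close>

text \<open>The difference of the two sides is a sum of squares. The coefficient of the fourth powers must stay below
\<open>9/5\<close> for the halving argument, in which \<open>x\<close> and \<open>y\<close> are sums over sets of sizes between one third and two
thirds of the whole; mixing then takes care of the mixed term.\<close>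

lemma fourth_power_add_le:
  fixes x y :: real
  shows "(x + y) ^ 4 \<le> 6/5 * (x ^ 4 + y ^ 4) + 46 * (x\<^sup>2 * y\<^sup>2)"
proof -
  have "6/5 * (x ^ 4 + y ^ 4) + 46 * (x\<^sup>2 * y\<^sup>2) - (x + y) ^ 4
      = (x\<^sup>2 + y\<^sup>2 - 20 * (x * y))\<^sup>2 / 10 + (x\<^sup>2 - y\<^sup>2)\<^sup>2 / 10"
    by (simp add: power2_eq_square power4_eq_xxxx field_simps)
  moreover have "0 \<le> (x\<^sup>2 + y\<^sup>2 - 20 * (x * y))\<^sup>2 / 10 + (x\<^sup>2 - y\<^sup>2)\<^sup>2 / 10" by simp
  ultimately show ?thesis by linarith
qed

lemma sum_fourth_power_le:
  fixes f :: "'a \<Rightarrow> real"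
  shows "(\<Sum>i\<in>I. f i) ^ 4 \<le> (\<Sum>i\<in>I. (f i) ^ 4) * real (card I) ^ 3"
proof -
  have "(\<Sum>i\<in>I. f i) ^ 4 = ((\<Sum>i\<in>I. f i)\<^sup>2)\<^sup>2" by simp
  also have "\<dots> \<le> ((\<Sum>i\<in>I. (f i)\<^sup>2) * real (card I))\<^sup>2"
    by (intro power_mono sum_squared_le_sum_of_squares) simp
  also have "\<dots> = (\<Sum>i\<in>I. (f i)\<^sup>2)\<^sup>2 * (real (card I))\<^sup>2" by (simp add: power_mult_distrib)
  also have "\<dots> \<le> ((\<Sum>i\<in>I. ((f i)\<^sup>2)\<^sup>2) * real (card I)) * (real (card I))\<^sup>2"
    by (intro mult_right_mono sum_squared_le_sum_of_squares) simp
  also have "\<dots> = (\<Sum>i\<in>I. (f i) ^ 4) * real (card I) ^ 3"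
    by (simp add: power3_eq_cube power2_eq_square[of "real (card I)"])
  finally show ?thesis .
qed

context mixing_field
begin

lemma psum_bounded:
  assumes "\<And>x. \<bar>\<phi> x\<bar> \<le> B"
  shows "\<bar>psum \<phi> Q w\<bar> \<le> real (card Q) * B"
  unfolding psum_def using assms sum_bounded_above[of Q "\<lambda>k. \<bar>\<phi> (X k w)\<bar>" B]
  by (intro order_trans[OF sum_abs]) auto

lemma psum_power_integrable:
  assumes "\<phi> \<in> borel_measurable borel" "\<And>x. \<bar>\<phi> x\<bar> \<le> B"
  shows "integrable M (\<lambda>w. (psum \<phi> Q w) ^ n)"
proof (rule integrable_const_bound)
  show "AE w in M. norm ((psum \<phi> Q w) ^ n) \<le> (real (card Q) * B) ^ n"
    using psum_bounded[OF assms(2)] by (auto simp: power_abs intro!: power_mono)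
  show "(\<lambda>w. (psum \<phi> Q w) ^ n) \<in> borel_measurable M"
    using psum_measurable[OF assms(1)] by (rule borel_measurable_power)
qed

definition spaced :: "nat \<Rightarrow> int set \<Rightarrow> bool" where
  "spaced g A \<longleftrightarrow> (\<forall>x\<in>A. \<forall>y\<in>A. x \<noteq> y \<longrightarrow> int g \<le> \<bar>x - y\<bar>)"

text \<open>Split the box in two along a side, the sizes being between one third and two thirds of the whole. The
two halves are nearly uncorrelated, so \<open>E (U\<^sup>2 V\<^sup>2)\<close> is at most \<open>E U\<^sup>2 E V\<^sup>2\<close> plus a small multiple of
\<open>sqrt (E U\<^sup>4 E V\<^sup>4)\<close>. Since \<open>v\<^sub>1\<^sup>2 + v\<^sub>2\<^sup>2 \<le> 5/9 (v\<^sub>1 + v\<^sub>2)\<^sup>2\<close>, the bound \<open>K v\<^sup>2\<close> reproduces itself: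
the three contributions are at most \<open>2/3\<close>, \<open>1/6\<close> and \<open>23/200\<close> of it, with room to spare. The sides are
arbitrary finite sets of integers rather than intervals, so that they can be residue classes.\<close>

lemma fourth_moment_spaced:
  assumes \<phi>: "centred \<phi>" and B: "\<And>x. \<bar>\<phi> x\<bar> \<le> B" and g: "rho g \<le> 1/100"
    and c: "0 \<le> c" "\<And>Q. finite Q \<Longrightarrow> (\<integral>w. (psum \<phi> Q w)\<^sup>2 \<partial>M) \<le> c * real (card Q)"
    and K: "B ^ 4 \<le> K" "69 * c\<^sup>2 \<le> K"
    and I: "\<And>u. finite (I u)" "\<And>u. spaced g (I u)"
  shows "(\<integral>w. (psum \<phi> (int_box I) w) ^ 4 \<partial>M) \<le> K * (real (card (int_box I)))\<^sup>2"
  using I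
proof (induction "\<Sum>u\<in>UNIV. card (I u)" arbitrary: I rule: less_induct)
  case (less I)
  note \<phi>m = centredD(1)[OF \<phi>]
  note int4 = psum_power_integrable[OF \<phi>m B]
  have K0: "0 \<le> K" using K(2) by (meson order_trans mult_nonneg_nonneg zero_le_numeral zero_le_power2)
  have fin: "finite (int_box I)" using less.prems(1) by (rule finite_box)
  show ?case
  proof (cases "card (int_box I) \<le> 1")
    case True
    then consider "int_box I = {}" | k where "int_box I = {k}"
      using fin by (metis card_0_eq card_1_singletonE le_less_linear less_one order_antisym)
    then show ?thesis
    proof cases
      case (2 k)
      have "(\<phi> (X k w)) ^ 4 \<le> B ^ 4" for w
        using power_mono[OF B[of "X k w"], of 4] by (simp add: power_even_abs_numeral)
      then have "(\<integral>w. (\<phi> (X k w)) ^ 4 \<partial>M) \<le> (\<integral>w. B ^ 4 \<partial>M)"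
        using int4[of "{k}" 4] by (intro integral_mono) (auto simp: psum_def)
      then show ?thesis using K by (simp add: 2 psum_def prob_space)
    qed simp
  next
    case False
    have "\<exists>u. 2 \<le> card (I u)"
    proof (rule ccontr)
      assume "\<not> ?thesis"
      then have "card (int_box I) \<le> (\<Prod>u\<in>(UNIV :: 'd set). 1)"
        unfolding card_box by (intro prod_mono) (auto simp: not_le less_Suc_eq_le numeral_2_eq_2)
      with False show False by simp
    qed
    then obtain u where u: "2 \<le> card (I u)" by blast
    define m where "m = card (I u)"
    obtain A where A: "A \<subseteq> I u" "card A = m div 2" "finite A"
      using obtain_subset_with_card_n[of "m div 2" "I u"] by (auto simp: m_def)
    define A' where "A' = I u - A"
    have A': "card A' = m - m div 2" "finite A'" "A' \<subseteq> I u" "A \<inter> A' = {}" "A \<union> A' = I u"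
      using A less.prems(1) by (auto simp: A'_def m_def card_Diff_subset)
    define P where "P = (\<Prod>v\<in>UNIV - {u}. real (card (I v)))"
    have P: "0 \<le> P" unfolding P_def by (intro prod_nonneg) auto
    have upd: "real (card (int_box (I(u := S)))) = real (card S) * P" for S
    proof -
      have "real (card (int_box (I(u := S)))) = (\<Prod>v\<in>UNIV. real (card ((I(u := S)) v)))"
        by (simp add: card_box)
      also have "\<dots> = real (card S) * (\<Prod>v\<in>UNIV - {u}. real (card ((I(u := S)) v)))"
        by (subst prod.remove[of _ u]) auto
      also have "(\<Prod>v\<in>UNIV - {u}. real (card ((I(u := S)) v))) = P"
        unfolding P_def by (intro prod.cong) auto
      finally show ?thesis .
    qed
    define n1 where "n1 = real (m div 2)"
    define n2 where "n2 = real (m - m div 2)"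
    have m: "2 \<le> m" using u by (simp add: m_def)
    have n: "n1 + n2 = real m" by (simp add: n1_def n2_def)
    have n1: "real m \<le> 3 * n1" "n1 \<le> n2" "0 < n1"
    proof -
      have "m \<le> 3 * (m div 2)" "m div 2 \<le> m - m div 2" "0 < m div 2" using m by linarith+
      then show "real m \<le> 3 * n1" "n1 \<le> n2" "0 < n1" unfolding n1_def n2_def by linarith+
    qed
    define v1 where "v1 = real (card (int_box (I(u := A))))"
    define v2 where "v2 = real (card (int_box (I(u := A'))))"
    define v where "v = real (card (int_box I))"
    have v: "v1 = n1 * P" "v2 = n2 * P" "v = real m * P"
      using upd[of A] upd[of A'] upd[of "I u"] A(2) A'(1)
      by (simp_all add: v1_def v2_def v_def n1_def n2_def m_def)
    have P1: "P > 0" using False v(3) P by (cases "P = 0") (auto simp: v_def)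
    define U where "U = psum \<phi> (int_box (I(u := A)))"
    define V where "V = psum \<phi> (int_box (I(u := A')))"
    have fin': "finite (int_box (I(u := A)))" "finite (int_box (I(u := A')))"
      using A A' less.prems(1) by (auto intro!: finite_box)
    have box_Un: "int_box I = int_box (I(u := A)) \<union> int_box (I(u := A'))" and box_Int: "int_box (I(u := A)) \<inter> int_box (I(u := A')) = {}"
      using A A' by (auto simp: int_box_def split: if_splits)
    have UV: "psum \<phi> (int_box I) w = U w + V w" for w
      unfolding U_def V_def box_Un using fin' box_Int by (rule psum_Un_disjoint)
    have IH: "(\<integral>w. (psum \<phi> (int_box (I(u := S))) w) ^ 4 \<partial>M) \<le> K * (real (card (int_box (I(u := S)))))\<^sup>2"
      if S: "S \<subseteq> I u" "card S < card (I u)" for S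
    proof (rule less.hyps)
      show "(\<Sum>v\<in>UNIV. card ((I(u := S)) v)) < (\<Sum>v\<in>UNIV. card (I v))"
        using S by (intro sum_strict_mono_ex1) (auto intro: less_imp_le)
      show "finite ((I(u := S)) v)" for v
        using less.prems(1) finite_subset[OF S(1)] by auto
      have "spaced g S" using less.prems(2)[of u] S(1) by (meson spaced_def subsetD)
      then show "spaced g ((I(u := S)) v)" for v
        using less.prems(2) by auto
    qed
    have U4: "(\<integral>w. (U w) ^ 4 \<partial>M) \<le> K * v1\<^sup>2"
      unfolding U_def v1_def using A m by (intro IH) (auto simp: m_def)
    have V4: "(\<integral>w. (V w) ^ 4 \<partial>M) \<le> K * v2\<^sup>2"
      unfolding V_def v2_def using A' m by (intro IH) (auto simp: m_def)
    have U2: "(\<integral>w. (U w)\<^sup>2 \<partial>M) \<le> c * v1" and V2: "(\<integral>w. (V w)\<^sup>2 \<partial>M) \<le> c * v2"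
      unfolding U_def V_def v1_def v2_def using c(2) fin' by auto
    have vpos: "0 < v1" "0 < v2" using v n1 P1 by auto
    have UV2: "(\<integral>w. (U w)\<^sup>2 * (V w)\<^sup>2 \<partial>M) \<le> (c\<^sup>2 + K / 100) * (v1 * v2)"
    proof -
      have sep: "separated_sets g (int_box (I(u := A))) (int_box (I(u := A')))"
      proof (rule separated_setsI[of _ _ u])
        fix k l assume "k \<in> int_box (I(u := A))" "l \<in> int_box (I(u := A'))"
        then have "k $ u \<in> A" "l $ u \<in> A'" by (auto simp: int_box_def split: if_splits)
        then have "k $ u \<in> I u" "l $ u \<in> I u" "k $ u \<noteq> l $ u" using A A' by auto
        then show "k $ u \<noteq> l $ u \<and> int g \<le> \<bar>k $ u - l $ u\<bar>"
          using less.prems(2)[of u] by (auto simp: spaced_def)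
      qed (use fin' vpos v1_def v2_def in auto)
      have L2: "(\<lambda>w. (psum \<phi> Q w)\<^sup>2) \<in> L2_real M (sigma_gen_by M X Q)" for Q
      proof -
        have "(\<lambda>w. (psum \<phi> Q w)\<^sup>2) \<in> borel_measurable (sigma_gen_by M X Q)"
          using psum_measurable_sigma_gen_by[OF order_refl \<phi>m] by (rule borel_measurable_power)
        then show ?thesis using int4[of Q 4] by (simp add: L2_real_def)
      qed
      have norm4: "l2norm M (\<lambda>w. (U w)\<^sup>2) \<le> sqrt K * v1" "l2norm M (\<lambda>w. (V w)\<^sup>2) \<le> sqrt K * v2"
        using U4 V4 vpos unfolding l2norm_def
        by (auto intro!: real_le_lsqrt simp: power_mult_distrib K0)
      have "(\<integral>w. (U w)\<^sup>2 * (V w)\<^sup>2 \<partial>M) \<le> (\<integral>w. (U w)\<^sup>2 \<partial>M) * (\<integral>w. (V w)\<^sup>2 \<partial>M)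
          + rho g * (l2norm M (\<lambda>w. (U w)\<^sup>2) * l2norm M (\<lambda>w. (V w)\<^sup>2))"
        using mixing_inequality[OF sep L2 L2] unfolding U_def V_def by linarith
      also have "\<dots> \<le> (c * v1) * (c * v2) + 1/100 * ((sqrt K * v1) * (sqrt K * v2))"
        using U2 V2 norm4 g vpos c K0 rho_nonneg
        by (intro add_mono mult_mono) auto
      also have "\<dots> = (c\<^sup>2 + K / 100) * (v1 * v2)"
        using K0 by (simp add: power2_eq_square algebra_simps)
      finally show ?thesis .
    qed
    have intUV: "integrable M (\<lambda>w. (U w)\<^sup>2 * (V w)\<^sup>2)"
      using int4[of _ 4] psum_measurable[OF \<phi>m] unfolding U_def V_def
      by (intro integrable_L2_mult L2_realI) auto
    have intU: "integrable M (\<lambda>w. (U w) ^ 4)" "integrable M (\<lambda>w. (V w) ^ 4)"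
      unfolding U_def V_def by (rule int4)+
    have "(\<integral>w. (psum \<phi> (int_box I) w) ^ 4 \<partial>M) \<le> (\<integral>w. 6/5 * ((U w) ^ 4 + (V w) ^ 4) + 46 * ((U w)\<^sup>2 * (V w)\<^sup>2) \<partial>M)"
    proof (rule integral_mono)
      show "integrable M (\<lambda>w. (psum \<phi> (int_box I) w) ^ 4)" by (rule int4)
      show "integrable M (\<lambda>w. 6/5 * ((U w) ^ 4 + (V w) ^ 4) + 46 * ((U w)\<^sup>2 * (V w)\<^sup>2))"
        using intU intUV by auto
      show "(psum \<phi> (int_box I) w) ^ 4 \<le> 6/5 * ((U w) ^ 4 + (V w) ^ 4) + 46 * ((U w)\<^sup>2 * (V w)\<^sup>2)" for w
        unfolding UV by (rule fourth_power_add_le)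
    qed
    also have "\<dots> = 6/5 * ((\<integral>w. (U w) ^ 4 \<partial>M) + (\<integral>w. (V w) ^ 4 \<partial>M)) + 46 * (\<integral>w. (U w)\<^sup>2 * (V w)\<^sup>2 \<partial>M)"
      using intU intUV by simp
    also have "\<dots> \<le> 6/5 * (K * v1\<^sup>2 + K * v2\<^sup>2) + 46 * ((c\<^sup>2 + K / 100) * (v1 * v2))"
      using U4 V4 UV2 by (intro add_mono mult_left_mono) auto
    also have "\<dots> \<le> 6/5 * (K * v1\<^sup>2 + K * v2\<^sup>2) + 46 * ((K / 69 + K / 100) * (v1 * v2))"
      using K vpos by (intro add_mono mult_left_mono mult_right_mono) auto
    also have "\<dots> = K * (6/5 * (v1\<^sup>2 + v2\<^sup>2) + 46 * (1/69 + 1/100) * (v1 * v2))"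
      by (simp add: algebra_simps)
    also have "\<dots> \<le> K * v\<^sup>2"
    proof (rule mult_left_mono[OF _ K0])
      have vsum: "v = v1 + v2" unfolding v n[symmetric] by (rule distrib_right)
      have "0 \<le> (3 * v1 - v) * (2 * v - 3 * v1)"
      proof (rule mult_nonneg_nonneg)
        show "0 \<le> 3 * v1 - v" using mult_right_mono[OF n1(1), of P] P1 v by (simp add: algebra_simps)
        have "v1 \<le> v2" using mult_right_mono[OF n1(2), of P] P1 v by simp
        then show "0 \<le> 2 * v - 3 * v1" using vsum vpos by linarith
      qed
      then have a: "v1\<^sup>2 + v2\<^sup>2 \<le> 5/9 * v\<^sup>2"
        unfolding vsum by (simp add: power2_eq_square algebra_simps)
      have "0 \<le> (v1 - v2)\<^sup>2" by simp
      then have b: "v1 * v2 \<le> 1/4 * v\<^sup>2"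
        unfolding vsum by (simp add: power2_eq_square algebra_simps)
      show "6/5 * (v1\<^sup>2 + v2\<^sup>2) + 46 * (1/69 + 1/100) * (v1 * v2) \<le> v\<^sup>2"
      proof -
        have "6/5 * x + 46 * (1/69 + 1/100) * y \<le> z" if "x \<le> 5/9 * z" "y \<le> 1/4 * z" "0 \<le> z" for x y z :: real
        proof -
          have "6/5 * x \<le> 2/3 * z" using that(1) by simp
          moreover have "46 * (1/69 + 1/100) * y \<le> 1/3 * z" using that(2,3) by simp
          ultimately show ?thesis by simp
        qed
        from this[OF a b] show ?thesis by simp
      qed
    qed
    finally show ?thesis unfolding v_def .
  qed
qed

text \<open>Sides that are not spaced are split into their \<open>g\<close> residue classes, which are; each such direction costs the
factor \<open>g ^ 4\<close>.\<close>

lemma fourth_moment_box: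
  assumes \<phi>: "centred \<phi>" and B: "\<And>x. \<bar>\<phi> x\<bar> \<le> B" and g: "1 \<le> g" "rho g \<le> 1/100"
    and c: "0 \<le> c" "\<And>Q. finite Q \<Longrightarrow> (\<integral>w. (psum \<phi> Q w)\<^sup>2 \<partial>M) \<le> c * real (card Q)"
    and K: "B ^ 4 \<le> K" "69 * c\<^sup>2 \<le> K"
    and "finite D" "\<And>u. finite (I u)" "\<And>u. u \<notin> D \<Longrightarrow> spaced g (I u)"
  shows "(\<integral>w. (psum \<phi> (int_box I) w) ^ 4 \<partial>M) \<le> (real g ^ 4) ^ card D * K * (real (card (int_box I)))\<^sup>2"
  using assms(9-)
proof (induction D arbitrary: I rule: finite_induct)
  case empty
  then show ?case using fourth_moment_spaced[OF \<phi> B g(2) c K, of I] by simp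
next
  case (insert u D)
  note int4 = psum_power_integrable[OF centredD(1)[OF \<phi>] B]
  have K0: "0 \<le> K" using K(2) by (meson order_trans mult_nonneg_nonneg zero_le_numeral zero_le_power2)
  define R where "R = {0..<int g}"
  define Is where "Is s = I(u := {x \<in> I u. x mod int g = s})" for s
  have fin: "finite (int_box I)" using insert.prems(1) by (rule finite_box)
  have box_Is: "{k \<in> int_box I. k $ u mod int g = s} = int_box (Is s)" for s
    by (auto simp: int_box_def Is_def split: if_splits)
  have split: "psum \<phi> (int_box I) w = (\<Sum>s\<in>R. psum \<phi> (int_box (Is s)) w)" for w
    unfolding box_Is[symmetric] using g by (intro psum_group fin) (auto simp: R_def)
  have IH: "(\<integral>w. (psum \<phi> (int_box (Is s)) w) ^ 4 \<partial>M) \<le> (real g ^ 4) ^ card D * K * (real (card (int_box I)))\<^sup>2" for s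
  proof -
    have "(\<integral>w. (psum \<phi> (int_box (Is s)) w) ^ 4 \<partial>M) \<le> (real g ^ 4) ^ card D * K * (real (card (int_box (Is s))))\<^sup>2"
    proof (rule insert.IH)
      show "finite (Is s v)" for v using insert.prems(1) by (auto simp: Is_def)
      fix v assume v: "v \<notin> D"
      show "spaced g (Is s v)"
      proof (cases "v = u")
        case True
        have "int g \<le> \<bar>x - y\<bar>" if "x mod int g = s" "y mod int g = s" "x \<noteq> y" for x y
        proof -
          have "int g dvd x - y"
            using that unfolding mod_eq_dvd_iff[symmetric] by simp
          then show ?thesis using that dvd_imp_le_int[of "x - y" "int g"] by simp
        qed
        with True show ?thesis by (simp add: Is_def spaced_def)
      qed (use v insert.prems(2) in \<open>auto simp: Is_def\<close>)
    qed
    also have "\<dots> \<le> (real g ^ 4) ^ card D * K * (real (card (int_box I)))\<^sup>2"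
      unfolding box_Is[symmetric] using K0 fin by (intro mult_left_mono power_mono) (auto intro: card_mono)
    finally show ?thesis .
  qed
  have "(\<integral>w. (psum \<phi> (int_box I) w) ^ 4 \<partial>M) \<le> (\<integral>w. (\<Sum>s\<in>R. (psum \<phi> (int_box (Is s)) w) ^ 4) * real (card R) ^ 3 \<partial>M)"
  proof (rule integral_mono)
    show "integrable M (\<lambda>w. (\<Sum>s\<in>R. (psum \<phi> (int_box (Is s)) w) ^ 4) * real (card R) ^ 3)"
      by (intro integrable_mult_left Bochner_Integration.integrable_sum int4)
    show "(psum \<phi> (int_box I) w) ^ 4 \<le> (\<Sum>s\<in>R. (psum \<phi> (int_box (Is s)) w) ^ 4) * real (card R) ^ 3" for w
      unfolding split by (rule sum_fourth_power_le)
  qed (rule int4)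
  also have "\<dots> = (\<Sum>s\<in>R. \<integral>w. (psum \<phi> (int_box (Is s)) w) ^ 4 \<partial>M) * real g ^ 3"
    using int4 by (simp add: R_def)
  also have "\<dots> \<le> (\<Sum>s\<in>R. (real g ^ 4) ^ card D * K * (real (card (int_box I)))\<^sup>2) * real g ^ 3"
    by (intro mult_right_mono sum_mono IH) simp
  also have "\<dots> = (real g ^ 4) ^ card (insert u D) * K * (real (card (int_box I)))\<^sup>2"
    using insert.hyps by (simp add: R_def power3_eq_cube power4_eq_xxxx)
  finally show ?case .
qed

lemma fourth_moment_rect:
  assumes \<phi>: "centred \<phi>" and B: "\<And>x. \<bar>\<phi> x\<bar> \<le> B"
  obtains K where "0 \<le> K" "\<And>L. (\<integral>w. (psum \<phi> (rect L) w) ^ 4 \<partial>M) \<le> K * (vol L)\<^sup>2"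
proof -
  obtain g where g: "1 \<le> g" "rho g < 1/100" using rho_small[of "1/100"] by auto
  define c where "c = var_const * variance0 \<phi>"
  have c: "0 \<le> c" "\<And>Q. finite Q \<Longrightarrow> (\<integral>w. (psum \<phi> Q w)\<^sup>2 \<partial>M) \<le> c * real (card Q)"
    using var_const_pos psum_variance_bound[OF \<phi>] by (auto simp: c_def mult_ac)
  define K where "K = max (B ^ 4) (69 * c\<^sup>2)"
  show ?thesis
  proof (rule that[of "(real g ^ 4) ^ CARD('d) * K"])
    have "0 \<le> 69 * c\<^sup>2" by simp
    then show "0 \<le> (real g ^ 4) ^ CARD('d) * K" unfolding K_def by (intro mult_nonneg_nonneg) (auto simp: le_max_iff_disj)
    show "(\<integral>w. (psum \<phi> (rect L) w) ^ 4 \<partial>M) \<le> (real g ^ 4) ^ CARD('d) * K * (vol L)\<^sup>2" for L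
      unfolding card_rect[symmetric] rect_eq_box
      by (rule fourth_moment_box[OF \<phi> B g(1) less_imp_le[OF g(2)] c]) (auto simp: K_def)
  qed
qed

section \<open>Truncation and the second-order expansion of characteristic functions\<close>

lemma centred_recentre:
  assumes "\<psi> \<in> borel_measurable borel" "(\<lambda>w. \<psi> (X 0 w)) \<in> L2_real M M"
  shows "centred (\<lambda>x. \<psi> x - (\<integral>w. \<psi> (X 0 w) \<partial>M))"
  unfolding centred_def
  using assms centred_L2(1)[OF assms(2)] L2_real_integrable[OF assms(2)] by (auto simp: prob_space)

text \<open>Clipping at height \<open>n\<close> and recentring leaves a remainder of small variance, by dominated convergence.
Applied to every variable of the field, this keeps stationarity and mixing, since both parts are functions of
the same field.\<close>

lemma truncation:
  assumes \<phi>: "centred \<phi>" and \<delta>: "0 < \<delta>"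
  obtains \<phi>' \<phi>'' B where "centred \<phi>'" "centred \<phi>''" "\<And>x. \<phi> x = \<phi>' x + \<phi>'' x"
    "\<And>x. \<bar>\<phi>' x\<bar> \<le> B" "variance0 \<phi>'' \<le> \<delta>"
proof -
  note [measurable] = centredD(1)[OF \<phi>]
  define c where "c n x = max (- real n) (min (real n) (\<phi> x))" for n x
  have c[measurable]: "c n \<in> borel_measurable borel" for n unfolding c_def by measurable
  have cX: "(\<lambda>w. c n (X 0 w)) \<in> borel_measurable M" for n
    by (rule measurable_compose[OF X_measurable c])
  have \<phi>X: "(\<lambda>w. \<phi> (X 0 w)) \<in> borel_measurable M"
    by (rule measurable_compose[OF X_measurable centredD(1)[OF \<phi>]])
  have cB: "\<bar>c n x\<bar> \<le> real n" for n x unfolding c_def by auto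
  have L2c: "(\<lambda>w. c n (X 0 w)) \<in> L2_real M M" for n
    using cX cB by (rule L2_real_bounded)
  have L2d: "(\<lambda>w. \<phi> (X 0 w) - c n (X 0 w)) \<in> L2_real M M" for n
    by (intro L2_real_diff centredD(2)[OF \<phi>] L2c)
  have "(\<lambda>n. \<integral>w. (\<phi> (X 0 w) - c n (X 0 w))\<^sup>2 \<partial>M) \<longlonglongrightarrow> (\<integral>w. 0 \<partial>M)"
  proof (rule integral_dominated_convergence[where w = "\<lambda>w. (\<phi> (X 0 w))\<^sup>2"])
    show "AE w in M. (\<lambda>n. (\<phi> (X 0 w) - c n (X 0 w))\<^sup>2) \<longlonglongrightarrow> 0"
    proof (rule AE_I2)
      fix w
      have "eventually (\<lambda>n. \<bar>\<phi> (X 0 w)\<bar> \<le> real n) sequentially"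
        by real_asymp
      then have "eventually (\<lambda>n. (\<phi> (X 0 w) - c n (X 0 w))\<^sup>2 = 0) sequentially"
        by eventually_elim (auto simp: c_def)
      then show "(\<lambda>n. (\<phi> (X 0 w) - c n (X 0 w))\<^sup>2) \<longlonglongrightarrow> 0" by (rule tendsto_eventually)
    qed
    show "AE w in M. norm ((\<phi> (X 0 w) - c n (X 0 w))\<^sup>2) \<le> (\<phi> (X 0 w))\<^sup>2" for n
      by (rule AE_I2) (auto simp: c_def abs_le_square_iff[symmetric] max_def min_def)
  qed (use L2_realD[OF centredD(2)[OF \<phi>]] cX \<phi>X in auto)
  then have "eventually (\<lambda>n. (\<integral>w. (\<phi> (X 0 w) - c n (X 0 w))\<^sup>2 \<partial>M) < \<delta>) sequentially"
    using \<delta> by (intro order_tendstoD(2)) auto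
  then obtain n where n: "(\<integral>w. (\<phi> (X 0 w) - c n (X 0 w))\<^sup>2 \<partial>M) < \<delta>"
    by (auto simp: eventually_sequentially)
  define a where "a = (\<integral>w. c n (X 0 w) \<partial>M)"
  show ?thesis
  proof (rule that)
    show "centred (\<lambda>x. c n x - a)" unfolding a_def by (rule centred_recentre[OF c L2c])
    have eq: "(\<integral>w. \<phi> (X 0 w) - c n (X 0 w) \<partial>M) = - a"
      using L2_real_integrable[OF centredD(2)[OF \<phi>]] L2_real_integrable[OF L2c] centredD(3)[OF \<phi>]
      by (simp add: a_def)
    have "(\<lambda>x. \<phi> x - c n x) \<in> borel_measurable borel" by measurable
    from centred_recentre[OF this L2d]
    show "centred (\<lambda>x. \<phi> x - c n x + a)" unfolding eq by simp
    show "\<phi> x = c n x - a + (\<phi> x - c n x + a)" for x by simp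
    show "\<bar>c n x - a\<bar> \<le> real n + \<bar>a\<bar>" for x using cB[of n x] by linarith
    have "variance0 (\<lambda>x. \<phi> x - c n x + a) = covar M (\<lambda>w. \<phi> (X 0 w) - c n (X 0 w)) (\<lambda>w. \<phi> (X 0 w) - c n (X 0 w))"
      unfolding variance0_def covar_def eq by (simp add: power2_eq_square)
    also have "\<dots> \<le> (\<integral>w. (\<phi> (X 0 w) - c n (X 0 w))\<^sup>2 \<partial>M)"
      by (simp add: centred_L2(2)[OF L2d])
    finally show "variance0 (\<lambda>x. \<phi> x - c n x + a) \<le> \<delta>" using n by simp
  qed
qed

end

text \<open>The remainder of the second-order expansion at \<open>z\<close> is at most both \<open>z\<^sup>2\<close> and \<open>|z| ^ 3 / 6\<close>. Use the first bound where
\<open>|x| \<le> |y|\<close> and the second elsewhere; in both cases \<open>|z|\<close> is at most twice the larger of \<open>|x|\<close> and \<open>|y|\<close>.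
Splitting \<open>|x| ^ 3\<close> into a second and a fourth moment makes the bound integrable with the moments available.\<close>

lemma iexp_second_order:
  fixes x y \<eta> :: real
  assumes \<eta>: "0 < \<eta>"
  shows "cmod (iexp (x + y) - (1 + \<i> * (x + y) - (x + y)\<^sup>2 / 2)) \<le> 4 * y\<^sup>2 + 4/3 * (\<eta> * x\<^sup>2 + x ^ 4 / \<eta>)"
proof -
  define z where "z = x + y"
  define R where "R = cmod (iexp z - (1 + \<i> * z - z\<^sup>2 / 2))"
  have sum: "(\<Sum>k\<le>2. (\<i> * complex_of_real z) ^ k / fact k) = 1 + \<i> * z - z\<^sup>2 / 2"
    by (simp add: numeral_2_eq_2 power_mult_distrib)
  have R1: "R \<le> \<bar>z\<bar> ^ 3 / 6"
    using iexp_approx1[of z 2] unfolding sum R_def by (simp add: eval_nat_numeral)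
  have R2: "R \<le> z\<^sup>2"
    using iexp_approx2[of z 2] unfolding sum R_def by simp
  have cube: "\<bar>x\<bar> ^ 3 \<le> \<eta> * x\<^sup>2 + x ^ 4 / \<eta>"
  proof -
    have "2 * \<eta> * \<bar>x\<bar> \<le> \<eta>\<^sup>2 + \<bar>x\<bar>\<^sup>2" by (rule sum_squares_bound)
    moreover have "0 \<le> \<eta> * \<bar>x\<bar>" using \<eta> by simp
    ultimately have "\<eta> * \<bar>x\<bar> \<le> \<eta>\<^sup>2 + x\<^sup>2" unfolding power2_abs by linarith
    then have "\<bar>x\<bar> \<le> \<eta> + x\<^sup>2 / \<eta>" using \<eta> by (simp add: field_simps power2_eq_square)
    then have "x\<^sup>2 * \<bar>x\<bar> \<le> x\<^sup>2 * (\<eta> + x\<^sup>2 / \<eta>)" by (intro mult_left_mono) auto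
    moreover have "\<bar>x\<bar> ^ 3 = x\<^sup>2 * \<bar>x\<bar>" by (simp add: power3_eq_cube power2_eq_square)
    ultimately show ?thesis by (simp add: algebra_simps power2_eq_square power4_eq_xxxx)
  qed
  have R: "cmod (iexp (x + y) - (1 + \<i> * (x + y) - (x + y)\<^sup>2 / 2)) = R"
    by (simp add: R_def z_def)
  define b where "b = \<eta> * x\<^sup>2 + x ^ 4 / \<eta>"
  have nn: "0 \<le> b" using \<eta> by (simp add: b_def)
  note cube = cube[folded b_def]
  show ?thesis
  proof (cases "\<bar>x\<bar> \<le> \<bar>y\<bar>")
    case True
    then have "\<bar>z\<bar> \<le> 2 * \<bar>y\<bar>" unfolding z_def by linarith
    then have "\<bar>z\<bar>\<^sup>2 \<le> (2 * \<bar>y\<bar>)\<^sup>2" by (rule power_mono) simp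
    then have "z\<^sup>2 \<le> 4 * y\<^sup>2" by (simp add: power_mult_distrib)
    with R2 nn show ?thesis unfolding R b_def[symmetric] by linarith
  next
    case False
    then have "\<bar>z\<bar> \<le> 2 * \<bar>x\<bar>" unfolding z_def by linarith
    then have "\<bar>z\<bar> ^ 3 \<le> (2 * \<bar>x\<bar>) ^ 3" by (rule power_mono) simp
    then have "\<bar>z\<bar> ^ 3 / 6 \<le> 4/3 * \<bar>x\<bar> ^ 3" by (simp add: power_mult_distrib)
    moreover have "0 \<le> 4 * y\<^sup>2" by simp
    ultimately show ?thesis using R1 cube unfolding R b_def[symmetric] by linarith
  qed
qed

context mixing_field
begin

text \<open>The point is the uniformity in \<open>L\<close>: for \<open>s\<^sup>2 vol L\<close> of order \<open>1 / p\<close> the right-hand side is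
\<open>\<delta> / p + K / p\<^sup>2\<close> up to constants, and \<open>\<delta>\<close> is arbitrary, so it is \<open>o(1 / p)\<close>. The truncated part has bounded fourth moments and the
remainder of the truncation has small variance.\<close>

lemma char_expansion:
  assumes \<phi>: "centred \<phi>" and \<delta>: "0 < \<delta>"
  obtains K where "0 \<le> K" "\<And>L s. cmod ((\<integral>w. iexp (s * psum \<phi> (rect L) w) \<partial>M) - (1 - s\<^sup>2 * var_rect \<phi> L / 2))
    \<le> \<delta> * (s\<^sup>2 * vol L) + K * (s\<^sup>2 * vol L)\<^sup>2"
proof -
  have "0 < \<delta> / (8 * var_const)" using \<delta> var_const_pos by simp
  from truncation[OF \<phi> this] obtain \<phi>' \<phi>'' B where tr: "centred \<phi>'" "centred \<phi>''" "\<And>x. \<phi> x = \<phi>' x + \<phi>'' x"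
    "\<And>x. \<bar>\<phi>' x\<bar> \<le> B" "variance0 \<phi>'' \<le> \<delta> / (8 * var_const)" by blast
  from fourth_moment_rect[OF tr(1,4)] obtain K0 where K0: "0 \<le> K0"
    "\<And>L. (\<integral>w. (psum \<phi>' (rect L) w) ^ 4 \<partial>M) \<le> K0 * (vol L)\<^sup>2" by blast
  define c where "c = var_const * variance0 \<phi>' + 1"
  have c: "0 < c" using var_const_pos by (simp add: c_def add_nonneg_pos)
  define \<eta> where "\<eta> = 3 * \<delta> / (8 * c)"
  have \<eta>: "0 < \<eta>" using \<delta> c by (simp add: \<eta>_def)
  show ?thesis
  proof (rule that[of "4/3 * (K0 / \<eta>)"])
    show "0 \<le> 4/3 * (K0 / \<eta>)" using K0 \<eta> by simp
    fix L s
    define S where "S = psum \<phi> (rect L)"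
    define S' where "S' = psum \<phi>' (rect L)"
    define S'' where "S'' = psum \<phi>'' (rect L)"
    have S: "S w = S' w + S'' w" for w
      by (simp add: S_def S'_def S''_def psum_def tr(3) sum.distrib)
    have L2: "S \<in> L2_real M M" "S' \<in> L2_real M M" "S'' \<in> L2_real M M"
      unfolding S_def S'_def S''_def by (intro psum_L2 \<phi> tr)+
    note [measurable] = L2[THEN L2_realD(1)]
    have int4: "integrable M (\<lambda>w. (S' w) ^ 4)"
      unfolding S'_def by (rule psum_power_integrable[OF centredD(1)[OF tr(1)] tr(4)])
    have int2: "integrable M (\<lambda>w. (S w)\<^sup>2)" "integrable M (\<lambda>w. (S' w)\<^sup>2)" "integrable M (\<lambda>w. (S'' w)\<^sup>2)"
      using L2[THEN L2_realD(2)] by auto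
    have intS: "integrable M S" using L2_real_integrable[OF L2(1)] .
    have ES: "(\<integral>w. S w \<partial>M) = 0" unfolding S_def by (rule expectation_psum[OF \<phi>])
    have inte: "integrable M (\<lambda>w. iexp (s * S w))"
      by (rule integrable_iexp) measurable
    let ?T = "\<lambda>w. complex_of_real (1 - (s * S w)\<^sup>2 / 2) + \<i> * complex_of_real (s * S w)"
    have int1: "integrable M (\<lambda>w. 1 - (s * S w)\<^sup>2 / 2)" "integrable M (\<lambda>w. s * S w)"
      using int2 intS by (auto simp: power_mult_distrib)
    have intT: "integrable M ?T"
      by (intro Bochner_Integration.integrable_add integrable_mult_right integrable_of_real int1)
    have T: "(\<integral>w. ?T w \<partial>M) = 1 - s\<^sup>2 * var_rect \<phi> L / 2"
    proof -
      have "(\<integral>w. ?T w \<partial>M) = complex_of_real (\<integral>w. 1 - (s * S w)\<^sup>2 / 2 \<partial>M) + \<i> * complex_of_real (\<integral>w. s * S w \<partial>M)"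
        by (subst Bochner_Integration.integral_add)
          (intro integrable_mult_right integrable_of_real int1,
            intro integrable_mult_right integrable_of_real int1,
            simp only: integral_mult_right_zero integral_complex_of_real)
      also have "(\<integral>w. s * S w \<partial>M) = 0" using ES by simp
      also have "(\<integral>w. 1 - (s * S w)\<^sup>2 / 2 \<partial>M) = 1 - s\<^sup>2 * var_rect \<phi> L / 2"
        using int2 by (simp add: prob_space power_mult_distrib var_rect_def S_def)
      finally show ?thesis by simp
    qed
    have bound: "cmod (iexp (s * S w) - ?T w) \<le> 4 * (s * S'' w)\<^sup>2 + 4/3 * (\<eta> * (s * S' w)\<^sup>2 + (s * S' w) ^ 4 / \<eta>)" for w
      using iexp_second_order[OF \<eta>, of "s * S' w" "s * S'' w"] by (simp add: S algebra_simps)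
    have "cmod ((\<integral>w. iexp (s * S w) \<partial>M) - (1 - s\<^sup>2 * var_rect \<phi> L / 2)) = cmod (\<integral>w. iexp (s * S w) - ?T w \<partial>M)"
      using inte intT T by simp
    also have "\<dots> \<le> (\<integral>w. cmod (iexp (s * S w) - ?T w) \<partial>M)"
      by (rule integral_norm_bound)
    also have "\<dots> \<le> (\<integral>w. 4 * (s * S'' w)\<^sup>2 + 4/3 * (\<eta> * (s * S' w)\<^sup>2 + (s * S' w) ^ 4 / \<eta>) \<partial>M)"
      using inte intT int2 int4
      by (intro integral_mono bound) (auto simp: power_mult_distrib)
    also have "\<dots> = 4 * s\<^sup>2 * (\<integral>w. (S'' w)\<^sup>2 \<partial>M) + 4/3 * (\<eta> * s\<^sup>2 * (\<integral>w. (S' w)\<^sup>2 \<partial>M) + s ^ 4 * (\<integral>w. (S' w) ^ 4 \<partial>M) / \<eta>)"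
      using int2 int4 by (simp add: power_mult_distrib)
    also have "\<dots> \<le> 4 * s\<^sup>2 * (\<delta> / 8 * vol L) + 4/3 * (\<eta> * s\<^sup>2 * (c * vol L) + s ^ 4 * (K0 * (vol L)\<^sup>2) / \<eta>)"
    proof (intro add_mono mult_left_mono divide_right_mono)
      have "(\<integral>w. (S'' w)\<^sup>2 \<partial>M) \<le> var_const * vol L * variance0 \<phi>''"
        using var_rect_le[OF tr(2), of L] by (simp add: S''_def var_rect_def)
      also have "\<dots> \<le> var_const * vol L * (\<delta> / (8 * var_const))"
        using var_const_pos by (intro mult_left_mono tr(5)) auto
      finally show "(\<integral>w. (S'' w)\<^sup>2 \<partial>M) \<le> \<delta> / 8 * vol L"
        using var_const_pos by (simp add: mult.commute)
      have "(\<integral>w. (S' w)\<^sup>2 \<partial>M) \<le> var_const * vol L * variance0 \<phi>'"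
        using var_rect_le[OF tr(1), of L] by (simp add: S'_def var_rect_def)
      also have "\<dots> \<le> c * vol L" by (simp add: c_def algebra_simps)
      finally show "(\<integral>w. (S' w)\<^sup>2 \<partial>M) \<le> c * vol L" .
      show "(\<integral>w. (S' w) ^ 4 \<partial>M) \<le> K0 * (vol L)\<^sup>2" unfolding S'_def by (rule K0)
    qed (use \<eta> in auto)
    also have "\<dots> = \<delta> * (s\<^sup>2 * vol L) + 4/3 * (K0 / \<eta>) * (s\<^sup>2 * vol L)\<^sup>2"
    proof -
      have "\<eta> * c = 3 * \<delta> / 8" using c by (simp add: \<eta>_def)
      then have "\<eta> * s\<^sup>2 * (c * vol L) = 3 * \<delta> / 8 * (s\<^sup>2 * vol L)" by (metis mult.assoc mult.commute)
      then have *: "\<eta> * s\<^sup>2 * (c * vol L) = 3 * \<delta> / 8 * (s\<^sup>2 * vol L)" .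
      show ?thesis unfolding * by (simp add: algebra_simps power2_eq_square power4_eq_xxxx)
    qed
    finally show "cmod ((\<integral>w. iexp (s * psum \<phi> (rect L) w) \<partial>M) - (1 - s\<^sup>2 * var_rect \<phi> L / 2))
        \<le> \<delta> * (s\<^sup>2 * vol L) + 4/3 * (K0 / \<eta>) * (s\<^sup>2 * vol L)\<^sup>2"
      by (simp add: S_def)
  qed
qed

end

section \<open>The central limit theorem for real functionals\<close>

lemma (in prob_space) iexp_expectation:
  assumes "f \<in> borel_measurable M"
  shows "(\<integral>w. iexp (f w) \<partial>M) = complex_of_real (\<integral>w. cos (f w) \<partial>M) + \<i> * complex_of_real (\<integral>w. sin (f w) \<partial>M)"
proof -
  note [measurable] = assms
  have int: "integrable M (\<lambda>w. cos (f w))" "integrable M (\<lambda>w. sin (f w))"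
    by (rule integrable_const_bound[of _ 1], simp, measurable)+
  have "(\<integral>w. iexp (f w) \<partial>M) = (\<integral>w. complex_of_real (cos (f w)) + \<i> * complex_of_real (sin (f w)) \<partial>M)"
    by (intro Bochner_Integration.integral_cong refl complex_eqI) (simp_all add: Re_exp Im_exp)
  also have "\<dots> = complex_of_real (\<integral>w. cos (f w) \<partial>M) + \<i> * complex_of_real (\<integral>w. sin (f w) \<partial>M)"
    by (subst Bochner_Integration.integral_add)
      (intro integrable_mult_right integrable_of_real int,
        intro integrable_mult_right integrable_of_real int,
        simp only: integral_mult_right_zero integral_complex_of_real)
  finally show ?thesis .
qed

lemma (in prob_space) norm_expectation_iexp_le_1:
  "f \<in> borel_measurable M \<Longrightarrow> cmod (\<integral>w. iexp (f w) \<partial>M) \<le> 1"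
  by (rule order_trans[OF integral_norm_bound]) (simp add: prob_space)

lemma cmod_iexp_diff_le: "cmod (iexp x - iexp y) \<le> \<bar>x - y\<bar>"
proof -
  have "\<i> * complex_of_real x = \<i> * complex_of_real y + \<i> * complex_of_real (x - y)"
    by (simp add: algebra_simps)
  then have "iexp x = iexp y * iexp (x - y)"
    by (simp only: exp_add)
  then have "iexp x - iexp y = iexp y * (iexp (x - y) - 1)"
    by (simp only: right_diff_distrib mult_1_right)
  then have "cmod (iexp x - iexp y) = cmod (iexp (x - y) - 1)" by (simp add: norm_mult)
  also have "\<dots> \<le> \<bar>x - y\<bar>" using iexp_approx1[of "x - y" 0] by simp
  finally show ?thesis .
qed

context mixing_field
begin

text \<open>Real and imaginary parts consist of two covariances each, of functions bounded by one.\<close>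

lemma mixing_iexp:
  assumes sep: "separated_sets n Q S"
    and f: "f \<in> borel_measurable (sigma_gen_by M X Q)" and g: "g \<in> borel_measurable (sigma_gen_by M X S)"
  shows "cmod ((\<integral>w. iexp (f w + g w) \<partial>M) - (\<integral>w. iexp (f w) \<partial>M) * (\<integral>w. iexp (g w) \<partial>M)) \<le> 4 * rho n"
proof -
  note fM[measurable] = borel_measurable_sigma_gen_by[OF f] and gM[measurable] = borel_measurable_sigma_gen_by[OF g]
  define cov where "cov a b = (\<integral>w. a (f w) * b (g w) \<partial>M) - (\<integral>w. a (f w) \<partial>M) * (\<integral>w. b (g w) \<partial>M)" for a b :: "real \<Rightarrow> real"
  have cov: "\<bar>cov a b\<bar> \<le> rho n"
    if [measurable]: "a \<in> borel_measurable borel" "b \<in> borel_measurable borel"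
      and ab: "\<And>x. \<bar>a x\<bar> \<le> 1" "\<And>x. \<bar>b x\<bar> \<le> 1" for a b
  proof -
    have af: "(\<lambda>w. a (f w)) \<in> borel_measurable (sigma_gen_by M X Q)"
      and bg: "(\<lambda>w. b (g w)) \<in> borel_measurable (sigma_gen_by M X S)"
      using f g that(1,2) by (auto intro: measurable_compose)
    note afM = borel_measurable_sigma_gen_by[OF af] and bgM = borel_measurable_sigma_gen_by[OF bg]
    have "\<bar>cov a b\<bar> \<le> rho n * (l2norm M (\<lambda>w. a (f w)) * l2norm M (\<lambda>w. b (g w)))"
      unfolding cov_def
    proof (rule mixing_inequality[OF sep])
      show "(\<lambda>w. a (f w)) \<in> L2_real M (sigma_gen_by M X Q)"
        using af L2_realD(2)[OF L2_real_bounded[OF afM ab(1)]] by (simp add: L2_real_def)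
      show "(\<lambda>w. b (g w)) \<in> L2_real M (sigma_gen_by M X S)"
        using bg L2_realD(2)[OF L2_real_bounded[OF bgM ab(2)]] by (simp add: L2_real_def)
    qed
    also have "\<dots> \<le> rho n * (1 * 1)"
      using l2norm_bounded[OF afM ab(1)] l2norm_bounded[OF bgM ab(2)]
      by (intro mult_left_mono mult_mono rho_nonneg) auto
    finally show ?thesis by simp
  qed
  have int: "integrable M (\<lambda>w. a (f w) * b (g w))"
    if [measurable]: "a \<in> borel_measurable borel" "b \<in> borel_measurable borel"
      and ab: "\<And>x. \<bar>a x\<bar> \<le> 1" "\<And>x. \<bar>b x\<bar> \<le> 1" for a b :: "real \<Rightarrow> real"
    by (rule integrable_const_bound[of _ "1"]) (auto simp: abs_mult intro!: mult_le_one ab)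
  have E: "(\<integral>w. cos (f w + g w) \<partial>M) = (\<integral>w. cos (f w) * cos (g w) \<partial>M) - (\<integral>w. sin (f w) * sin (g w) \<partial>M)"
    "(\<integral>w. sin (f w + g w) \<partial>M) = (\<integral>w. sin (f w) * cos (g w) \<partial>M) + (\<integral>w. cos (f w) * sin (g w) \<partial>M)"
    unfolding cos_add sin_add using int by auto
  have eq: "(\<integral>w. iexp (f w + g w) \<partial>M) - (\<integral>w. iexp (f w) \<partial>M) * (\<integral>w. iexp (g w) \<partial>M)
      = complex_of_real (cov cos cos - cov sin sin) + \<i> * complex_of_real (cov sin cos + cov cos sin)"
    unfolding iexp_expectation[OF fM] iexp_expectation[OF gM] iexp_expectation[OF borel_measurable_add[OF fM gM]] E cov_def
    by (simp add: algebra_simps)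
  have "cmod (complex_of_real (cov cos cos - cov sin sin) + \<i> * complex_of_real (cov sin cos + cov cos sin))
      \<le> \<bar>cov cos cos - cov sin sin\<bar> + \<bar>cov sin cos + cov cos sin\<bar>"
    by (rule order_trans[OF norm_triangle_ineq]) (simp add: norm_mult flip: of_real_diff of_real_add)
  also have "\<dots> \<le> 4 * rho n"
  proof -
    have m1: "(cos :: real \<Rightarrow> real) \<in> borel_measurable borel"
      by (rule borel_measurable_continuous_onI[OF continuous_on_cos[OF continuous_on_id]])
    have m2: "(sin :: real \<Rightarrow> real) \<in> borel_measurable borel"
      by (rule borel_measurable_continuous_onI[OF continuous_on_sin[OF continuous_on_id]])
    have c1: "\<bar>cov cos cos\<bar> \<le> rho n" by (rule cov[OF m1 m1 abs_cos_le_one abs_cos_le_one])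
    have c2: "\<bar>cov sin sin\<bar> \<le> rho n" by (rule cov[OF m2 m2 abs_sin_le_one abs_sin_le_one])
    have c3: "\<bar>cov sin cos\<bar> \<le> rho n" by (rule cov[OF m2 m1 abs_sin_le_one abs_cos_le_one])
    have c4: "\<bar>cov cos sin\<bar> \<le> rho n" by (rule cov[OF m1 m2 abs_cos_le_one abs_sin_le_one])
    show ?thesis using c1 c2 c3 c4
      by linarith
  qed
  finally show ?thesis unfolding eq .
qed

text \<open>Split off one slab at a time; the slabs before it are at distance at least \<open>g\<close>, so each step costs
\<open>4 rho g\<close>. By stationarity all slabs have the same characteristic function.\<close>

lemma slabs_decouple:
  assumes \<phi>: "\<phi> \<in> borel_measurable borel" and w: "l + g \<le> w" "p * w \<le> L $ u"
    and l: "1 \<le> l" and L: "\<And>v. 1 \<le> L $ v"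
  shows "cmod ((\<integral>x. iexp (s * (\<Sum>j<p. psum \<phi> (slab L u w l j) x)) \<partial>M)
    - (\<integral>x. iexp (s * psum \<phi> (rect (upd L u l)) x) \<partial>M) ^ p) \<le> 4 * real p * rho g"
proof -
  note [measurable] = psum_measurable[OF \<phi>]
  define a where "a = (\<integral>x. iexp (s * psum \<phi> (rect (upd L u l)) x) \<partial>M)"
  define B where "B j = psum \<phi> (slab L u w l j)" for j
  have [measurable]: "B j \<in> borel_measurable M" for j unfolding B_def by measurable
  have lw: "l \<le> w" using w by simp
  have a1: "cmod a \<le> 1" unfolding a_def by (rule norm_expectation_iexp_le_1) measurable
  have Ba: "(\<integral>x. iexp (s * B j x) \<partial>M) = a" if "j < p" for j
    unfolding B_def a_def
    by (rule integral_slab[OF that lw w(2) \<phi>, where F = "\<lambda>y. iexp (s * y)"]) measurable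
  have ne: "slab L u w l j \<noteq> {}" if "j < p" for j
  proof
    assume "slab L u w l j = {}"
    then have "vol (upd L u l) = 0" using card_slab[OF that lw w(2)] by simp
    moreover have "0 < vol (upd L u l)" using L l by (intro vol_pos) auto
    ultimately show False by simp
  qed
  have "cmod ((\<integral>x. iexp (s * (\<Sum>j<q. B j x)) \<partial>M) - a ^ q) \<le> 4 * real q * rho g" if "q \<le> p" for q
    using that
  proof (induction q)
    case 0
    then show ?case by (simp add: prob_space)
  next
    case (Suc q)
    define E where "E = (\<integral>x. iexp (s * (\<Sum>j<q. B j x)) \<partial>M)"
    define E' where "E' = (\<integral>x. iexp (s * (\<Sum>j<Suc q. B j x)) \<partial>M)"
    have step: "cmod (E' - E * a) \<le> 4 * rho g"
    proof (cases "q = 0")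
      case True
      then show ?thesis using Ba[of 0] Suc.prems by (simp add: E_def E'_def prob_space rho_nonneg)
    next
      case False
      let ?Q = "\<Union>j<q. slab L u w l j" and ?S = "slab L u w l q"
      have sep: "separated_sets g ?Q ?S"
      proof (rule separated_setsI[of _ _ u])
        show "?Q \<noteq> {}" using ne[of 0] False Suc.prems by auto
        show "?S \<noteq> {}" using ne[of q] Suc.prems by auto
        fix k m assume "k \<in> ?Q" "m \<in> ?S"
        then obtain i where i: "i < q" "k \<in> slab L u w l i" by auto
        then have "Suc i * w \<le> q * w" by (intro mult_le_mono1) simp
        then have "int (i * w) + int w \<le> int (q * w)" by (metis add.commute mult_Suc of_nat_add of_nat_le_iff)
        moreover have "k $ u \<le> int (i * w) + int l" "int (q * w) < m $ u"
          using i \<open>m \<in> ?S\<close> by (auto simp: slab_def)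
        moreover have "int l + int g \<le> int w" using w by simp
        ultimately have "int g < m $ u - k $ u" by linarith
        then show "k $ u \<noteq> m $ u \<and> int g \<le> \<bar>k $ u - m $ u\<bar>" by linarith
      qed auto
      have sum: "(\<Sum>j<q. B j x) = psum \<phi> ?Q x" for x
        unfolding B_def by (rule psum_slabs[OF lw, symmetric])
      have "cmod ((\<integral>x. iexp (s * psum \<phi> ?Q x + s * psum \<phi> ?S x) \<partial>M)
          - (\<integral>x. iexp (s * psum \<phi> ?Q x) \<partial>M) * (\<integral>x. iexp (s * psum \<phi> ?S x) \<partial>M)) \<le> 4 * rho g"
        by (rule mixing_iexp[OF sep])
          (intro borel_measurable_times borel_measurable_const psum_measurable_sigma_gen_by order_refl \<phi>)+
      moreover have "(\<integral>x. iexp (s * psum \<phi> ?S x) \<partial>M) = a"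
        using Ba[of q] Suc.prems by (simp add: B_def)
      moreover have "E' = (\<integral>x. iexp (s * psum \<phi> ?Q x + s * psum \<phi> ?S x) \<partial>M)"
        unfolding E'_def sum[symmetric] by (simp add: B_def distrib_left)
      moreover have "E = (\<integral>x. iexp (s * psum \<phi> ?Q x) \<partial>M)"
        unfolding E_def sum ..
      ultimately show ?thesis by simp
    qed
    have "E' - a ^ Suc q = (E' - E * a) + (E - a ^ q) * a" by (simp add: algebra_simps)
    then have "cmod (E' - a ^ Suc q) \<le> cmod (E' - E * a) + cmod (E - a ^ q) * cmod a"
      by (metis norm_mult norm_triangle_ineq)
    also have "\<dots> \<le> 4 * rho g + (4 * real q * rho g) * 1"
      using Suc a1 rho_nonneg[of g] unfolding E_def[symmetric]
      by (intro add_mono step mult_mono) auto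
    finally show ?case unfolding E'_def by (simp add: algebra_simps)
  qed
  from this[of p] show ?thesis by (simp add: a_def B_def)
qed

text \<open>The parameters are chosen in the order \<open>\<delta>\<close> (quality of the expansion), \<open>p\<close> (number of slabs), \<open>g\<close> (gap), and
finally the size of the rectangle. One direction \<open>u\<close> is enough: the other sides stay as they are, and the
sum over a slab is again a sum over a rectangle, whose sides all tend to infinity.\<close>

theorem central_limit_real:
  assumes \<phi>: "centred \<phi>" and q: "((\<lambda>L. var_rect \<phi> L / vol L) \<longlongrightarrow> q) min_at_top"
  shows "((\<lambda>L. \<integral>w. iexp (t * (psum \<phi> (rect L) w / sqrt (vol L))) \<partial>M)
    \<longlongrightarrow> complex_of_real (exp (- (t\<^sup>2 * q) / 2))) min_at_top"
proof (rule tendstoI)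
  fix e0 :: real assume e0: "0 < e0"
  \<comment> \<open>six error terms of size \<open>e\<close> have to fit strictly below \<open>e0\<close>\<close>
  define e where "e = e0 / 7"
  have e: "0 < e" using e0 by (simp add: e_def)
  define C where "C = var_const * variance0 \<phi>"
  have C: "0 \<le> C" using var_const_pos by (simp add: C_def)
  have q0: "0 \<le> q"
    by (rule tendsto_lowerbound[OF q _ min_at_top_neq_bot]) simp
  have t1: "0 < t\<^sup>2 + 1" by (simp add: add_nonneg_pos)
  define \<delta> where "\<delta> = e / (t\<^sup>2 + 1)"
  have \<delta>: "0 < \<delta>" using e t1 by (simp add: \<delta>_def)
  have \<delta>t: "\<delta> * t\<^sup>2 \<le> e" using e t1 by (simp add: \<delta>_def field_simps)
  from char_expansion[OF \<phi> \<delta>] obtain K where K: "0 \<le> K"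
    "\<And>L s. cmod ((\<integral>w. iexp (s * psum \<phi> (rect L) w) \<partial>M) - (1 - s\<^sup>2 * var_rect \<phi> L / 2))
      \<le> \<delta> * (s\<^sup>2 * vol L) + K * (s\<^sup>2 * vol L)\<^sup>2" by blast
  \<comment> \<open>\<open>p\<close> is so large that the errors of the expansion, \<open>p\<close> times over, and of Euler's limit are small\<close>
  obtain p :: nat where p: "1 \<le> p" "K * (t\<^sup>2)\<^sup>2 / real p \<le> e" "t\<^sup>2 * q / 2 / real p \<le> 1"
    "dist ((1 + (- (t\<^sup>2 * q / 2)) / real p) ^ p) (exp (- (t\<^sup>2 * q / 2))) < e"
  proof -
    have "eventually (\<lambda>p. K * (t\<^sup>2)\<^sup>2 / real p < e) sequentially"
      using e by (intro order_tendstoD(2)[of _ 0]) (auto intro: lim_const_over_n)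
    moreover have "eventually (\<lambda>p. t\<^sup>2 * q / 2 / real p < 1) sequentially"
      by (intro order_tendstoD(2)[of _ 0]) (real_asymp, simp)
    moreover have "eventually (\<lambda>p. dist ((1 + (- (t\<^sup>2 * q / 2)) / real p) ^ p) (exp (- (t\<^sup>2 * q / 2))) < e) sequentially"
      using tendsto_exp_limit_sequentially[of "- (t\<^sup>2 * q / 2)"] e by (rule tendstoD)
    ultimately have "eventually (\<lambda>p. 1 \<le> p \<and> K * (t\<^sup>2)\<^sup>2 / real p < e \<and> t\<^sup>2 * q / 2 / real p < 1
        \<and> dist ((1 + (- (t\<^sup>2 * q / 2)) / real p) ^ p) (exp (- (t\<^sup>2 * q / 2))) < e) sequentially"
      using eventually_ge_at_top[of 1] by eventually_elim auto
    then show thesis using that by (auto simp: eventually_sequentially intro: less_imp_le)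
  qed
  \<comment> \<open>the gap may depend on \<open>p\<close>, because the rectangle is still free to grow\<close>
  have "0 < e / (4 * real p)" using e p by simp
  then obtain g where g: "1 \<le> g" "rho g < e / (4 * real p)" using rho_small by blast
  have pg: "4 * real p * rho g \<le> e" using g p by (simp add: field_simps)
  define b where "b = 1 - t\<^sup>2 * q / (2 * real p)"
  have b: "\<bar>b\<bar> \<le> 1" using p q0 by (auto simp: b_def abs_le_iff field_simps)
  have "0 < e / (t\<^sup>2 + 1)" using e t1 by simp
  with q have "eventually (\<lambda>L. dist (var_rect \<phi> L / vol L) q < e / (t\<^sup>2 + 1)) min_at_top"
    by (rule tendstoD)
  then obtain N1 where N1: "\<And>L. (\<forall>u. N1 \<le> L $ u) \<Longrightarrow> dist (var_rect \<phi> L / vol L) q < e / (t\<^sup>2 + 1)"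
    unfolding eventually_min_at_top by blast
  \<comment> \<open>the fraction of points that may be lost in the gaps; the two bounds serve the steps 1 and 4 below\<close>
  define f0 where "f0 = min (e\<^sup>2 / ((t\<^sup>2 + 1) * (C + 1))) (e / ((t\<^sup>2 + 1) * (C + 1)))"
  have pos: "0 < (t\<^sup>2 + 1) * (C + 1)" using t1 C by simp
  have f0_pos: "0 < f0" using e pos by (simp add: f0_def)
  have "f0 \<le> e\<^sup>2 / ((t\<^sup>2 + 1) * (C + 1))" "f0 \<le> e / ((t\<^sup>2 + 1) * (C + 1))"
    unfolding f0_def by simp_all
  with f0_pos have f0: "0 < f0" "(t\<^sup>2 + 1) * (C + 1) * f0 \<le> e\<^sup>2" "(t\<^sup>2 + 1) * (C + 1) * f0 \<le> e"
    unfolding pos_le_divide_eq[OF pos] by (simp_all only: mult.commute)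
  have tC: "t\<^sup>2 * C \<le> (t\<^sup>2 + 1) * (C + 1)" using C by (intro mult_mono) auto
  obtain N2 :: nat where N2: "(real p * real g + real p) / f0 \<le> real N2" using real_arch_simple by blast
  define N where "N = max (max 1 N2) (max N1 (p * (max 1 N1 + g)))"
  define u :: 'd where "u = undefined"
  have main: "dist (\<integral>w. iexp (t * (psum \<phi> (rect L) w / sqrt (vol L))) \<partial>M) (complex_of_real (exp (- (t\<^sup>2 * q) / 2))) < e0"
    if LN: "\<forall>v. N \<le> L $ v" for L
  proof -
    have L: "1 \<le> L $ v" "N1 \<le> L $ v" for v using LN by (auto simp: N_def)
    define w where "w = L $ u div p"
    define l where "l = w - g"
    define L' where "L' = upd L u l"
    have "p * (max 1 N1 + g) \<le> L $ u" using LN by (auto simp: N_def)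
    then have "(p * (max 1 N1 + g)) div p \<le> w" unfolding w_def by (rule div_le_mono)
    then have "max 1 N1 + g \<le> w" using p by simp
    then have l: "1 \<le> l" "N1 \<le> l" "l + g = w" by (auto simp: l_def)
    have lw: "l \<le> w" using l by simp
    have w_eq: "real w = real l + real g" using l(3) by linarith
    have pw: "p * w \<le> L $ u" unfolding w_def by simp
    have volL: "0 < vol L" using L(1) by (rule vol_pos)
    have volL': "0 < vol L'" unfolding L'_def using L l by (intro vol_pos) auto
    define f where "f = 1 - real p * real l / real (L $ u)"
    have Lu: "0 < real (L $ u)" using L(1)[of u] by simp
    have ratio: "real p * vol L' = (1 - f) * vol L"
      using Lu unfolding f_def L'_def vol_upd vol_eq_cross[of L u] by simp
    have "real p * real l \<le> real p * real w" using lw by (intro mult_left_mono) auto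
    also have "\<dots> \<le> real (L $ u)" using pw by (metis of_nat_le_iff of_nat_mult)
    finally have f: "0 \<le> f" "f \<le> 1" unfolding f_def using Lu by (auto simp: divide_simps)
    have ff0: "f \<le> f0"
    proof -
      have "L $ u < p * w + p"
        using dividend_less_times_div[of p "L $ u"] p(1) unfolding w_def by simp
      then have "real (L $ u) \<le> real (p * w + p)" by (intro of_nat_mono) simp
      also have "\<dots> = real p * real l + real p * real g + real p" by (simp add: algebra_simps w_eq)
      finally have "real (L $ u) \<le> real p * real l + real p * real g + real p" .
      have "f * real (L $ u) \<le> real p * real g + real p"
      proof -
        have "f * real (L $ u) = real (L $ u) - real p * real l"
          using Lu by (simp add: f_def left_diff_distrib)
        then show ?thesis using \<open>real (L $ u) \<le> real p * real l + real p * real g + real p\<close> by linarith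
      qed
      also have "\<dots> \<le> f0 * real N2" using N2 unfolding pos_divide_le_eq[OF f0(1)] by (simp only: mult.commute)
      also have "\<dots> \<le> f0 * real (L $ u)"
        using LN f0(1) by (intro mult_left_mono) (auto simp: N_def)
      finally show ?thesis using Lu by simp
    qed
    define s where "s = t / sqrt (vol L)"
    have s2: "s\<^sup>2 = t\<^sup>2 / vol L" using volL by (simp add: s_def power_divide)
    define S where "S = psum \<phi> (rect L)"
    define T where "T x = (\<Sum>j<p. psum \<phi> (slab L u w l j) x)" for x
    define a where "a = (\<integral>x. iexp (s * psum \<phi> (rect L') x) \<partial>M)"
    note [measurable] = psum_measurable[OF centredD(1)[OF \<phi>]]
    have [measurable]: "S \<in> borel_measurable M" "T \<in> borel_measurable M"
      unfolding S_def T_def by measurable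
    have L2: "(\<lambda>x. S x - T x) \<in> L2_real M M"
      unfolding S_def T_def by (intro L2_real_diff L2_real_sum psum_L2 \<phi>)
    have 1: "cmod ((\<integral>x. iexp (s * S x) \<partial>M) - (\<integral>x. iexp (s * T x) \<partial>M)) \<le> e"
    proof -
      have "cmod ((\<integral>x. iexp (s * S x) \<partial>M) - (\<integral>x. iexp (s * T x) \<partial>M)) = cmod (\<integral>x. iexp (s * S x) - iexp (s * T x) \<partial>M)"
        by (subst Bochner_Integration.integral_diff) (auto intro!: integrable_iexp)
      also have "\<dots> \<le> (\<integral>x. cmod (iexp (s * S x) - iexp (s * T x)) \<partial>M)"
        by (rule integral_norm_bound)
      also have "\<dots> \<le> (\<integral>x. \<bar>s\<bar> * \<bar>S x - T x\<bar> \<partial>M)"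
      proof (rule integral_mono)
        show "integrable M (\<lambda>x. cmod (iexp (s * S x) - iexp (s * T x)))"
          by (intro integrable_norm Bochner_Integration.integrable_diff integrable_iexp) measurable
        show "integrable M (\<lambda>x. \<bar>s\<bar> * \<bar>S x - T x\<bar>)"
          using L2_real_integrable[OF L2] by simp
        show "cmod (iexp (s * S x) - iexp (s * T x)) \<le> \<bar>s\<bar> * \<bar>S x - T x\<bar>" for x
          using cmod_iexp_diff_le[of "s * S x" "s * T x"] by (simp add: abs_mult flip: right_diff_distrib)
      qed
      also have "\<dots> \<le> \<bar>s\<bar> * l2norm M (\<lambda>x. S x - T x)"
        using abs_expectation_le_l2norm[OF L2] by (simp add: mult_left_mono)
      also have "\<dots> \<le> \<bar>s\<bar> * sqrt (C * (f * vol L))"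
      proof (rule mult_left_mono)
        have "vol L - real p * vol L' = f * vol L" using ratio by (simp add: algebra_simps)
        then show "l2norm M (\<lambda>x. S x - T x) \<le> sqrt (C * (f * vol L))"
          using psum_rect_minus_slabs[OF \<phi> lw pw] unfolding l2norm_def
          by (simp add: S_def T_def C_def L'_def mult_ac)
      qed simp
      also have "\<dots> = sqrt (s\<^sup>2 * (C * (f * vol L)))" by (simp add: real_sqrt_mult)
      also have "\<dots> = sqrt (t\<^sup>2 * C * f)" unfolding s2 using volL by simp
      also have "\<dots> \<le> sqrt (e\<^sup>2)"
      proof (rule real_sqrt_le_mono)
        have "t\<^sup>2 * C * f \<le> (t\<^sup>2 + 1) * (C + 1) * f0"
          using tC ff0 f C by (intro mult_mono) auto
        then show "t\<^sup>2 * C * f \<le> e\<^sup>2" using f0 by simp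
      qed
      finally show ?thesis using e by simp
    qed
    have 2: "cmod ((\<integral>x. iexp (s * T x) \<partial>M) - a ^ p) \<le> e"
    proof -
      have "cmod ((\<integral>x. iexp (s * T x) \<partial>M) - a ^ p) \<le> 4 * real p * rho g"
        unfolding T_def a_def L'_def using l pw L
        by (intro slabs_decouple centredD(1)[OF \<phi>]) auto
      with pg show ?thesis by simp
    qed
    have s2vol: "s\<^sup>2 * vol L' = (1 - f) * t\<^sup>2 / real p"
    proof -
      have "vol L' = (1 - f) * vol L / real p" using ratio p by (simp add: field_simps)
      then show ?thesis unfolding s2 using volL by simp
    qed
    have s2vol_le: "s\<^sup>2 * vol L' \<le> t\<^sup>2 / real p"
    proof -
      have "(1 - f) * t\<^sup>2 \<le> 1 * t\<^sup>2" using f by (intro mult_right_mono) auto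
      then show ?thesis unfolding s2vol by (simp add: divide_right_mono)
    qed
    have 3: "real p * cmod (a - complex_of_real (1 - s\<^sup>2 * var_rect \<phi> L' / 2)) \<le> 2 * e"
    proof -
      have "real p * cmod (a - complex_of_real (1 - s\<^sup>2 * var_rect \<phi> L' / 2))
          \<le> real p * (\<delta> * (s\<^sup>2 * vol L') + K * (s\<^sup>2 * vol L')\<^sup>2)"
        using K(2)[of s L'] unfolding a_def by (intro mult_left_mono) auto
      also have "\<dots> \<le> real p * (\<delta> * (t\<^sup>2 / real p) + K * (t\<^sup>2 / real p)\<^sup>2)"
        using s2vol_le volL' \<delta> K(1) by (intro mult_left_mono add_mono power_mono) auto
      also have "\<dots> = \<delta> * t\<^sup>2 + K * (t\<^sup>2)\<^sup>2 / real p"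
        using p(1) by (simp add: power2_eq_square field_simps)
      also have "\<dots> \<le> 2 * e" using \<delta>t p(2) by simp
      finally show ?thesis .
    qed
    have 4: "real p * \<bar>s\<^sup>2 * var_rect \<phi> L' / 2 - t\<^sup>2 * q / (2 * real p)\<bar> \<le> e"
    proof -
      define v where "v = var_rect \<phi> L' / vol L'"
      have v: "0 \<le> v" "v \<le> C" "\<bar>v - q\<bar> \<le> e / (t\<^sup>2 + 1)"
      proof -
        show "0 \<le> v" "v \<le> C"
          using var_rect_le[OF \<phi>, of L'] volL' by (auto simp: v_def C_def divide_simps mult_ac)
        have "\<forall>v. N1 \<le> L' $ v" using L(2) l(2) by (auto simp: L'_def)
        from N1[OF this] show "\<bar>v - q\<bar> \<le> e / (t\<^sup>2 + 1)" by (simp add: v_def dist_real_def)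
      qed
      have "s\<^sup>2 * var_rect \<phi> L' = s\<^sup>2 * vol L' * v" using volL' by (simp add: v_def)
      then have "s\<^sup>2 * var_rect \<phi> L' / 2 - t\<^sup>2 * q / (2 * real p) = (t\<^sup>2 / 2 * ((v - q) - f * v)) / real p"
        unfolding s2vol using p(1) by (simp add: field_simps)
      then have "real p * \<bar>s\<^sup>2 * var_rect \<phi> L' / 2 - t\<^sup>2 * q / (2 * real p)\<bar> = t\<^sup>2 / 2 * \<bar>(v - q) - f * v\<bar>"
        using p(1) by (simp add: abs_divide abs_mult)
      also have "\<dots> \<le> t\<^sup>2 / 2 * (e / (t\<^sup>2 + 1) + f0 * C)"
      proof (rule mult_left_mono)
        have "f * v \<le> f0 * C" using ff0 f v by (intro mult_mono) auto
        moreover have "0 \<le> f * v" using f v by simp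
        ultimately show "\<bar>(v - q) - f * v\<bar> \<le> e / (t\<^sup>2 + 1) + f0 * C" using v(3) by linarith
      qed simp
      also have "\<dots> = (t\<^sup>2 * (e / (t\<^sup>2 + 1)) + t\<^sup>2 * C * f0) / 2"
      proof -
        have "a / 2 * (x + f0 * C) = (a * x + a * C * f0) / 2" for a x :: real
          by (simp add: algebra_simps)
        then show ?thesis .
      qed
      also have "\<dots> \<le> (e + e) / 2"
      proof (intro divide_right_mono add_mono)
        show "t\<^sup>2 * (e / (t\<^sup>2 + 1)) \<le> e" using \<delta>t by (simp add: \<delta>_def mult.commute)
        have "t\<^sup>2 * C * f0 \<le> (t\<^sup>2 + 1) * (C + 1) * f0" using tC f0 by (intro mult_right_mono) auto
        then show "t\<^sup>2 * C * f0 \<le> e" using f0(3) by (rule order_trans)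
      qed simp
      finally show ?thesis by simp
    qed
    have a1: "cmod a \<le> 1" unfolding a_def by (rule norm_expectation_iexp_le_1) measurable
    have 5: "cmod (a ^ p - complex_of_real b ^ p) \<le> 3 * e"
    proof -
      have "cmod (a ^ p - complex_of_real b ^ p) \<le> real p * cmod (a - complex_of_real b)"
        using a1 b by (intro norm_power_diff) auto
      also have "\<dots> \<le> real p * (cmod (a - complex_of_real (1 - s\<^sup>2 * var_rect \<phi> L' / 2))
          + \<bar>s\<^sup>2 * var_rect \<phi> L' / 2 - t\<^sup>2 * q / (2 * real p)\<bar>)"
      proof (rule mult_left_mono)
        have "a - complex_of_real b = (a - complex_of_real (1 - s\<^sup>2 * var_rect \<phi> L' / 2))
            - complex_of_real (s\<^sup>2 * var_rect \<phi> L' / 2 - t\<^sup>2 * q / (2 * real p))"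
          by (simp add: b_def)
        then show "cmod (a - complex_of_real b) \<le> cmod (a - complex_of_real (1 - s\<^sup>2 * var_rect \<phi> L' / 2))
          + \<bar>s\<^sup>2 * var_rect \<phi> L' / 2 - t\<^sup>2 * q / (2 * real p)\<bar>"
          by (metis norm_of_real norm_triangle_ineq4)
      qed simp
      also have "\<dots> \<le> 3 * e" using 3 4 by (simp add: distrib_left)
      finally show ?thesis .
    qed
    have 6: "cmod (complex_of_real b ^ p - complex_of_real (exp (- (t\<^sup>2 * q) / 2))) \<le> e"
    proof -
      have "b = 1 + (- (t\<^sup>2 * q / 2)) / real p" by (simp add: b_def)
      then have "\<bar>b ^ p - exp (- (t\<^sup>2 * q) / 2)\<bar> < e" using p(4) by (simp add: dist_real_def)
      moreover have "complex_of_real b ^ p - complex_of_real (exp (- (t\<^sup>2 * q) / 2))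
          = complex_of_real (b ^ p - exp (- (t\<^sup>2 * q) / 2))" by simp
      ultimately show ?thesis by (metis norm_of_real less_imp_le)
    qed
    have "t * (psum \<phi> (rect L) x / sqrt (vol L)) = s * S x" for x
      by (simp add: s_def S_def)
    then have "dist (\<integral>w. iexp (t * (psum \<phi> (rect L) w / sqrt (vol L))) \<partial>M) (complex_of_real (exp (- (t\<^sup>2 * q) / 2)))
        = cmod ((\<integral>x. iexp (s * S x) \<partial>M) - complex_of_real (exp (- (t\<^sup>2 * q) / 2)))"
      by (simp add: dist_norm)
    also have "\<dots> \<le> e + e + 3 * e + e"
    proof -
      have tri: "cmod (x - y) \<le> A + B" if "cmod (x - z) \<le> A" "cmod (z - y) \<le> B" for x y z A B
        using norm_triangle_ineq[of "x - z" "z - y"] that by simp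
      show ?thesis by (rule tri[OF tri[OF tri[OF 1 2] 5] 6])
    qed
    also have "\<dots> < e0" using e0 by (simp add: e_def)
    finally show ?thesis .
  qed
  show "eventually (\<lambda>L. dist (\<integral>w. iexp (t * (psum \<phi> (rect L) w / sqrt (vol L))) \<partial>M)
      (complex_of_real (exp (- (t\<^sup>2 * q) / 2))) < e0) min_at_top"
    unfolding eventually_min_at_top using main by blast
qed

end

section \<open>Orthonormal bases\<close>

definition proj :: "(nat \<Rightarrow> 'h::real_inner) \<Rightarrow> nat \<Rightarrow> 'h \<Rightarrow> 'h" where
  "proj e m x = (\<Sum>i=1..m. (x \<bullet> e i) *\<^sub>R e i)"

locale onb =
  fixes e :: "nat \<Rightarrow> 'h::{real_inner, banach, second_countable_topology}"
  assumes onb: "orthonormal_basis e"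
begin

lemma inner_basis: "1 \<le> i \<Longrightarrow> 1 \<le> j \<Longrightarrow> e i \<bullet> e j = (if i = j then 1 else 0)"
  using onb by (auto simp: orthonormal_basis_def)

lemma proj_inner: "1 \<le> j \<Longrightarrow> proj e m x \<bullet> e j = (if j \<le> m then x \<bullet> e j else 0)"
proof -
  assume j: "1 \<le> j"
  have "proj e m x \<bullet> e j = (\<Sum>i=1..m. if i = j then x \<bullet> e i else 0)"
    unfolding proj_def inner_sum_left using j by (intro sum.cong) (auto simp: inner_basis)
  also have "\<dots> = (if j \<le> m then x \<bullet> e j else 0)" using j by (subst sum.delta) auto
  finally show ?thesis .
qed

lemma inner_proj: "x \<bullet> proj e m x = (\<Sum>i=1..m. (x \<bullet> e i)\<^sup>2)"
  unfolding proj_def inner_sum_right by (simp add: power2_eq_square)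

lemma norm_proj: "(norm (proj e m x))\<^sup>2 = (\<Sum>i=1..m. (x \<bullet> e i)\<^sup>2)"
proof -
  have "(norm (proj e m x))\<^sup>2 = proj e m x \<bullet> (\<Sum>i=1..m. (x \<bullet> e i) *\<^sub>R e i)"
    by (simp add: power2_norm_eq_inner proj_def)
  also have "\<dots> = (\<Sum>i=1..m. (x \<bullet> e i)\<^sup>2)"
    unfolding inner_sum_right by (intro sum.cong) (auto simp: proj_inner power2_eq_square)
  finally show ?thesis .
qed

lemma norm_minus_proj: "(norm (x - proj e m x))\<^sup>2 = (norm x)\<^sup>2 - (\<Sum>i=1..m. (x \<bullet> e i)\<^sup>2)"
  using norm_proj[of m x] inner_proj[of x m]
  by (simp add: power2_norm_eq_inner inner_diff inner_commute)

lemma norm_minus_proj_le: "norm (x - proj e m x) \<le> norm x"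
proof -
  have "(norm (x - proj e m x))\<^sup>2 \<le> (norm x)\<^sup>2"
    unfolding norm_minus_proj by (simp add: sum_nonneg)
  then show ?thesis by (rule power2_le_imp_le) simp
qed

lemma proj_diff: "proj e m (x - y) = proj e m x - proj e m y"
  by (simp add: proj_def inner_diff_left scaleR_diff_left sum_subtractf)

lemma norm_proj_le: "norm (proj e m x) \<le> norm x"
proof -
  have "(norm (proj e m x))\<^sup>2 \<le> (norm x)\<^sup>2"
    using norm_minus_proj[of x m] zero_le_power2[of "norm (x - proj e m x)"] unfolding norm_proj by linarith
  then show ?thesis by (rule power2_le_imp_le) simp
qed

lemma proj_0 [simp]: "proj e 0 x = 0"
  by (simp add: proj_def)

lemma proj_Suc: "proj e (Suc m) x = proj e m x + (x \<bullet> e (Suc m)) *\<^sub>R e (Suc m)"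
  by (simp add: proj_def)

lemma proj_measurable [measurable]: "proj e m \<in> borel_measurable borel"
  unfolding proj_def by measurable

lemma proj_eventually_id:
  assumes "y \<in> span (e ` {1..})"
  shows "\<exists>m0. \<forall>m\<ge>m0. proj e m y = y"
  using assms
proof (induction rule: span_induct_alt)
  case base
  show ?case by (simp add: proj_def)
next
  case (step c x y)
  then obtain j where j: "1 \<le> j" "x = e j" by auto
  from step obtain m0 where m0: "\<And>m. m0 \<le> m \<Longrightarrow> proj e m y = y" by auto
  have "proj e m (c *\<^sub>R x + y) = c *\<^sub>R x + y" if m: "max m0 j \<le> m" for m
  proof -
    have "proj e m x = (\<Sum>i=1..m. if i = j then e j else 0)"
      unfolding proj_def j using j(1) by (intro sum.cong) (auto simp: inner_basis)
    also have "\<dots> = x" using m j by (subst sum.delta) auto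
    finally have "proj e m x = x" .
    moreover have "proj e m (c *\<^sub>R x + y) = c *\<^sub>R proj e m x + proj e m y"
      by (simp add: proj_def inner_add_left scaleR_add_left sum.distrib scaleR_sum_right)
    ultimately show ?thesis using m0 m by simp
  qed
  then show ?case by blast
qed

text \<open>Approximate \<open>x\<close> by some \<open>y\<close> in the span. Large projections fix \<open>y\<close>, and \<open>z - proj e m z\<close> is never longer than
\<open>z\<close>.\<close>

lemma proj_tendsto: "(\<lambda>m. proj e m x) \<longlonglongrightarrow> x"
proof (rule LIMSEQ_I)
  fix r :: real assume "0 < r"
  have "x \<in> closure (span (e ` {1..}))" using onb by (simp add: orthonormal_basis_def)
  then obtain y where y: "y \<in> span (e ` {1..})" "dist y x < r"
    using \<open>0 < r\<close> unfolding closure_approachable by blast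
  from proj_eventually_id[OF y(1)] obtain m0 where m0: "\<And>m. m0 \<le> m \<Longrightarrow> proj e m y = y" by auto
  have "norm (proj e m x - x) < r" if "m0 \<le> m" for m
  proof -
    have "x - proj e m x = (x - y) - proj e m (x - y)"
      using m0[OF that] by (simp add: proj_diff)
    then have "norm (x - proj e m x) \<le> norm (x - y)"
      using norm_minus_proj_le[of "x - y" m] by (simp only:)
    then show ?thesis using y(2) by (simp add: dist_norm norm_minus_commute)
  qed
  then show "\<exists>no. \<forall>m\<ge>no. norm (proj e m x - x) < r" by blast
qed

lemma parseval: "(\<lambda>i. (x \<bullet> e (Suc i))\<^sup>2) sums (norm x)\<^sup>2"
proof -
  have "(\<lambda>m. (norm (proj e m x))\<^sup>2) \<longlonglongrightarrow> (norm x)\<^sup>2"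
    by (intro tendsto_intros proj_tendsto)
  moreover have "(norm (proj e m x))\<^sup>2 = (\<Sum>i<m. (x \<bullet> e (Suc i))\<^sup>2)" for m
    unfolding norm_proj using sum.atLeast_Suc_atMost_Suc_shift[of "\<lambda>i. (x \<bullet> e i)\<^sup>2" 0 m]
    by (simp add: sum.atLeast1_atMost_eq)
  ultimately show ?thesis unfolding sums_def by simp
qed

lemma tail_sums: "(\<lambda>i. (x \<bullet> e (Suc (i + m)))\<^sup>2) sums (norm (x - proj e m x))\<^sup>2"
proof -
  have "(\<lambda>i. (x \<bullet> e (Suc (i + m)))\<^sup>2) sums ((norm x)\<^sup>2 - (\<Sum>i<m. (x \<bullet> e (Suc i))\<^sup>2))"
    by (rule sums_split_initial_segment[OF parseval])
  then show ?thesis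
    unfolding norm_minus_proj by (simp add: sum.atLeast1_atMost_eq)
qed

end

section \<open>Tents and Lipschitz approximation\<close>

definition tent :: "real \<Rightarrow> real" where
  "tent y = max 0 (1 - \<bar>y\<bar>)"

lemma tent_props: "0 \<le> tent y" "tent y \<le> 1" "tent y \<noteq> 0 \<Longrightarrow> \<bar>y\<bar> \<le> 1"
  by (auto simp: tent_def max_def split: if_splits)

lemma continuous_tent: "isCont tent y"
  unfolding tent_def[abs_def] by (intro continuous_intros)

text \<open>The tents at the integers form a partition of unity: at \<open>y\<close> only those at the two integers next to \<open>y\<close> are nonzero.\<close>

lemma sum_tents:
  fixes K :: nat and y :: real
  shows "(\<Sum>k\<in>{- int K..int K}. tent (y - real_of_int k)) \<le> 1"
    and "\<bar>y\<bar> \<le> real K \<Longrightarrow> (\<Sum>k\<in>{- int K..int K}. tent (y - real_of_int k)) = 1"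
proof -
  define f where "f = \<lfloor>y\<rfloor>"
  have f: "real_of_int f \<le> y" "y < real_of_int f + 1" by (auto simp: f_def)
  have zero: "tent (y - real_of_int k) = 0" if "k \<noteq> f" "k \<noteq> f + 1" for k
  proof -
    from that have "k \<le> f - 1 \<or> f + 2 \<le> k" by linarith
    then have "real_of_int k \<le> real_of_int f - 1 \<or> real_of_int f + 2 \<le> real_of_int k" by linarith
    then show ?thesis using f by (auto simp: tent_def)
  qed
  have two: "tent (y - real_of_int f) + tent (y - real_of_int (f + 1)) = 1"
    using f by (auto simp: tent_def)
  have "(\<Sum>k\<in>{- int K..int K}. tent (y - real_of_int k)) \<le> (\<Sum>k\<in>{- int K..int K} \<union> {f, f + 1}. tent (y - real_of_int k))"
    by (intro sum_mono2) (auto simp: tent_props)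
  also have "\<dots> = (\<Sum>k\<in>{f, f + 1}. tent (y - real_of_int k))"
    by (rule sum.mono_neutral_right) (auto simp: zero)
  finally show "(\<Sum>k\<in>{- int K..int K}. tent (y - real_of_int k)) \<le> 1" using two by simp
  assume y: "\<bar>y\<bar> \<le> real K"
  have "(\<Sum>k\<in>{- int K..int K}. tent (y - real_of_int k)) = (\<Sum>k\<in>{- int K..int K} \<union> {f, f + 1}. tent (y - real_of_int k))"
  proof (rule sum.mono_neutral_left)
    show "\<forall>i\<in>{- int K..int K} \<union> {f, f + 1} - {- int K..int K}. tent (y - real_of_int i) = 0"
    proof
      fix i assume i: "i \<in> {- int K..int K} \<union> {f, f + 1} - {- int K..int K}"
      have "f \<in> {- int K..int K}" using y f by (auto simp: abs_le_iff)
      with i have "i = f + 1" "i \<notin> {- int K..int K}" by auto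
      with \<open>f \<in> {- int K..int K}\<close> have "i = int K + 1" "f = int K" by auto
      then have "real_of_int f = real K" "real_of_int i = real K + 1" by simp_all
      then show "tent (y - real_of_int i) = 0" using y f by (auto simp: tent_def)
    qed
  qed auto
  also have "\<dots> = (\<Sum>k\<in>{f, f + 1}. tent (y - real_of_int k))"
    by (rule sum.mono_neutral_right) (auto simp: zero)
  finally show "(\<Sum>k\<in>{- int K..int K}. tent (y - real_of_int k)) = 1" using two by simp
qed

text \<open>For \<open>f\<close> bounded below, the largest \<open>k\<close>-Lipschitz function below \<open>f\<close>. These functions reduce weak convergence from continuous to Lipschitz
test functions.\<close>

definition inf_conv :: "('h::real_normed_vector \<Rightarrow> real) \<Rightarrow> nat \<Rightarrow> 'h \<Rightarrow> real" where
  "inf_conv f k x = (INF y. f y + real k * norm (x - y))"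

lemma inf_conv_props:
  fixes f :: "'h::real_normed_vector \<Rightarrow> real"
  assumes B: "\<And>x. \<bar>f x\<bar> \<le> B"
  shows "inf_conv f k x \<le> f x" "\<bar>inf_conv f k x\<bar> \<le> B"
    "\<bar>inf_conv f k x - inf_conv f k y\<bar> \<le> real k * norm (x - y)"
    "isCont f x \<Longrightarrow> (\<lambda>k. inf_conv f k x) \<longlonglongrightarrow> f x"
proof -
  have low: "- B \<le> f y + real k * norm (x - y)" for x y k
  proof -
    have "0 \<le> real k * norm (x - y)" by simp
    then show ?thesis using B[of y] by linarith
  qed
  have bdd: "bdd_below (range (\<lambda>y. f y + real k * norm (x - y)))" for x k
    using low by (intro bdd_belowI[of _ "- B"]) auto
  have le: "inf_conv f k x \<le> f y + real k * norm (x - y)" for x y k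
    unfolding inf_conv_def using bdd by (rule cINF_lower) simp
  show le_f: "inf_conv f k x \<le> f x" for x k using le[of k x x] by simp
  have "- B \<le> inf_conv f k x"
    unfolding inf_conv_def using low by (intro cINF_greatest) auto
  then show "\<bar>inf_conv f k x\<bar> \<le> B" using le_f[of k x] B[of x] by linarith
  have lip: "inf_conv f k x - real k * norm (x - y) \<le> inf_conv f k y" for x y
    unfolding inf_conv_def[of f k y]
  proof (rule cINF_greatest)
    fix z
    have "inf_conv f k x \<le> f z + real k * norm (x - z)" by (rule le)
    also have "real k * norm (x - z) \<le> real k * (norm (x - y) + norm (y - z))"
      using norm_triangle_ineq[of "x - y" "y - z"] by (intro mult_left_mono) auto
    finally show "inf_conv f k x - real k * norm (x - y) \<le> f z + real k * norm (y - z)"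
      by (simp add: distrib_left)
  qed simp
  show "\<bar>inf_conv f k x - inf_conv f k y\<bar> \<le> real k * norm (x - y)"
    using lip[of x y] lip[of y x] by (simp add: norm_minus_commute abs_le_iff)
  assume cont: "isCont f x"
  show "(\<lambda>k. inf_conv f k x) \<longlonglongrightarrow> f x"
  proof (rule LIMSEQ_I)
    fix r :: real assume r: "0 < r"
    then obtain d where d: "0 < d" "\<And>y. norm (y - x) < d \<Longrightarrow> \<bar>f y - f x\<bar> < r / 2"
      using cont unfolding continuous_at_eps_delta by (auto simp: dist_norm dest: spec[of _ "r / 2"])
    obtain k0 :: nat where k0: "2 * B / d \<le> real k0" using real_arch_simple by blast
    have "norm (inf_conv f k x - f x) < r" if k: "k0 \<le> k" for k
    proof -
      have "f x - r / 2 \<le> inf_conv f k x"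
        unfolding inf_conv_def
      proof (rule cINF_greatest)
        fix y
        show "f x - r / 2 \<le> f y + real k * norm (x - y)"
        proof (cases "norm (y - x) < d")
          case True
          have "0 \<le> real k * norm (x - y)" by simp
          with d(2)[OF True] show ?thesis by linarith
        next
          case False
          have "2 * B \<le> real k0 * d" using k0 d(1) by (simp add: field_simps)
          also have "\<dots> \<le> real k * norm (x - y)"
            using False k d(1) by (intro mult_mono) (auto simp: norm_minus_commute)
          finally have "2 * B \<le> real k * norm (x - y)" .
          with B[of x] B[of y] r show ?thesis by (simp add: abs_le_iff)
        qed
      qed simp
      with le_f[of k x] r show ?thesis by auto
    qed
    then show "\<exists>no. \<forall>n\<ge>no. norm (inf_conv f n x - f x) < r" by blast
  qed
qed

section \<open>Weak convergence from characteristic functionals\<close>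

text \<open>The data of a continuity theorem in Hilbert space: laws with uniformly bounded second moments and uniformly small
tails, whose characteristic functionals converge on the span of the basis.\<close>

locale char_convergence = onb e
  for e :: "nat \<Rightarrow> 'h::{real_inner, banach, second_countable_topology}" +
  fixes \<mu> :: "nat \<Rightarrow> 'h measure" and \<nu> :: "'h measure" and C :: real and t :: "nat \<Rightarrow> real"
  assumes prob_\<mu>: "\<And>n. prob_space (\<mu> n)" and sets_\<mu> [measurable_cong, simp]: "\<And>n. sets (\<mu> n) = sets borel"
    and prob_\<nu>: "prob_space \<nu>" and sets_\<nu> [measurable_cong, simp]: "sets \<nu> = sets borel"
    and char_conv: "\<And>u. u \<in> span (e ` {1..}) \<Longrightarrow>
      (\<lambda>n. \<integral>x. iexp (u \<bullet> x) \<partial>\<mu> n) \<longlonglongrightarrow> (\<integral>x. iexp (u \<bullet> x) \<partial>\<nu>)"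
    and moment_\<mu>: "\<And>n. integrable (\<mu> n) (\<lambda>x. (norm x)\<^sup>2)" "\<And>n. (\<integral>x. (norm x)\<^sup>2 \<partial>\<mu> n) \<le> C"
    and moment_\<nu>: "integrable \<nu> (\<lambda>x. (norm x)\<^sup>2)" "(\<integral>x. (norm x)\<^sup>2 \<partial>\<nu>) \<le> C"
    and tail_\<mu>: "\<And>n m. (\<integral>x. (norm (x - proj e m x))\<^sup>2 \<partial>\<mu> n) \<le> t m"
    and tail_\<nu>: "\<And>m. (\<integral>x. (norm (x - proj e m x))\<^sup>2 \<partial>\<nu>) \<le> t m"
    and t_tendsto: "t \<longlonglongrightarrow> 0"
begin

abbreviation U :: "'h set" where "U \<equiv> span (e ` {1..})"

lemma space_eq [simp]: "space (\<mu> n) = UNIV" "space \<nu> = UNIV"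
  using sets_eq_imp_space_eq[OF sets_\<mu>[of n]] sets_eq_imp_space_eq[OF sets_\<nu>] by simp_all

lemma measurable_eq [simp]: "measurable (\<mu> n) N = measurable borel N" "measurable \<nu> N = measurable borel N"
  by (auto intro!: measurable_cong_sets)

text \<open>Weights under which the characteristic functionals still converge. The class is closed under enough operations to
contain all Lipschitz functions of finitely many coordinates, which replaces a continuity theorem in several
dimensions.\<close>

definition testable :: "('h \<Rightarrow> real) \<Rightarrow> bool" where
  "testable f \<longleftrightarrow> f \<in> borel_measurable borel \<and> (\<exists>B. \<forall>x. \<bar>f x\<bar> \<le> B) \<and>
    (\<forall>u\<in>U. (\<lambda>n. \<integral>x. f x *\<^sub>R iexp (u \<bullet> x) \<partial>\<mu> n) \<longlonglongrightarrow> (\<integral>x. f x *\<^sub>R iexp (u \<bullet> x) \<partial>\<nu>))"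

lemma integrable_bounded:
  fixes F :: "'h \<Rightarrow> 'b::{banach, second_countable_topology}"
  assumes "F \<in> borel_measurable borel" "\<And>x. norm (F x) \<le> B"
  shows "integrable (\<mu> n) F" "integrable \<nu> F"
proof -
  interpret prob_space "\<mu> n" by (rule prob_\<mu>)
  show "integrable (\<mu> n) F" using assms by (intro integrable_const_bound[of _ B]) auto
next
  interpret prob_space \<nu> by (rule prob_\<nu>)
  show "integrable \<nu> F" using assms by (intro integrable_const_bound[of _ B]) auto
qed

lemma integrable_testable:
  assumes "testable f"
  shows "integrable (\<mu> n) (\<lambda>x. f x *\<^sub>R iexp (u \<bullet> x))" "integrable \<nu> (\<lambda>x. f x *\<^sub>R iexp (u \<bullet> x))"
proof -
  from assms obtain B where B: "\<And>x. \<bar>f x\<bar> \<le> B" and [measurable]: "f \<in> borel_measurable borel"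
    by (auto simp: testable_def)
  have m: "(\<lambda>x. f x *\<^sub>R iexp (u \<bullet> x)) \<in> borel_measurable borel" by measurable
  have b: "norm (f x *\<^sub>R iexp (u \<bullet> x)) \<le> B" for x using B[of x] by simp
  show "integrable (\<mu> n) (\<lambda>x. f x *\<^sub>R iexp (u \<bullet> x))" "integrable \<nu> (\<lambda>x. f x *\<^sub>R iexp (u \<bullet> x))"
    using integrable_bounded[OF m b] by auto
qed

lemma testable_const: "testable (\<lambda>_. c)"
  unfolding testable_def using char_conv by (auto intro!: tendsto_scaleR)

lemma testable_add: "testable f \<Longrightarrow> testable g \<Longrightarrow> testable (\<lambda>x. f x + g x)"
  unfolding testable_def[of "\<lambda>x. f x + g x"]
proof (intro conjI ballI)
  assume f: "testable f" and g: "testable g"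
  show "(\<lambda>x. f x + g x) \<in> borel_measurable borel" using f g by (auto simp: testable_def)
  from f g obtain B B' where "\<And>x. \<bar>f x\<bar> \<le> B" "\<And>x. \<bar>g x\<bar> \<le> B'" by (auto simp: testable_def)
  then show "\<exists>B. \<forall>x. \<bar>f x + g x\<bar> \<le> B"
    by (intro exI[of _ "B + B'"] allI order_trans[OF abs_triangle_ineq]) (auto intro: add_mono)
  fix u assume "u \<in> U"
  with f g show "(\<lambda>n. \<integral>x. (f x + g x) *\<^sub>R iexp (u \<bullet> x) \<partial>\<mu> n) \<longlonglongrightarrow> (\<integral>x. (f x + g x) *\<^sub>R iexp (u \<bullet> x) \<partial>\<nu>)"
    unfolding scaleR_add_left
    by (simp add: integrable_testable) (intro tendsto_add, auto simp: testable_def)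
qed


lemma testable_sum: "(\<And>i. i \<in> I \<Longrightarrow> testable (f i)) \<Longrightarrow> testable (\<lambda>x. \<Sum>i\<in>I. f i x)"
  by (induction I rule: infinite_finite_induct) (auto intro: testable_const[of 0] testable_add)

text \<open>Multiplication by \<open>cos (v \<bullet> x)\<close> or \<open>sin (v \<bullet> x)\<close> only shifts the argument of the characteristic functional by \<open>v\<close> and
\<open>- v\<close>.\<close>

lemma testable_mult_cos_sin:
  assumes f: "testable f" and v: "v \<in> U"
  shows "testable (\<lambda>x. f x * cos (v \<bullet> x))" "testable (\<lambda>x. f x * sin (v \<bullet> x))"
proof -
  from f obtain B where B: "\<And>x. \<bar>f x\<bar> \<le> B" and [measurable]: "f \<in> borel_measurable borel"
    by (auto simp: testable_def)
  have bd: "\<bar>f x * a\<bar> \<le> B" if "\<bar>a\<bar> \<le> 1" for a x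
    using mult_mono[OF B[of x] that] B[of x] by (simp add: abs_mult)
  have exps: "complex_of_real (cos y) = (iexp y + iexp (- y)) / 2" "complex_of_real (sin y) = (iexp y - iexp (- y)) / (2 * \<i>)" for y
    by (simp_all add: cos_of_real[symmetric] sin_of_real[symmetric] cos_exp_eq sin_exp_eq)
  have uv: "u + v \<in> U" "u - v \<in> U" if "u \<in> U" for u
    using that v by (auto intro: span_add span_diff)
  have cs: "(f x * cos (v \<bullet> x)) *\<^sub>R iexp (u \<bullet> x) = (f x *\<^sub>R iexp ((u + v) \<bullet> x) + f x *\<^sub>R iexp ((u - v) \<bullet> x)) / 2"
    "(f x * sin (v \<bullet> x)) *\<^sub>R iexp (u \<bullet> x) = (f x *\<^sub>R iexp ((u + v) \<bullet> x) - f x *\<^sub>R iexp ((u - v) \<bullet> x)) / (2 * \<i>)" for x u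
  proof -
    have e: "iexp ((u + v) \<bullet> x) = iexp (v \<bullet> x) * iexp (u \<bullet> x)" "iexp ((u - v) \<bullet> x) = iexp (- (v \<bullet> x)) * iexp (u \<bullet> x)"
      by (simp_all add: inner_add_left inner_diff_left exp_add[symmetric] algebra_simps)
    show "(f x * cos (v \<bullet> x)) *\<^sub>R iexp (u \<bullet> x) = (f x *\<^sub>R iexp ((u + v) \<bullet> x) + f x *\<^sub>R iexp ((u - v) \<bullet> x)) / 2"
      unfolding e scaleR_conv_of_real of_real_mult exps by (simp only: algebra_simps add_divide_distrib times_divide_eq_right times_divide_eq_left)
    show "(f x * sin (v \<bullet> x)) *\<^sub>R iexp (u \<bullet> x) = (f x *\<^sub>R iexp ((u + v) \<bullet> x) - f x *\<^sub>R iexp ((u - v) \<bullet> x)) / (2 * \<i>)"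
      unfolding e scaleR_conv_of_real of_real_mult exps by (simp only: algebra_simps diff_divide_distrib times_divide_eq_right times_divide_eq_left)
  qed
  have lim: "(\<lambda>n. \<integral>x. f x *\<^sub>R iexp (u \<bullet> x) \<partial>\<mu> n) \<longlonglongrightarrow> (\<integral>x. f x *\<^sub>R iexp (u \<bullet> x) \<partial>\<nu>)" if "u \<in> U" for u
    using f that by (auto simp: testable_def)
  note int = integrable_testable[OF f]
  show "testable (\<lambda>x. f x * cos (v \<bullet> x))"
    unfolding testable_def
  proof (intro conjI ballI)
    show "\<exists>B. \<forall>x. \<bar>f x * cos (v \<bullet> x)\<bar> \<le> B" using bd[OF abs_cos_le_one] by blast
    fix u assume u: "u \<in> U"
    show "(\<lambda>n. \<integral>x. (f x * cos (v \<bullet> x)) *\<^sub>R iexp (u \<bullet> x) \<partial>\<mu> n) \<longlonglongrightarrow> (\<integral>x. (f x * cos (v \<bullet> x)) *\<^sub>R iexp (u \<bullet> x) \<partial>\<nu>)"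
      unfolding cs integral_divide_zero Bochner_Integration.integral_add[OF int(1) int(1)] Bochner_Integration.integral_add[OF int(2) int(2)]
      by (intro tendsto_divide tendsto_add tendsto_const lim uv u) simp
  qed measurable
  show "testable (\<lambda>x. f x * sin (v \<bullet> x))"
    unfolding testable_def
  proof (intro conjI ballI)
    show "\<exists>B. \<forall>x. \<bar>f x * sin (v \<bullet> x)\<bar> \<le> B" using bd[OF abs_sin_le_one] by blast
    fix u assume u: "u \<in> U"
    show "(\<lambda>n. \<integral>x. (f x * sin (v \<bullet> x)) *\<^sub>R iexp (u \<bullet> x) \<partial>\<mu> n) \<longlonglongrightarrow> (\<integral>x. (f x * sin (v \<bullet> x)) *\<^sub>R iexp (u \<bullet> x) \<partial>\<nu>)"
      unfolding cs integral_divide_zero Bochner_Integration.integral_diff[OF int(1) int(1)] Bochner_Integration.integral_diff[OF int(2) int(2)]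
      by (intro tendsto_divide tendsto_diff tendsto_const lim uv u) simp
  qed measurable
qed

end

text \<open>A weight that is at least one turns a probability measure into another one; \<open>N\<close> is the law of the coordinate
\<open>x \<bullet> a\<close> under it.\<close>

lemma weighted_image:
  fixes V :: "'h::{real_inner, second_countable_topology} \<Rightarrow> real" and a :: 'h
  assumes "prob_space M" and sets: "sets M = sets borel" and V: "V \<in> borel_measurable borel"
    "\<And>x. 1 \<le> V x" "\<And>x. \<bar>V x\<bar> \<le> B"
  defines "Z \<equiv> \<integral>x. V x \<partial>M"
  defines "N \<equiv> distr (density M (\<lambda>x. ennreal (V x / Z))) borel (\<lambda>x. x \<bullet> a)"
  shows "real_distribution N" "1 \<le> Z"
    "\<And>h :: real \<Rightarrow> 'b::{banach, second_countable_topology}. h \<in> borel_measurable borel \<Longrightarrow>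
      integral\<^sup>L N h = (1 / Z) *\<^sub>R (\<integral>x. V x *\<^sub>R h (x \<bullet> a) \<partial>M)"
proof -
  interpret prob_space M by fact
  have [measurable_cong]: "sets M = sets borel" by fact
  note [measurable] = V(1)
  have sp: "space M = UNIV" using sets_eq_imp_space_eq[OF sets] by simp
  have int: "integrable M V" using V by (intro integrable_const_bound[of _ B]) auto
  have "(\<integral>x. 1 \<partial>M) \<le> Z" unfolding Z_def using V int by (intro integral_mono) auto
  then show Z: "1 \<le> Z" by (simp add: prob_space)
  have nn: "0 \<le> V x / Z" for x using V(2)[of x] Z by simp
  have "emeasure (density M (\<lambda>x. ennreal (V x / Z))) (space (density M (\<lambda>x. ennreal (V x / Z)))) = (\<integral>\<^sup>+x. ennreal (V x / Z) \<partial>M)"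
    by (subst emeasure_density) (auto simp: sp)
  also have "\<dots> = ennreal (\<integral>x. V x / Z \<partial>M)"
    using int nn by (intro nn_integral_eq_integral) auto
  also have "\<dots> = 1" using Z by (simp add: Z_def[symmetric])
  finally have D: "prob_space (density M (\<lambda>x. ennreal (V x / Z)))" by (rule prob_spaceI)
  have ma: "(\<lambda>x. x \<bullet> a) \<in> borel_measurable (density M (\<lambda>x. ennreal (V x / Z)))" by measurable
  show "real_distribution N"
    unfolding N_def by (rule prob_space.real_distribution_distr[OF D]) (use ma in simp)
  fix h :: "real \<Rightarrow> 'b" assume [measurable]: "h \<in> borel_measurable borel"
  have "integral\<^sup>L N h = (\<integral>x. h (x \<bullet> a) \<partial>density M (\<lambda>x. ennreal (V x / Z)))"
    unfolding N_def by (rule integral_distr[OF ma]) simp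
  also have "\<dots> = (\<integral>x. (V x / Z) *\<^sub>R h (x \<bullet> a) \<partial>M)"
    using nn by (intro integral_density) auto
  also have "\<dots> = (\<integral>x. (1 / Z) *\<^sub>R (V x *\<^sub>R h (x \<bullet> a)) \<partial>M)" by simp
  also have "\<dots> = (1 / Z) *\<^sub>R (\<integral>x. V x *\<^sub>R h (x \<bullet> a) \<partial>M)" by (rule integral_scaleR_right)
  finally show "integral\<^sup>L N h = (1 / Z) *\<^sub>R (\<integral>x. V x *\<^sub>R h (x \<bullet> a) \<partial>M)" .
qed

context char_convergence
begin

text \<open>The laws of \<open>x \<bullet> a\<close> under the measures with weight \<open>V\<close> have convergent characteristic functions, because \<open>V\<close> is
testable; so Levy's theorem on the real line applies to them.\<close>

lemma testable_integral_mult: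
  assumes V: "testable V" "\<And>x. 1 \<le> V x" and a: "a \<in> U"
    and h: "\<And>y. isCont h y" "\<And>y. \<bar>h y\<bar> \<le> (B' :: real)"
  shows "(\<lambda>n. \<integral>x. V x * h (x \<bullet> a) \<partial>\<mu> n) \<longlonglongrightarrow> (\<integral>x. V x * h (x \<bullet> a) \<partial>\<nu>)"
proof -
  from V obtain B where B: "\<And>x. \<bar>V x\<bar> \<le> B" and Vm: "V \<in> borel_measurable borel"
    by (auto simp: testable_def)
  have hm: "h \<in> borel_measurable borel"
    using h(1) by (intro borel_measurable_continuous_onI continuous_at_imp_continuous_on) auto
  have em: "(\<lambda>y. iexp (s * y)) \<in> borel_measurable borel" for s :: real by measurable
  define Z where "Z n = (\<integral>x. V x \<partial>\<mu> n)" for n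
  define Z' where "Z' = (\<integral>x. V x \<partial>\<nu>)"
  define N where "N n = distr (density (\<mu> n) (\<lambda>x. ennreal (V x / Z n))) borel (\<lambda>x. x \<bullet> a)" for n
  define N' where "N' = distr (density \<nu> (\<lambda>x. ennreal (V x / Z'))) borel (\<lambda>x. x \<bullet> a)"
  have rd: "real_distribution (N n)" "real_distribution N'" for n
    unfolding N_def N'_def Z_def Z'_def
    by (rule weighted_image(1)[OF _ _ Vm V(2) B]; simp add: prob_\<mu> prob_\<nu>)+
  have Z1: "1 \<le> Z n" "1 \<le> Z'" for n
    unfolding Z_def Z'_def
    by (rule weighted_image(2)[OF _ _ Vm V(2) B]; simp add: prob_\<mu> prob_\<nu>)+
  have int_c: "integral\<^sup>L (N n) k = (1 / Z n) *\<^sub>R (\<integral>x. V x *\<^sub>R k (x \<bullet> a) \<partial>\<mu> n)"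
      "integral\<^sup>L N' k = (1 / Z') *\<^sub>R (\<integral>x. V x *\<^sub>R k (x \<bullet> a) \<partial>\<nu>)"
    if "k \<in> borel_measurable borel" for n and k :: "real \<Rightarrow> complex"
    unfolding N_def N'_def Z_def Z'_def
    by (rule weighted_image(3)[OF _ _ Vm V(2) B that]; simp add: prob_\<mu> prob_\<nu>)+
  have int_r: "integral\<^sup>L (N n) k = (1 / Z n) *\<^sub>R (\<integral>x. V x *\<^sub>R k (x \<bullet> a) \<partial>\<mu> n)"
      "integral\<^sup>L N' k = (1 / Z') *\<^sub>R (\<integral>x. V x *\<^sub>R k (x \<bullet> a) \<partial>\<nu>)"
    if "k \<in> borel_measurable borel" for n and k :: "real \<Rightarrow> real"
    unfolding N_def N'_def Z_def Z'_def
    by (rule weighted_image(3)[OF _ _ Vm V(2) B that]; simp add: prob_\<mu> prob_\<nu>)+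
  have limV: "(\<lambda>n. \<integral>x. V x *\<^sub>R iexp (u \<bullet> x) \<partial>\<mu> n) \<longlonglongrightarrow> (\<integral>x. V x *\<^sub>R iexp (u \<bullet> x) \<partial>\<nu>)" if "u \<in> U" for u
    using V(1) that by (auto simp: testable_def)
  have Z: "Z \<longlonglongrightarrow> Z'"
  proof -
    have "(\<lambda>n. complex_of_real (Z n)) \<longlonglongrightarrow> complex_of_real Z'"
      using limV[of 0] by (simp add: Z_def[abs_def] Z'_def span_zero scaleR_conv_of_real)
    then show ?thesis by (simp add: tendsto_of_real_iff)
  qed
  have "weak_conv_m N N'"
  proof (rule levy_continuity[OF rd])
    fix s
    have eq: "V x *\<^sub>R iexp (s * (x \<bullet> a)) = V x *\<^sub>R iexp ((s *\<^sub>R a) \<bullet> x)" for x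
      by (simp add: inner_commute)
    have "(\<lambda>n. (1 / Z n) *\<^sub>R (\<integral>x. V x *\<^sub>R iexp ((s *\<^sub>R a) \<bullet> x) \<partial>\<mu> n)) \<longlonglongrightarrow> (1 / Z') *\<^sub>R (\<integral>x. V x *\<^sub>R iexp ((s *\<^sub>R a) \<bullet> x) \<partial>\<nu>)"
      using Z1(2) a by (intro tendsto_scaleR tendsto_divide tendsto_const Z limV span_scale) auto
    then show "(\<lambda>n. char (N n) s) \<longlonglongrightarrow> char N' s"
      unfolding char_def int_c[OF em] eq .
  qed
  then have "(\<lambda>n. integral\<^sup>L (N n) h) \<longlonglongrightarrow> integral\<^sup>L N' h"
    using h by (intro weak_conv_imp_integral_bdd_continuous_conv[OF rd]) auto
  then have "(\<lambda>n. Z n * ((1 / Z n) *\<^sub>R (\<integral>x. V x *\<^sub>R h (x \<bullet> a) \<partial>\<mu> n))) \<longlonglongrightarrow> Z' * ((1 / Z') *\<^sub>R (\<integral>x. V x *\<^sub>R h (x \<bullet> a) \<partial>\<nu>))"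
    unfolding int_r[OF hm] by (intro tendsto_mult Z)
  moreover have "Z n \<noteq> 0" "Z' \<noteq> 0" for n using Z1(1)[of n] Z1(2) by auto
  ultimately show ?thesis by simp
qed

text \<open>The characteristic functional with weight \<open>f x * h (x \<bullet> a)\<close> at \<open>u\<close> has real and imaginary parts that are integrals
of \<open>h (x \<bullet> a)\<close> with the testable weights \<open>f x * cos (u \<bullet> x)\<close> and \<open>f x * sin (u \<bullet> x)\<close>. Adding a constant makes these
weights at least one, so that the preceding lemma applies.\<close>

lemma testable_mult:
  assumes f: "testable f" and a: "a \<in> U"
    and h: "\<And>y. isCont h y" "\<And>y. \<bar>h y\<bar> \<le> (B' :: real)"
  shows "testable (\<lambda>x. f x * h (x \<bullet> a))"
proof -
  have hm[measurable]: "h \<in> borel_measurable borel"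
    using h(1) by (intro borel_measurable_continuous_onI continuous_at_imp_continuous_on) auto
  have intc: "(\<lambda>n. \<integral>x. g x * h (x \<bullet> a) \<partial>\<mu> n) \<longlonglongrightarrow> (\<integral>x. g x * h (x \<bullet> a) \<partial>\<nu>)" if g: "testable g" for g
  proof -
    from g obtain B where B: "\<And>x. \<bar>g x\<bar> \<le> B" and [measurable]: "g \<in> borel_measurable borel"
      by (auto simp: testable_def)
    \<comment> \<open>the weight \<open>g\<close> is the difference of the weights \<open>g + (B + 1)\<close> and \<open>B + 1\<close>, both at least one\<close>
    have gB: "1 \<le> g x + (B + 1)" for x using B[of x] by linarith
    have t1: "testable (\<lambda>x. g x + (B + 1))" by (intro testable_add g testable_const)
    have "0 \<le> B" using B[of 0] by linarith
    have t2: "testable (\<lambda>_. B + 1)" by (rule testable_const)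
    have B0: "1 \<le> B + 1" using \<open>0 \<le> B\<close> by simp
    have bd: "norm (c * h y) \<le> K * B'" if "\<bar>c\<bar> \<le> K" for c y K
      using mult_mono[OF that h(2)[of y]] that by (simp add: abs_mult)
    have gh: "(\<lambda>x. g x * h (x \<bullet> a)) \<in> borel_measurable borel" "(\<lambda>x. (B + 1) * h (x \<bullet> a)) \<in> borel_measurable borel" by measurable
    note i1 = integrable_bounded[OF gh(1) bd[OF B]]
    have i2: "integrable (\<mu> n) (\<lambda>x. (B + 1) * h (x \<bullet> a))" "integrable \<nu> (\<lambda>x. (B + 1) * h (x \<bullet> a))" for n
      using integrable_bounded[OF gh(2) bd[of "B + 1" "\<bar>B + 1\<bar>"]] by simp_all
    have "(\<lambda>n. (\<integral>x. (g x + (B + 1)) * h (x \<bullet> a) \<partial>\<mu> n) - (\<integral>x. (B + 1) * h (x \<bullet> a) \<partial>\<mu> n))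
        \<longlonglongrightarrow> (\<integral>x. (g x + (B + 1)) * h (x \<bullet> a) \<partial>\<nu>) - (\<integral>x. (B + 1) * h (x \<bullet> a) \<partial>\<nu>)"
      by (intro tendsto_diff testable_integral_mult[OF t1 gB a h] testable_integral_mult[OF t2 B0 a h])
    then show ?thesis
      unfolding distrib_right[of "g _"] Bochner_Integration.integral_add[OF i1(1) i2(1)] Bochner_Integration.integral_add[OF i1(2) i2(2)]
      by simp
  qed
  from f obtain B where B: "\<And>x. \<bar>f x\<bar> \<le> B" and [measurable]: "f \<in> borel_measurable borel"
    by (auto simp: testable_def)
  have bd: "norm (f x * c * h y) \<le> B * B'" if "\<bar>c\<bar> \<le> 1" for c x y
  proof -
    have "\<bar>f x\<bar> * \<bar>c\<bar> \<le> B * 1" using B[of x] that by (intro mult_mono) auto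
    then have "\<bar>f x\<bar> * \<bar>c\<bar> * \<bar>h y\<bar> \<le> B * B'" using h(2)[of y] B[of x] by (intro mult_mono) auto
    then show ?thesis by (simp add: abs_mult)
  qed
  show ?thesis
    unfolding testable_def
  proof (intro conjI ballI)
    show "(\<lambda>x. f x * h (x \<bullet> a)) \<in> borel_measurable borel" by measurable
    show "\<exists>K. \<forall>x. \<bar>f x * h (x \<bullet> a)\<bar> \<le> K" using bd[of 1] by auto
    fix u assume u: "u \<in> U"
    let ?c = "\<lambda>x. f x * cos (u \<bullet> x) * h (x \<bullet> a)" and ?s = "\<lambda>x. f x * sin (u \<bullet> x) * h (x \<bullet> a)"
    have m: "?c \<in> borel_measurable borel" "?s \<in> borel_measurable borel" by measurable
    note ic = integrable_bounded[OF m(1) bd[OF abs_cos_le_one]] and sn = integrable_bounded[OF m(2) bd[OF abs_sin_le_one]]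
    have "(f x * h (x \<bullet> a)) *\<^sub>R iexp (u \<bullet> x) = complex_of_real (?c x) + \<i> * complex_of_real (?s x)" for x
      by (rule complex_eqI) (simp_all add: Re_exp Im_exp mult_ac)
    then have split: "(\<integral>x. (f x * h (x \<bullet> a)) *\<^sub>R iexp (u \<bullet> x) \<partial>N) = complex_of_real (\<integral>x. ?c x \<partial>N) + \<i> * complex_of_real (\<integral>x. ?s x \<partial>N)"
      if "integrable N ?c" "integrable N ?s" for N
      using that
      by (simp only: Bochner_Integration.integral_add integrable_mult_right integrable_of_real
          integral_mult_right_zero integral_complex_of_real)
    have "(\<lambda>n. complex_of_real (\<integral>x. ?c x \<partial>\<mu> n) + \<i> * complex_of_real (\<integral>x. ?s x \<partial>\<mu> n))
      \<longlonglongrightarrow> complex_of_real (\<integral>x. ?c x \<partial>\<nu>) + \<i> * complex_of_real (\<integral>x. ?s x \<partial>\<nu>)"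
      by (intro tendsto_add tendsto_mult tendsto_const tendsto_of_real intc testable_mult_cos_sin f u)
    then show "(\<lambda>n. \<integral>x. (f x * h (x \<bullet> a)) *\<^sub>R iexp (u \<bullet> x) \<partial>\<mu> n) \<longlonglongrightarrow> (\<integral>x. (f x * h (x \<bullet> a)) *\<^sub>R iexp (u \<bullet> x) \<partial>\<nu>)"
      unfolding split[OF ic(1) sn(1)] split[OF ic(2) sn(2)] .
  qed
qed

text \<open>The error may grow quadratically, because second moments are bounded uniformly.\<close>

lemma testable_approx:
  assumes fm: "f \<in> borel_measurable borel" and B: "\<And>x. \<bar>f x\<bar> \<le> B"
    and approx: "\<And>r. 0 < r \<Longrightarrow> \<exists>g. testable g \<and> (\<forall>x. \<bar>f x - g x\<bar> \<le> r * (1 + (norm x)\<^sup>2))"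
  shows "testable f"
  unfolding testable_def
proof (intro conjI ballI)
  show "\<exists>B. \<forall>x. \<bar>f x\<bar> \<le> B" using B by blast
  fix u assume u: "u \<in> U"
  note [measurable] = fm
  have C: "0 \<le> C"
    using order_trans[OF integral_nonneg_AE moment_\<nu>(2)] by auto
  have diff: "norm ((\<integral>x. f x *\<^sub>R iexp (u \<bullet> x) \<partial>N) - (\<integral>x. g x *\<^sub>R iexp (u \<bullet> x) \<partial>N)) \<le> r * (1 + C)"
    if N: "prob_space N" "sets N = sets borel" "integrable N (\<lambda>x. (norm x)\<^sup>2)" "(\<integral>x. (norm x)\<^sup>2 \<partial>N) \<le> C"
      and g: "integrable N (\<lambda>x. g x *\<^sub>R iexp (u \<bullet> x))" "integrable N (\<lambda>x. f x *\<^sub>R iexp (u \<bullet> x))"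
        "\<And>x. \<bar>f x - g x\<bar> \<le> r * (1 + (norm x)\<^sup>2)" and r: "0 < r"
    for N g r
  proof -
    interpret prob_space N by fact
    have "norm ((\<integral>x. f x *\<^sub>R iexp (u \<bullet> x) \<partial>N) - (\<integral>x. g x *\<^sub>R iexp (u \<bullet> x) \<partial>N))
        = norm (\<integral>x. f x *\<^sub>R iexp (u \<bullet> x) - g x *\<^sub>R iexp (u \<bullet> x) \<partial>N)"
      using g by simp
    also have "\<dots> \<le> (\<integral>x. norm (f x *\<^sub>R iexp (u \<bullet> x) - g x *\<^sub>R iexp (u \<bullet> x)) \<partial>N)"
      by (rule integral_norm_bound)
    also have "\<dots> \<le> (\<integral>x. r * (1 + (norm x)\<^sup>2) \<partial>N)"
    proof (rule integral_mono)
      show "integrable N (\<lambda>x. norm (f x *\<^sub>R iexp (u \<bullet> x) - g x *\<^sub>R iexp (u \<bullet> x)))"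
        using g by (intro integrable_norm Bochner_Integration.integrable_diff)
      show "integrable N (\<lambda>x. r * (1 + (norm x)\<^sup>2))" using N(3) by simp
      show "norm (f x *\<^sub>R iexp (u \<bullet> x) - g x *\<^sub>R iexp (u \<bullet> x)) \<le> r * (1 + (norm x)\<^sup>2)" for x
        using g(3)[of x] by (simp flip: scaleR_diff_left)
    qed
    also have "\<dots> = r * (1 + (\<integral>x. (norm x)\<^sup>2 \<partial>N))" using N(3) by (simp add: prob_space)
    also have "\<dots> \<le> r * (1 + C)" using r N(4) by (intro mult_left_mono) auto
    finally show ?thesis .
  qed
  have m: "(\<lambda>x. f x *\<^sub>R iexp (u \<bullet> x)) \<in> borel_measurable borel" by measurable
  have intf: "integrable (\<mu> n) (\<lambda>x. f x *\<^sub>R iexp (u \<bullet> x))" "integrable \<nu> (\<lambda>x. f x *\<^sub>R iexp (u \<bullet> x))" for n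
    by (rule integrable_bounded[OF m, of B]; use B in simp)+
  show "(\<lambda>n. \<integral>x. f x *\<^sub>R iexp (u \<bullet> x) \<partial>\<mu> n) \<longlonglongrightarrow> (\<integral>x. f x *\<^sub>R iexp (u \<bullet> x) \<partial>\<nu>)"
  proof (rule LIMSEQ_I)
    fix s :: real assume s: "0 < s"
    define r where "r = s / 3 / (1 + C)"
    have r: "0 < r" "r * (1 + C) = s / 3"
    proof -
      have "0 < 1 + C" using C by simp
      then show "0 < r" "r * (1 + C) = s / 3" unfolding r_def using s by (simp_all del: distrib_left_numeral)
    qed
    from approx[OF r(1)] obtain g where g: "testable g" "\<And>x. \<bar>f x - g x\<bar> \<le> r * (1 + (norm x)\<^sup>2)" by auto
    let ?I = "\<lambda>h N. \<integral>x. h x *\<^sub>R iexp (u \<bullet> x) \<partial>N"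
    have "(\<lambda>n. ?I g (\<mu> n)) \<longlonglongrightarrow> ?I g \<nu>" using g(1) u by (auto simp: testable_def)
    from LIMSEQ_D[OF this, of "s / 3"] s
    obtain n0 where n0: "\<And>n. n0 \<le> n \<Longrightarrow> norm (?I g (\<mu> n) - ?I g \<nu>) < s / 3" by auto
    have "norm (?I f (\<mu> n) - ?I f \<nu>) < s" if "n0 \<le> n" for n
    proof -
      have a: "norm (?I f (\<mu> n) - ?I g (\<mu> n)) \<le> s / 3"
        using diff[OF prob_\<mu> sets_\<mu> moment_\<mu> integrable_testable(1)[OF g(1)] intf(1) g(2) r(1)] r(2) by simp
      have b: "norm (?I f \<nu> - ?I g \<nu>) \<le> s / 3"
        using diff[OF prob_\<nu> sets_\<nu> moment_\<nu> integrable_testable(2)[OF g(1)] intf(2) g(2) r(1)] r(2) by simp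
      have tri: "norm (x - y) < s" if "norm (x - x') \<le> s / 3" "norm (x' - y') < s / 3" "norm (y - y') \<le> s / 3"
        for x y x' y' :: complex
      proof -
        have "x - y = (x - x') + (x' - y') - (y - y')" by simp
        then have "norm (x - y) \<le> norm (x - x') + norm (x' - y') + norm (y - y')"
          by (metis norm_triangle_ineq norm_triangle_ineq4 add_right_mono order_trans)
        with that show ?thesis by linarith
      qed
      show ?thesis by (rule tri[OF a n0[OF that] b])
    qed
    then show "\<exists>no. \<forall>n\<ge>no. norm (?I f (\<mu> n) - ?I f \<nu>) < s" by blast
  qed
qed (rule fm)

lemma lipschitz_measurable:
  fixes g :: "'h \<Rightarrow> real"
  assumes "\<And>x y. \<bar>g x - g y\<bar> \<le> \<Lambda> * norm (x - y)"
  shows "g \<in> borel_measurable borel"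
proof (rule borel_measurable_continuous_onI)
  have "(max 0 \<Lambda>)-lipschitz_on UNIV g"
  proof (rule lipschitz_onI)
    fix x y
    have "\<bar>g x - g y\<bar> \<le> \<Lambda> * norm (x - y)" by (rule assms)
    also have "\<dots> \<le> max 0 \<Lambda> * norm (x - y)" by (intro mult_right_mono) auto
    finally show "dist (g x) (g y) \<le> max 0 \<Lambda> * dist x y" by (simp add: dist_norm)
  qed simp
  then show "continuous_on UNIV g" by (rule lipschitz_on_continuous_on)
qed

text \<open>Induction on the number of coordinates. In the last coordinate, interpolate \<open>g\<close> between equidistant nodes: this writes
it, up to a small error, as a finite sum of products of a function of the first \<open>m\<close> coordinates, testable by induction,
and a tent in the last coordinate. Far from the nodes the error is at most \<open>B\<close>, which the quadratic
bound absorbs.\<close>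

lemma testable_lipschitz_proj:
  assumes "\<And>x. \<bar>g x\<bar> \<le> B" "\<And>x y. \<bar>g x - g y\<bar> \<le> \<Lambda> * norm (x - y)" "0 \<le> \<Lambda>"
  shows "testable (\<lambda>x. g (proj e m x))"
  using assms
proof (induction m arbitrary: g)
  case 0
  then show ?case by (simp add: testable_const)
next
  case (Suc m g)
  note gB = Suc.prems(1) and gL = Suc.prems(2)
  let ?e = "e (Suc m)"
  have e1: "norm ?e = 1" using inner_basis[of "Suc m" "Suc m"] by (simp add: norm_eq_1)
  have eU: "?e \<in> U" by (rule span_base) auto
  have [measurable]: "g \<in> borel_measurable borel" by (rule lipschitz_measurable[OF gL])
  have B0: "0 \<le> B" using gB[of 0] by linarith
  show ?case
  proof (rule testable_approx)
    show "(\<lambda>x. g (proj e (Suc m) x)) \<in> borel_measurable borel" by measurable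
    show "\<bar>g (proj e (Suc m) x)\<bar> \<le> B" for x by (rule gB)
    fix r :: real assume r: "0 < r"
    \<comment> \<open>\<open>\<eta>\<close> is the distance of the nodes; there are \<open>2 K + 1\<close> of them\<close>
    define \<eta> where "\<eta> = min 1 (r / (\<Lambda> + B + 1))"
    have D: "0 < \<Lambda> + B + 1" using Suc.prems(3) B0 by linarith
    have \<eta>: "0 < \<eta>" "\<eta> \<le> 1" using r D by (auto simp: \<eta>_def)
    have \<eta>r: "(\<Lambda> + B) * \<eta> \<le> r"
    proof -
      have "(\<Lambda> + B) * \<eta> \<le> (\<Lambda> + B + 1) * (r / (\<Lambda> + B + 1))"
        using Suc.prems(3) B0 \<eta>(1) r by (intro mult_mono) (auto simp: \<eta>_def)
      then show ?thesis using D by simp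
    qed
    obtain K :: nat where K: "1 / \<eta>\<^sup>2 \<le> real K" using real_arch_simple by blast
    define T where "T k x = g (proj e m x + (real_of_int k * \<eta>) *\<^sub>R ?e) * tent ((x \<bullet> ?e) / \<eta> - real_of_int k)" for k x
    define G where "G x = (\<Sum>k\<in>{- int K..int K}. T k x)" for x
    have "testable (T k)" for k
      unfolding T_def[abs_def]
    proof (rule testable_mult[OF _ eU, where h = "\<lambda>y. tent (y / \<eta> - real_of_int k)" and B' = 1])
      have lip': "\<bar>g (x + z) - g (y + z)\<bar> \<le> \<Lambda> * norm (x - y)" for x y z
        using gL[of "x + z" "y + z"] by simp
      show "testable (\<lambda>x. g (proj e m x + (real_of_int k * \<eta>) *\<^sub>R ?e))"
        by (rule Suc.IH[where g = "\<lambda>x. g (x + (real_of_int k * \<eta>) *\<^sub>R ?e)"]) (use gB lip' Suc.prems(3) in auto)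
      show "isCont (\<lambda>y. tent (y / \<eta> - real_of_int k)) y" for y
        using \<eta>(1) by (intro isCont_o2[OF _ continuous_tent] continuous_intros) auto
      show "\<bar>tent (y / \<eta> - real_of_int k)\<bar> \<le> 1" for y
        using tent_props(1,2) by (simp add: abs_le_iff)
    qed
    then have "testable G" unfolding G_def[abs_def] by (intro testable_sum)
    moreover have "\<bar>g (proj e (Suc m) x) - G x\<bar> \<le> r * (1 + (norm x)\<^sup>2)" for x
    proof -
      define y where "y = x \<bullet> ?e"
      define p where "p = proj e m x"
      define \<tau> where "\<tau> k = tent (y / \<eta> - real_of_int k)" for k
      define s where "s = (\<Sum>k\<in>{- int K..int K}. \<tau> k)"
      have s: "s \<le> 1" "\<bar>y / \<eta>\<bar> \<le> real K \<Longrightarrow> s = 1"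
        unfolding s_def \<tau>_def using sum_tents by auto
      have s0: "0 \<le> s" unfolding s_def \<tau>_def by (intro sum_nonneg tent_props)
      have a: "\<bar>(\<Sum>k\<in>{- int K..int K}. (g (p + y *\<^sub>R ?e) - g (p + (real_of_int k * \<eta>) *\<^sub>R ?e)) * \<tau> k)\<bar> \<le> \<Lambda> * \<eta>"
      proof -
        have "\<bar>(g (p + y *\<^sub>R ?e) - g (p + (real_of_int k * \<eta>) *\<^sub>R ?e)) * \<tau> k\<bar> \<le> \<Lambda> * \<eta> * \<tau> k" for k
        proof (cases "\<tau> k = 0")
          case False
          then have "\<bar>y / \<eta> - real_of_int k\<bar> \<le> 1" unfolding \<tau>_def by (rule tent_props)
          then have "\<bar>y / \<eta> - real_of_int k\<bar> * \<eta> \<le> 1 * \<eta>" using \<eta> by (intro mult_right_mono) auto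
          then have "\<bar>(y / \<eta> - real_of_int k) * \<eta>\<bar> \<le> \<eta>" using \<eta>(1) by (simp add: abs_mult)
          moreover have "(y / \<eta> - real_of_int k) * \<eta> = y - real_of_int k * \<eta>" using \<eta>(1) by (simp add: left_diff_distrib)
          ultimately have "\<bar>y - real_of_int k * \<eta>\<bar> \<le> \<eta>" by simp
          moreover have "\<bar>g (p + y *\<^sub>R ?e) - g (p + (real_of_int k * \<eta>) *\<^sub>R ?e)\<bar> \<le> \<Lambda> * \<bar>y - real_of_int k * \<eta>\<bar>"
            using gL[of "p + y *\<^sub>R ?e" "p + (real_of_int k * \<eta>) *\<^sub>R ?e"] e1 by (simp flip: scaleR_diff_left)
          ultimately have "\<bar>g (p + y *\<^sub>R ?e) - g (p + (real_of_int k * \<eta>) *\<^sub>R ?e)\<bar> \<le> \<Lambda> * \<eta>"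
            using Suc.prems(3) by (meson mult_left_mono order_trans)
          then show ?thesis using tent_props(1) by (simp add: abs_mult \<tau>_def mult_right_mono)
        qed simp
        then have "\<bar>(\<Sum>k\<in>{- int K..int K}. (g (p + y *\<^sub>R ?e) - g (p + (real_of_int k * \<eta>) *\<^sub>R ?e)) * \<tau> k)\<bar> \<le> (\<Sum>k\<in>{- int K..int K}. \<Lambda> * \<eta> * \<tau> k)"
          by (intro order_trans[OF sum_abs] sum_mono)
        also have "\<dots> = \<Lambda> * \<eta> * s" by (simp add: s_def sum_distrib_left)
        also have "\<dots> \<le> \<Lambda> * \<eta> * 1" using s(1) Suc.prems(3) \<eta>(1) by (intro mult_left_mono) auto
        finally show ?thesis by simp
      qed
      have b: "\<bar>g (p + y *\<^sub>R ?e) * (1 - s)\<bar> \<le> B * (\<eta> * y\<^sup>2)"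
      proof (cases "\<bar>y / \<eta>\<bar> \<le> real K")
        case True
        then show ?thesis using s(2) B0 \<eta>(1) by simp
      next
        case False
        have "1 / \<eta>\<^sup>2 \<le> \<bar>y\<bar> / \<eta>" using False K \<eta>(1) by (simp add: abs_divide)
        then have "1 \<le> \<eta> * \<bar>y\<bar>" using \<eta>(1) by (simp add: field_simps power2_eq_square)
        then have "1 * 1 \<le> (\<eta> * \<bar>y\<bar>) * (\<eta> * \<bar>y\<bar>)" by (intro mult_mono) auto
        also have "\<dots> = \<eta> * (\<eta> * y\<^sup>2)" by (simp add: power2_eq_square)
        also have "\<dots> \<le> 1 * (\<eta> * y\<^sup>2)" using \<eta> by (intro mult_right_mono) auto
        finally have "1 \<le> \<eta> * y\<^sup>2" by simp
        then have "\<bar>1 - s\<bar> \<le> \<eta> * y\<^sup>2" using s s0 by auto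
        then show ?thesis unfolding abs_mult using gB by (intro mult_mono) (auto simp: B0)
      qed
      have "g (proj e (Suc m) x) - G x = (\<Sum>k\<in>{- int K..int K}. (g (p + y *\<^sub>R ?e) - g (p + (real_of_int k * \<eta>) *\<^sub>R ?e)) * \<tau> k) + g (p + y *\<^sub>R ?e) * (1 - s)"
        unfolding proj_Suc G_def T_def p_def[symmetric] y_def[symmetric] \<tau>_def[symmetric] s_def
        by (simp add: left_diff_distrib sum_subtractf sum_distrib_left right_diff_distrib)
      then have "\<bar>g (proj e (Suc m) x) - G x\<bar> \<le> \<Lambda> * \<eta> + B * (\<eta> * y\<^sup>2)" using a b by linarith
      also have "\<dots> \<le> (\<Lambda> + B) * \<eta> * (1 + y\<^sup>2)"
        using Suc.prems(3) B0 \<eta>(1) by (simp add: algebra_simps)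
      also have "\<dots> \<le> r * (1 + (norm x)\<^sup>2)"
      proof (intro mult_mono add_mono \<eta>r)
        have "\<bar>y\<bar> \<le> norm x * norm ?e" unfolding y_def by (rule Cauchy_Schwarz_ineq2)
        then show "y\<^sup>2 \<le> (norm x)\<^sup>2" using e1 by (simp flip: abs_le_square_iff)
      qed (use r in auto)
      finally show ?thesis .
    qed
    ultimately show "\<exists>f'. testable f' \<and> (\<forall>x. \<bar>g (proj e (Suc m) x) - f' x\<bar> \<le> r * (1 + (norm x)\<^sup>2))" by blast
  qed
qed

lemma lipschitz_convergence:
  assumes gB: "\<And>x. \<bar>g x\<bar> \<le> B" and gL: "\<And>x y. \<bar>g x - g y\<bar> \<le> \<Lambda> * norm (x - y)" and L0: "0 \<le> \<Lambda>"
  shows "(\<lambda>n. \<integral>x. g x \<partial>\<mu> n) \<longlonglongrightarrow> (\<integral>x. g x \<partial>\<nu>)"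
proof -
  have [measurable]: "g \<in> borel_measurable borel" by (rule lipschitz_measurable[OF gL])
  have gp: "(\<lambda>x. g (proj e m x)) \<in> borel_measurable borel" for m by measurable
  have int: "integrable (\<mu> n) g" "integrable \<nu> g" "integrable (\<mu> n) (\<lambda>x. g (proj e m x))" "integrable \<nu> (\<lambda>x. g (proj e m x))" for n m
    by (rule integrable_bounded[where B = B]; (rule gp)?; simp add: gB)+
  have diff: "\<bar>(\<integral>x. g x \<partial>N) - (\<integral>x. g (proj e m x) \<partial>N)\<bar> \<le> \<Lambda> * sqrt (t m)"
    if N: "prob_space N" "sets N = sets borel" "integrable N (\<lambda>x. (norm x)\<^sup>2)" "integrable N g" "integrable N (\<lambda>x. g (proj e m x))"
      "(\<integral>x. (norm (x - proj e m x))\<^sup>2 \<partial>N) \<le> t m" for N m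
  proof -
    interpret prob_space N by fact
    have [measurable_cong]: "sets N = sets borel" by fact
    have nm: "(\<lambda>x. norm (x - proj e m x)) \<in> borel_measurable N" by measurable
    have L2: "(\<lambda>x. norm (x - proj e m x)) \<in> L2_real N N"
    proof (rule L2_realI[OF nm])
      show "integrable N (\<lambda>x. (norm (x - proj e m x))\<^sup>2)"
        by (rule Bochner_Integration.integrable_bound[OF N(3)])
          (measurable, auto intro!: power_mono norm_minus_proj_le)
    qed
    have "\<bar>(\<integral>x. g x \<partial>N) - (\<integral>x. g (proj e m x) \<partial>N)\<bar> = \<bar>\<integral>x. g x - g (proj e m x) \<partial>N\<bar>"
      using N by simp
    also have "\<dots> \<le> (\<integral>x. \<bar>g x - g (proj e m x)\<bar> \<partial>N)" by (rule integral_abs_bound)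
    also have "\<dots> \<le> (\<integral>x. \<Lambda> * norm (x - proj e m x) \<partial>N)"
      using N gL L2_real_integrable[OF L2] by (intro integral_mono) auto
    also have "\<dots> = \<Lambda> * (\<integral>x. \<bar>norm (x - proj e m x)\<bar> \<partial>N)" by simp
    also have "\<dots> \<le> \<Lambda> * l2norm N (\<lambda>x. norm (x - proj e m x))"
      by (intro mult_left_mono abs_expectation_le_l2norm L2 L0)
    also have "\<dots> \<le> \<Lambda> * sqrt (t m)" unfolding l2norm_def using N(6) L0 by (intro mult_left_mono) auto
    finally show ?thesis .
  qed
  have lim: "(\<lambda>n. \<integral>x. g (proj e m x) \<partial>\<mu> n) \<longlonglongrightarrow> (\<integral>x. g (proj e m x) \<partial>\<nu>)" for m
  proof -
    have "testable (\<lambda>x. g (proj e m x))" by (rule testable_lipschitz_proj[OF assms])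
    then have "(\<lambda>n. \<integral>x. g (proj e m x) *\<^sub>R iexp (0 \<bullet> x) \<partial>\<mu> n) \<longlonglongrightarrow> (\<integral>x. g (proj e m x) *\<^sub>R iexp (0 \<bullet> x) \<partial>\<nu>)"
      unfolding testable_def by (blast intro: span_zero)
    then show ?thesis by (simp add: scaleR_conv_of_real tendsto_of_real_iff)
  qed
  show ?thesis
  proof (rule LIMSEQ_I)
    fix s :: real assume s: "0 < s"
    have "(\<lambda>m. \<Lambda> * sqrt (t m)) \<longlonglongrightarrow> \<Lambda> * sqrt 0" by (intro tendsto_intros t_tendsto)
    then have "eventually (\<lambda>m. \<Lambda> * sqrt (t m) < s / 3) sequentially"
      using s by (intro order_tendstoD(2)) auto
    then obtain m where m: "\<Lambda> * sqrt (t m) < s / 3" by (auto simp: eventually_sequentially)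
    from LIMSEQ_D[OF lim[of m], of "s / 3"] s obtain n0 where
      n0: "\<And>n. n0 \<le> n \<Longrightarrow> norm ((\<integral>x. g (proj e m x) \<partial>\<mu> n) - (\<integral>x. g (proj e m x) \<partial>\<nu>)) < s / 3" by auto
    have "norm ((\<integral>x. g x \<partial>\<mu> n) - (\<integral>x. g x \<partial>\<nu>)) < s" if "n0 \<le> n" for n
      using n0[OF that] m diff[OF prob_\<mu> sets_\<mu> moment_\<mu>(1) int(1) int(3) tail_\<mu>, of n m]
        diff[OF prob_\<nu> sets_\<nu> moment_\<nu>(1) int(2) int(4) tail_\<nu>, of m] unfolding real_norm_def by linarith
    then show "\<exists>no. \<forall>n\<ge>no. norm ((\<integral>x. g x \<partial>\<mu> n) - (\<integral>x. g x \<partial>\<nu>)) < s" by blast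
  qed
qed

text \<open>For continuous \<open>h\<close> the infimal convolutions are Lipschitz, lie below \<open>h\<close> and converge to it, which gives a lower bound for
the integrals in the limit; apply this to \<open>f\<close> and to \<open>- f\<close>.\<close>

theorem bounded_continuous_convergence:
  fixes f :: "'h \<Rightarrow> real"
  assumes cont: "continuous_on UNIV f" and bdd: "bounded (range f)"
  shows "(\<lambda>n. \<integral>x. f x \<partial>\<mu> n) \<longlonglongrightarrow> (\<integral>x. f x \<partial>\<nu>)"
proof -
  obtain B where B: "\<And>x. \<bar>f x\<bar> \<le> B" using bdd by (auto simp: bounded_iff)
  interpret N: prob_space \<nu> by (rule prob_\<nu>)
  have lower: "eventually (\<lambda>n. (\<integral>x. h x \<partial>\<nu>) - r < (\<integral>x. h x \<partial>\<mu> n)) sequentially"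
    if hB: "\<And>x. \<bar>h x\<bar> \<le> B" and hc: "\<And>x. isCont h x" and r: "0 < r" for h :: "'h \<Rightarrow> real" and r
  proof -
    note ic = inf_conv_props[where f = h, OF hB]
    have hm: "h \<in> borel_measurable borel"
      using hc by (intro borel_measurable_continuous_onI continuous_at_imp_continuous_on) auto
    have im: "inf_conv h k \<in> borel_measurable borel" for k by (rule lipschitz_measurable[OF ic(3)])
    have "(\<lambda>k. \<integral>x. inf_conv h k x \<partial>\<nu>) \<longlonglongrightarrow> (\<integral>x. h x \<partial>\<nu>)"
      using ic(2) ic(4)[OF hc] hm im by (intro integral_dominated_convergence[where w = "\<lambda>_. B"]) auto
    then have "eventually (\<lambda>k. (\<integral>x. h x \<partial>\<nu>) - r < (\<integral>x. inf_conv h k x \<partial>\<nu>)) sequentially"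
      using r by (intro order_tendstoD(1)) auto
    then obtain k where k: "(\<integral>x. h x \<partial>\<nu>) - r < (\<integral>x. inf_conv h k x \<partial>\<nu>)" by (auto simp: eventually_sequentially)
    have "(\<lambda>n. \<integral>x. inf_conv h k x \<partial>\<mu> n) \<longlonglongrightarrow> (\<integral>x. inf_conv h k x \<partial>\<nu>)"
      by (rule lipschitz_convergence[OF ic(2,3)]) simp
    then have "eventually (\<lambda>n. (\<integral>x. h x \<partial>\<nu>) - r < (\<integral>x. inf_conv h k x \<partial>\<mu> n)) sequentially"
      using k by (intro order_tendstoD(1))
    then show ?thesis
    proof (rule eventually_mono)
      fix n assume "(\<integral>x. h x \<partial>\<nu>) - r < (\<integral>x. inf_conv h k x \<partial>\<mu> n)"
      also have "\<dots> \<le> (\<integral>x. h x \<partial>\<mu> n)"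
        using integrable_bounded(1)[OF im[of k], where B = B] integrable_bounded(1)[OF hm, where B = B] ic(1,2) hB
        by (intro integral_mono) auto
      finally show "(\<integral>x. h x \<partial>\<nu>) - r < (\<integral>x. h x \<partial>\<mu> n)" .
    qed
  qed
  have fc: "isCont f x" for x using cont by (simp add: continuous_on_eq_continuous_at)
  show ?thesis
  proof (rule tendstoI)
    fix r :: real assume r: "0 < r"
    have 1: "eventually (\<lambda>n. (\<integral>x. f x \<partial>\<nu>) - r < (\<integral>x. f x \<partial>\<mu> n)) sequentially"
      by (rule lower[OF B fc r])
    have "eventually (\<lambda>n. (\<integral>x. - f x \<partial>\<nu>) - r < (\<integral>x. - f x \<partial>\<mu> n)) sequentially"
      by (rule lower) (use B fc r in \<open>auto intro: continuous_intros\<close>)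
    then have "eventually (\<lambda>n. - (\<integral>x. f x \<partial>\<nu>) - r < - (\<integral>x. f x \<partial>\<mu> n)) sequentially"
      by simp
    with 1 show "eventually (\<lambda>n. dist (\<integral>x. f x \<partial>\<mu> n) (\<integral>x. f x \<partial>\<nu>) < r) sequentially"
      by eventually_elim (simp add: dist_real_def abs_less_iff)
  qed
qed

end

section \<open>Triangular factorisation of nonnegative definite matrices\<close>

definition psd :: "(nat \<Rightarrow> nat \<Rightarrow> real) \<Rightarrow> bool" where
  "psd A \<longleftrightarrow> (\<forall>i j. A i j = A j i) \<and> (\<forall>n r. 0 \<le> (\<Sum>i<n. \<Sum>j<n. r i * r j * A i j))"

text \<open>The quadratic form at \<open>r\<close> plus \<open>t\<close> times the \<open>k\<close>-th unit vector is a nonnegative quadratic polynomial in \<open>t\<close>. It is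
evaluated on \<open>max n (Suc k)\<close> coordinates, so that the \<open>k\<close>-th is among them.\<close>

lemma psd_Cauchy_Schwarz:
  assumes A: "psd A"
  shows "(\<Sum>i<n. r i * A i k)\<^sup>2 \<le> (\<Sum>i<n. \<Sum>j<n. r i * r j * A i j) * A k k"
proof (rule quadratic_nonneg_imp_discriminant)
  fix t :: real
  have sym: "A i j = A j i" for i j using A by (auto simp: psd_def)
  define N where "N = max n (Suc k)"
  define r' where "r' i = (if i < n then r i else 0)" for i
  define d where "d i = (if i = k then t else 0)" for i
  have ext: "(\<Sum>i<N. r' i * f i) = (\<Sum>i<n. r i * f i)" for f :: "nat \<Rightarrow> real"
  proof -
    have "(\<Sum>i<N. r' i * f i) = (\<Sum>i<n. r' i * f i)"
      by (rule sum.mono_neutral_right) (auto simp: N_def r'_def)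
    then show ?thesis by (simp add: r'_def)
  qed
  have dl: "(\<Sum>i<N. d i * f i) = t * f k" for f :: "nat \<Rightarrow> real"
  proof -
    have "(\<Sum>i<N. d i * f i) = (\<Sum>i<N. if i = k then t * f k else 0)"
      by (intro sum.cong) (auto simp: d_def)
    also have "\<dots> = t * f k" by (subst sum.delta) (auto simp: N_def)
    finally show ?thesis .
  qed
  have "0 \<le> (\<Sum>i<N. \<Sum>j<N. (r' i + d i) * (r' j + d j) * A i j)" using A by (auto simp: psd_def)
  also have "\<dots> = (\<Sum>i<N. r' i * (\<Sum>j<N. r' j * A i j)) + (\<Sum>i<N. r' i * (\<Sum>j<N. d j * A i j))
      + (\<Sum>i<N. d i * (\<Sum>j<N. r' j * A i j)) + (\<Sum>i<N. d i * (\<Sum>j<N. d j * A i j))"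
    by (simp add: sum_distrib_left sum.distrib[symmetric] algebra_simps)
  also have "\<dots> = (\<Sum>i<n. r i * (\<Sum>j<n. r j * A i j)) + (\<Sum>i<n. r i * (t * A i k))
      + t * (\<Sum>j<n. r j * A k j) + t * (t * A k k)"
    unfolding ext dl ..
  also have "(\<Sum>j<n. r j * A k j) = (\<Sum>i<n. r i * A i k)" using sym by simp
  also have "(\<Sum>i<n. r i * (t * A i k)) = t * (\<Sum>i<n. r i * A i k)"
    by (simp add: sum_distrib_left mult.left_commute)
  also have "(\<Sum>i<n. r i * (\<Sum>j<n. r j * A i j)) = (\<Sum>i<n. \<Sum>j<n. r i * r j * A i j)"
    by (simp add: sum_distrib_left mult.assoc)
  finally show "0 \<le> (\<Sum>i<n. \<Sum>j<n. r i * r j * A i j) + 2 * t * (\<Sum>i<n. r i * A i k) + t\<^sup>2 * A k k"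
    by (simp add: power2_eq_square algebra_simps)
qed

lemma psd_diag_nonneg:
  assumes A: "psd A"
  shows "0 \<le> A k k"
proof -
  define r where "r i = (if i = k then 1 else 0 :: real)" for i
  have "(\<Sum>j<Suc k. r i * r j * A i j) = r i * A i k" for i
  proof -
    have "(\<Sum>j<Suc k. r i * r j * A i j) = (\<Sum>j<Suc k. if j = k then r i * A i k else 0)"
      by (intro sum.cong) (auto simp: r_def)
    also have "\<dots> = r i * A i k" by (subst sum.delta) auto
    finally show ?thesis .
  qed
  then have "(\<Sum>i<Suc k. \<Sum>j<Suc k. r i * r j * A i j) = (\<Sum>i<Suc k. if i = k then A k k else 0)"
    by (simp only:) (intro sum.cong, auto simp: r_def)
  also have "\<dots> = A k k" by (subst sum.delta) auto
  finally have eq: "(\<Sum>i<Suc k. \<Sum>j<Suc k. r i * r j * A i j) = A k k" .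
  have "0 \<le> (\<Sum>i<Suc k. \<Sum>j<Suc k. r i * r j * A i j)" using A unfolding psd_def by blast
  then show ?thesis unfolding eq .
qed

text \<open>The Schur complement, that is, one step of Gaussian elimination. Because division by zero gives zero, a
  vanishing pivot \<open>A k k\<close> needs no special treatment: its whole row vanishes, by the Cauchy--Schwarz
  inequality.\<close>

definition schur :: "(nat \<Rightarrow> nat \<Rightarrow> real) \<Rightarrow> nat \<Rightarrow> nat \<Rightarrow> nat \<Rightarrow> real" where
  "schur A k i j = A i j - A i k * A j k / A k k"

lemma psd_schur:
  assumes A: "psd A"
  shows "psd (schur A k)"
  unfolding psd_def
proof (intro conjI allI)
  have sym: "A i j = A j i" for i j using A by (auto simp: psd_def)
  show "schur A k i j = schur A k j i" for i j unfolding schur_def sym[of i j] by simp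
  fix n and r :: "nat \<Rightarrow> real"
  let ?Q = "\<Sum>i<n. \<Sum>j<n. r i * r j * A i j" and ?b = "\<Sum>i<n. r i * A i k"
  have "(\<Sum>i<n. \<Sum>j<n. r i * r j * schur A k i j) = ?Q - (\<Sum>i<n. \<Sum>j<n. (r i * A i k) * (r j * A j k) / A k k)"
    unfolding sum_subtractf[symmetric] schur_def by (intro sum.cong refl) (simp add: right_diff_distrib)
  also have "(\<Sum>i<n. \<Sum>j<n. (r i * A i k) * (r j * A j k) / A k k) = ?b\<^sup>2 / A k k"
    unfolding power2_eq_square sum_product sum_divide_distrib ..
  finally have eq: "(\<Sum>i<n. \<Sum>j<n. r i * r j * schur A k i j) = ?Q - ?b\<^sup>2 / A k k" .
  have "?b\<^sup>2 \<le> ?Q * A k k" by (rule psd_Cauchy_Schwarz[OF A])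
  moreover have "0 \<le> A k k" by (rule psd_diag_nonneg[OF A])
  moreover have "0 \<le> ?Q" using A by (auto simp: psd_def)
  ultimately have "?b\<^sup>2 / A k k \<le> ?Q" by (cases "A k k = 0") (auto simp: pos_divide_le_eq)
  then show "0 \<le> (\<Sum>i<n. \<Sum>j<n. r i * r j * schur A k i j)" unfolding eq by simp
qed

lemma schur_row_zero:
  assumes A: "psd A"
  shows "schur A k k j = 0"
proof (cases "A k k = 0")
  case True
  define r where "r i = (if i = j then 1 else 0 :: real)" for i
  have "(\<Sum>i<Suc j. r i * A i k) = (\<Sum>i<Suc j. if i = j then A j k else 0)"
    by (intro sum.cong) (auto simp: r_def)
  also have "\<dots> = A j k" by (subst sum.delta) auto
  finally have "(A j k)\<^sup>2 \<le> 0"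
    using psd_Cauchy_Schwarz[OF A, where r = r and n = "Suc j" and k = k] True by simp
  then have "A j k = 0" by simp
  moreover have "A k j = A j k" using A by (simp add: psd_def)
  ultimately show ?thesis by (simp add: schur_def)
next
  case False
  moreover have "A k j = A j k" using A by (simp add: psd_def)
  ultimately show ?thesis by (simp add: schur_def)
qed

primrec schurs :: "(nat \<Rightarrow> nat \<Rightarrow> real) \<Rightarrow> nat \<Rightarrow> nat \<Rightarrow> nat \<Rightarrow> real" where
  "schurs A 0 = A"
| "schurs A (Suc k) = schur (schurs A k) k"

text \<open>Cholesky's factorisation. After \<open>n\<close> elimination steps the first \<open>n\<close> rows are zero, so for \<open>i < n\<close> the entry \<open>A i j\<close> is the
sum of what the steps have subtracted, and step \<open>k\<close> subtracts a product \<open>c i k * c j k\<close>.\<close>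

lemma triangular_factorisation:
  assumes A: "psd A"
  shows "\<exists>c. \<forall>i j n. i < n \<longrightarrow> A i j = (\<Sum>k<n. c i k * c j k)"
proof -
  have P: "psd (schurs A k)" for k by (induction k) (auto simp: A psd_schur)
  have zero: "schurs A k i j = 0" if "i < k" for i j k
    using that
  proof (induction k arbitrary: j)
    case (Suc k)
    show ?case
    proof (cases "i = k")
      case True
      then show ?thesis using schur_row_zero[OF P] by simp
    next
      case False
      with Suc show ?thesis by (simp add: schur_def)
    qed
  qed simp
  define c where "c i k = schurs A k i k / sqrt (schurs A k k k)" for i k
  have cc: "c i k * c j k = schurs A k i k * schurs A k j k / schurs A k k k" for i j k
    unfolding c_def using psd_diag_nonneg[OF P, of k k] by simp
  have "A i j = (\<Sum>k<n. c i k * c j k) + schurs A n i j" for i j n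
    by (induction n) (auto simp: cc schur_def)
  then have "A i j = (\<Sum>k<n. c i k * c j k)" if "i < n" for i j n
    using zero[OF that] by (metis add.right_neutral)
  then show ?thesis by blast
qed

section \<open>Normal laws on a Hilbert space\<close>

abbreviation gauss_seq :: "(nat \<Rightarrow> real) measure" where
  "gauss_seq \<equiv> PiM UNIV (\<lambda>_. std_normal_distribution)"

lemma prob_space_std_normal: "prob_space std_normal_distribution"
  by (rule real_distribution.axioms(1)[OF real_dist_normal_dist])

lemma prob_space_gauss_seq: "prob_space gauss_seq"
  by (rule prob_space_PiM) (rule prob_space_std_normal)

lemma gauss_seq_coordinate_measurable: "(\<lambda>w. w k) \<in> borel_measurable gauss_seq"
proof -
  have "(\<lambda>w. w k) \<in> measurable gauss_seq std_normal_distribution"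
    by (rule measurable_component_singleton) simp
  then show ?thesis by (simp cong: measurable_cong_sets)
qed

lemma distr_gauss_seq: "distr gauss_seq borel (\<lambda>w. w k) = std_normal_distribution"
proof -
  interpret product_prob_space "\<lambda>_. std_normal_distribution" UNIV
    by (intro product_prob_spaceI prob_space_std_normal)
  have "distr gauss_seq borel (\<lambda>w. w k) = distr gauss_seq std_normal_distribution (\<lambda>w. w k)"
    by (intro distr_cong) auto
  then show ?thesis using PiM_component[of k] by simp
qed

lemma gauss_seq_indep: "prob_space.indep_vars gauss_seq (\<lambda>_. borel) (\<lambda>k w. w k) UNIV"
proof -
  interpret prob_space gauss_seq by (rule prob_space_gauss_seq)
  have sets: "sets (PiM UNIV (\<lambda>_::nat. borel :: real measure)) = sets gauss_seq"
    by (intro sets_PiM_cong) auto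
  have "distr gauss_seq (PiM UNIV (\<lambda>_. borel)) (\<lambda>x. \<lambda>i\<in>UNIV. x i) = distr gauss_seq gauss_seq (\<lambda>x. x)"
    by (intro distr_cong sets) auto
  also have "\<dots> = gauss_seq" by (rule distr_id)
  also have "\<dots> = PiM UNIV (\<lambda>i. distr gauss_seq borel (\<lambda>w. w i))"
    by (simp add: distr_gauss_seq)
  finally show ?thesis
    by (subst indep_vars_iff_distr_eq_PiM) (auto intro: gauss_seq_coordinate_measurable)
qed

lemma gauss_seq_distributed: "distributed gauss_seq lborel (\<lambda>w. w k) std_normal_density"
  unfolding distributed_def
proof (intro conjI)
  have "distr gauss_seq lborel (\<lambda>w. w k) = distr gauss_seq borel (\<lambda>w. w k)"
    by (intro distr_cong) auto
  then show "distr gauss_seq lborel (\<lambda>w. w k) = density lborel (\<lambda>x. ennreal (std_normal_density x))"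
    by (simp add: distr_gauss_seq)
  show "(\<lambda>w. w k) \<in> measurable gauss_seq lborel" using gauss_seq_coordinate_measurable by simp
qed simp

lemma gauss_seq_moments:
  "integrable gauss_seq (\<lambda>w. w k * w l)" "(\<integral>w. w k * w l \<partial>gauss_seq) = (if k = l then 1 else 0)"
proof -
  interpret prob_space gauss_seq by (rule prob_space_gauss_seq)
  note D = gauss_seq_distributed
  have int: "integrable gauss_seq (\<lambda>w. (w k) ^ n)" for k n
  proof -
    have "integrable (distr gauss_seq borel (\<lambda>w. w k)) (\<lambda>x. x ^ n)"
      unfolding distr_gauss_seq by (rule integrable_std_normal_distribution_moment)
    then show ?thesis by (subst (asm) integrable_distr_eq) (auto intro: gauss_seq_coordinate_measurable)
  qed
  have int1: "integrable gauss_seq (\<lambda>w. w k)" for k using int[of k 1] by simp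
  have E0: "(\<integral>w. w k \<partial>gauss_seq) = 0" for k
    by (rule standard_normal_distributed_expectation[OF D])
  have E2: "(\<integral>w. (w k)\<^sup>2 \<partial>gauss_seq) = 1" for k
    using standard_normal_distributed_variance[OF D, of k] E0 by simp
  show "integrable gauss_seq (\<lambda>w. w k * w l)"
    by (rule integrable_L2_mult) (auto intro!: L2_realI int gauss_seq_coordinate_measurable)
  show "(\<integral>w. w k * w l \<partial>gauss_seq) = (if k = l then 1 else 0)"
  proof (cases "k = l")
    case True
    then show ?thesis using E2[of k] by (simp add: power2_eq_square)
  next
    case False
    have "indep_vars (\<lambda>_. borel) (\<lambda>k w. w k) {k, l}"
      by (rule indep_vars_subset[OF gauss_seq_indep]) simp
    then have "(\<integral>w. (\<Prod>i\<in>{k, l}. w i) \<partial>gauss_seq) = (\<Prod>i\<in>{k, l}. \<integral>w. w i \<partial>gauss_seq)"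
      by (intro indep_vars_lebesgue_integral int1) auto
    with False E0 show ?thesis by simp
  qed
qed

lemma gauss_seq_linear_combination:
  "centered_normal gauss_seq (\<lambda>w. \<Sum>k<n. d k * w k)"
proof -
  interpret prob_space gauss_seq by (rule prob_space_gauss_seq)
  define I where "I = {k\<in>{..<n}. d k \<noteq> 0}"
  have m: "(\<lambda>w. \<Sum>k<n. d k * w k) \<in> borel_measurable gauss_seq"
    by (intro borel_measurable_sum borel_measurable_times borel_measurable_const gauss_seq_coordinate_measurable)
  have eq: "(\<Sum>k<n. d k * w k) = (\<Sum>k\<in>I. d k * w k)" for w
    unfolding I_def by (intro sum.mono_neutral_right) auto
  show ?thesis
  proof (cases "I = {}")
    case True
    then show ?thesis using m by (simp add: centered_normal_def eq)
  next
    case False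
    have "finite I" by (simp add: I_def)
    have indep: "indep_vars (\<lambda>_. borel) (\<lambda>k w. d k * w k) I"
      by (rule indep_vars_compose2[where X = "\<lambda>k w. w k" and M' = "\<lambda>_. borel"])
        (auto intro: indep_vars_subset[OF gauss_seq_indep])
    have pos: "0 < \<bar>d k\<bar>" if "k \<in> I" for k using that by (simp add: I_def)
    have dist: "distributed gauss_seq lborel (\<lambda>w. d k * w k) (normal_density 0 \<bar>d k\<bar>)" if "k \<in> I" for k
      using normal_density_affine[OF gauss_seq_distributed[of k], of "d k" 0] that by (simp add: I_def)
    have "distributed gauss_seq lborel (\<lambda>w. \<Sum>k\<in>I. d k * w k) (normal_density (\<Sum>k\<in>I. 0) (sqrt (\<Sum>k\<in>I. \<bar>d k\<bar>\<^sup>2)))"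
      by (rule sum_indep_normal[OF \<open>finite I\<close> False indep pos dist])
    moreover have "0 < sqrt (\<Sum>k\<in>I. \<bar>d k\<bar>\<^sup>2)"
      using False \<open>finite I\<close> pos by (auto intro!: sum_pos)
    ultimately show ?thesis using m unfolding centered_normal_def eq by auto
  qed
qed

lemma centered_normal_moments:
  assumes "prob_space M" "centered_normal M Z"
  shows "integrable M (\<lambda>x. (Z x)\<^sup>2)" "(\<integral>x. iexp (Z x) \<partial>M) = complex_of_real (exp (- (\<integral>x. (Z x)\<^sup>2 \<partial>M) / 2))"
proof -
  interpret prob_space M by fact
  have [measurable]: "Z \<in> borel_measurable M" using assms(2) by (simp add: centered_normal_def)
  from assms(2) consider "AE x in M. Z x = 0" | s where "0 < s" "distributed M lborel Z (normal_density 0 s)"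
    by (auto simp: centered_normal_def)
  then have "integrable M (\<lambda>x. (Z x)\<^sup>2) \<and> (\<integral>x. iexp (Z x) \<partial>M) = complex_of_real (exp (- (\<integral>x. (Z x)\<^sup>2 \<partial>M) / 2))"
  proof cases
    case 1
    have 2: "AE x in M. (Z x)\<^sup>2 = 0" and 3: "AE x in M. iexp (Z x) = 1" using 1 by auto
    have "integrable M (\<lambda>x. (Z x)\<^sup>2) \<longleftrightarrow> integrable M (\<lambda>x. 0 :: real)"
      by (rule integrable_cong_AE) (use 2 in auto)
    moreover have "(\<integral>x. (Z x)\<^sup>2 \<partial>M) = (\<integral>x. 0 \<partial>M)" by (rule integral_cong_AE) (use 2 in auto)
    moreover have "(\<integral>x. iexp (Z x) \<partial>M) = (\<integral>x. 1 \<partial>M)" by (rule integral_cong_AE) (use 3 in auto)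
    ultimately show ?thesis by (simp add: prob_space)
  next
    case (2 s)
    define W where "W x = Z x / s" for x
    have [measurable]: "W \<in> borel_measurable M" unfolding W_def[abs_def] by measurable
    have Z: "Z x = s * W x" for x using 2(1) by (simp add: W_def)
    have D: "distributed M lborel W std_normal_density"
      using 2(2) unfolding normal_standard_normal_convert[OF 2(1), of Z 0] W_def[abs_def] by simp
    have "distr M borel W = distr M lborel W" by (intro distr_cong) auto
    then have dW: "distr M borel W = std_normal_distribution" using D by (simp add: distributed_def)
    have "integrable (distr M borel W) (\<lambda>x. x\<^sup>2)"
      unfolding dW by (rule integrable_std_normal_distribution_moment)
    then have int: "integrable M (\<lambda>x. (W x)\<^sup>2)" by (subst (asm) integrable_distr_eq) auto
    have "(\<integral>x. (W x)\<^sup>2 \<partial>M) = 1"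
      using standard_normal_distributed_variance[OF D] standard_normal_distributed_expectation[OF D] by simp
    then have EZ: "(\<integral>x. (Z x)\<^sup>2 \<partial>M) = s\<^sup>2" by (simp add: Z power_mult_distrib)
    have "(\<integral>x. iexp (Z x) \<partial>M) = (\<integral>y. iexp (s * y) \<partial>distr M borel W)"
      unfolding Z by (subst integral_distr) auto
    also have "\<dots> = char std_normal_distribution s" unfolding dW char_def ..
    also have "\<dots> = complex_of_real (exp (- (s\<^sup>2) / 2))" by (simp add: char_std_normal_distribution)
    finally show ?thesis using int by (simp add: EZ) (simp add: Z power_mult_distrib)
  qed
  then show "integrable M (\<lambda>x. (Z x)\<^sup>2)" "(\<integral>x. iexp (Z x) \<partial>M) = complex_of_real (exp (- (\<integral>x. (Z x)\<^sup>2 \<partial>M) / 2))"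
    by auto
qed

text \<open>Lets one compute with random variables on another space that represent a functional only almost everywhere.\<close>

lemma centered_normal_distr:
  assumes Y: "Y \<in> measurable M N" and Z: "Z \<in> borel_measurable N"
    and V: "centered_normal M V" and ae: "AE w in M. Z (Y w) = V w"
  shows "centered_normal (distr M N Y) Z"
proof -
  have [measurable]: "V \<in> borel_measurable M" using V by (simp add: centered_normal_def)
  note [measurable] = Y Z
  have "(AE x in distr M N Y. Z x = 0) \<longleftrightarrow> (AE w in M. V w = 0)"
  proof -
    have "(AE x in distr M N Y. Z x = 0) \<longleftrightarrow> (AE w in M. Z (Y w) = 0)"
      by (rule AE_distr_iff[OF Y]) measurable
    also have "\<dots> \<longleftrightarrow> (AE w in M. V w = 0)"
      using ae by (intro iffI) (auto elim: AE_mp)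
    finally show ?thesis .
  qed
  moreover have "distributed (distr M N Y) lborel Z f \<longleftrightarrow> distributed M lborel V f" for f
  proof -
    have "distr (distr M N Y) lborel Z = distr M lborel (Z \<circ> Y)"
      by (rule distr_distr) auto
    also have "\<dots> = distr M lborel V"
      by (rule distr_cong_AE) (use ae in auto)
    finally show ?thesis by (simp add: distributed_def)
  qed
  ultimately show ?thesis using V Z by (simp add: centered_normal_def)
qed

context onb
begin

lemma norm_sum_basis:
  "(norm (\<Sum>i=m..<n. a i *\<^sub>R e (Suc i)))\<^sup>2 = (\<Sum>i=m..<n. (a i)\<^sup>2)"
proof -
  have "(norm (\<Sum>i=m..<n. a i *\<^sub>R e (Suc i)))\<^sup>2 = (\<Sum>i=m..<n. \<Sum>j=m..<n. a i * (a j * (e (Suc j) \<bullet> e (Suc i))))"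
    by (simp add: power2_norm_eq_inner inner_sum_left inner_sum_right sum_distrib_left)
  also have "\<dots> = (\<Sum>i=m..<n. \<Sum>j=m..<n. if j = i then a i * a i else 0)"
    by (intro sum.cong refl) (auto simp: inner_basis)
  also have "\<dots> = (\<Sum>i=m..<n. (a i)\<^sup>2)"
    by (intro sum.cong refl, subst sum.delta) (auto simp: power2_eq_square)
  finally show ?thesis .
qed

lemma summable_basis_expansion:
  assumes "summable (\<lambda>i. (a i)\<^sup>2)"
  shows "summable (\<lambda>i. a i *\<^sub>R e (Suc i))"
  unfolding summable_Cauchy
proof (intro allI impI)
  fix r :: real assume r: "0 < r"
  then have "0 < r\<^sup>2" by simp
  with assms obtain N where N: "\<And>m n. N \<le> m \<Longrightarrow> norm (\<Sum>i=m..<n. (a i)\<^sup>2) < r\<^sup>2"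
    unfolding summable_Cauchy by blast
  have "norm (\<Sum>i=m..<n. a i *\<^sub>R e (Suc i)) < r" if "N \<le> m" for m n
  proof (rule power2_less_imp_less)
    show "(norm (\<Sum>i=m..<n. a i *\<^sub>R e (Suc i)))\<^sup>2 < r\<^sup>2"
      unfolding norm_sum_basis using N[OF that, of n] by simp
  qed (use r in simp)
  then show "\<exists>N. \<forall>m\<ge>N. \<forall>n. norm (\<Sum>i=m..<n. a i *\<^sub>R e (Suc i)) < r" by blast
qed

lemma inner_basis_expansion:
  assumes "summable (\<lambda>i. (a i)\<^sup>2)"
  shows "(\<Sum>i. a i *\<^sub>R e (Suc i)) \<bullet> e (Suc j) = a j"
proof -
  have "(\<lambda>i. (a i *\<^sub>R e (Suc i)) \<bullet> e (Suc j)) sums ((\<Sum>i. a i *\<^sub>R e (Suc i)) \<bullet> e (Suc j))"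
    by (intro bounded_linear.sums[OF bounded_linear_inner_left] summable_sums summable_basis_expansion assms)
  moreover have "(\<lambda>i. (a i *\<^sub>R e (Suc i)) \<bullet> e (Suc j)) = (\<lambda>i. if i = j then a i else 0)"
    by (auto simp: inner_basis)
  ultimately have "(\<lambda>i. if i = j then a i else 0) sums ((\<Sum>i. a i *\<^sub>R e (Suc i)) \<bullet> e (Suc j))" by simp
  then show ?thesis using sums_single[of j a] sums_unique2 by blast
qed

text \<open>Parseval's identity under the integral sign.\<close>

lemma integral_tail:
  fixes Y :: "'w \<Rightarrow> 'h"
  assumes Y: "Y \<in> borel_measurable M"
    and int: "\<And>i. integrable M (\<lambda>w. (Y w \<bullet> e (Suc i))\<^sup>2)"
    and sum: "summable (\<lambda>i. \<integral>w. (Y w \<bullet> e (Suc i))\<^sup>2 \<partial>M)"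
  shows "integrable M (\<lambda>w. (norm (Y w - proj e m (Y w)))\<^sup>2)"
    "(\<integral>w. (norm (Y w - proj e m (Y w)))\<^sup>2 \<partial>M) = (\<Sum>i. \<integral>w. (Y w \<bullet> e (Suc (i + m)))\<^sup>2 \<partial>M)"
proof -
  have eq: "(norm (y - proj e m y))\<^sup>2 = (\<Sum>i. (y \<bullet> e (Suc (i + m)))\<^sup>2)" for y
    using tail_sums[of y m] by (simp add: sums_iff)
  have ae: "AE w in M. summable (\<lambda>i. norm ((Y w \<bullet> e (Suc (i + m)))\<^sup>2))"
    using tail_sums[of _ m] by (auto simp: sums_iff)
  have sm: "summable (\<lambda>i. \<integral>w. norm ((Y w \<bullet> e (Suc (i + m)))\<^sup>2) \<partial>M)"
    using summable_ignore_initial_segment[OF sum, of m] by simp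
  show "integrable M (\<lambda>w. (norm (Y w - proj e m (Y w)))\<^sup>2)"
    unfolding eq by (rule integrable_suminf[OF int ae sm])
  show "(\<integral>w. (norm (Y w - proj e m (Y w)))\<^sup>2 \<partial>M) = (\<Sum>i. \<integral>w. (Y w \<bullet> e (Suc (i + m)))\<^sup>2 \<partial>M)"
    unfolding eq by (rule integral_suminf[OF int ae sm])
qed

text \<open>With the triangular factor \<open>c\<close> of the matrix, the variables \<open>V i = (\<Sum>k\<le>i. c i k * w k)\<close> of independent standard normal \<open>w k\<close>
have the required covariances. As the trace is finite, the sum of the \<open>(V i)\<^sup>2\<close> is almost surely finite, so the \<open>V i\<close> are the
coordinates of a random element of the Hilbert space; its law is the one wanted. The factorisation is indexed from
zero, the basis from one.\<close>

theorem normal_law_exists: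
  assumes sym: "symmetric_matrix \<sigma>" and nn: "nonneg_definite \<sigma>"
    and trace: "summable (\<lambda>i. \<sigma> (Suc i) (Suc i))"
  obtains \<nu> where "is_normal_law e \<sigma> \<nu>"
proof -
  interpret prob_space gauss_seq by (rule prob_space_gauss_seq)
  note [measurable] = gauss_seq_coordinate_measurable
  define A where "A i j = \<sigma> (Suc i) (Suc j)" for i j
  have "psd A"
    unfolding psd_def
  proof (intro conjI allI)
    show "A i j = A j i" for i j using sym by (simp add: symmetric_matrix_def A_def)
    fix n and r :: "nat \<Rightarrow> real"
    show "0 \<le> (\<Sum>i<n. \<Sum>j<n. r i * r j * A i j)"
    proof (cases "n = 0")
      case False
      then have "0 \<le> (\<Sum>i=1..n. \<Sum>j=1..n. r (i - 1) * r (j - 1) * \<sigma> i j)"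
        using nn[unfolded nonneg_definite_def, rule_format, of n "\<lambda>i. r (i - 1)"] by simp
      then show ?thesis by (simp add: sum.atLeast1_atMost_eq A_def)
    qed simp
  qed
  from triangular_factorisation[OF this]
  obtain c where c: "\<And>i j n. i < n \<Longrightarrow> A i j = (\<Sum>k<n. c i k * c j k)" by blast
  have c0: "c i k = 0" if "i < k" for i k
  proof -
    have "(\<Sum>l<Suc k. c i l * c i l) = (\<Sum>l<k. c i l * c i l)"
      using c[of i "Suc k" i] c[of i k i] that by simp
    then show ?thesis by simp
  qed
  define V where "V i w = (\<Sum>k<Suc i. c i k * w k)" for i and w :: "nat \<Rightarrow> real"
  have V_eq: "V i w = (\<Sum>k<n. c i k * w k)" if "i < n" for i n w
    unfolding V_def by (intro sum.mono_neutral_left) (use that c0 in auto)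
  have [measurable]: "V i \<in> borel_measurable gauss_seq" for i
    unfolding V_def[abs_def]
    by (intro borel_measurable_sum borel_measurable_times borel_measurable_const gauss_seq_coordinate_measurable)
  have VV: "integrable gauss_seq (\<lambda>w. V i w * V j w)" "(\<integral>w. V i w * V j w \<partial>gauss_seq) = A i j" for i j
  proof -
    define n where "n = Suc (max i j)"
    have ij: "i < n" "j < n" by (auto simp: n_def)
    have eq: "V i w * V j w = (\<Sum>k<n. \<Sum>l<n. c i k * c j l * (w k * w l))" for w
      unfolding V_eq[OF ij(1)] V_eq[OF ij(2)] sum_product by (intro sum.cong refl) (simp add: mult_ac)
    show "integrable gauss_seq (\<lambda>w. V i w * V j w)"
      unfolding eq by (intro Bochner_Integration.integrable_sum integrable_mult_right gauss_seq_moments)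
    have "(\<integral>w. V i w * V j w \<partial>gauss_seq) = (\<Sum>k<n. \<Sum>l<n. c i k * c j l * (if k = l then 1 else 0))"
      unfolding eq gauss_seq_moments(2)[symmetric]
      by (simp add: Bochner_Integration.integral_sum gauss_seq_moments(1))
    also have "\<dots> = (\<Sum>k<n. c i k * c j k)" by (simp add: if_distrib cong: if_cong)
    also have "\<dots> = A i j" using c[OF ij(1), of j] by simp
    finally show "(\<integral>w. V i w * V j w \<partial>gauss_seq) = A i j" .
  qed
  have V2: "integrable gauss_seq (\<lambda>w. (V i w)\<^sup>2)" "(\<integral>w. (V i w)\<^sup>2 \<partial>gauss_seq) = A i i" for i
    using VV[of i i] by (simp_all add: power2_eq_square)
  have ae: "AE w in gauss_seq. summable (\<lambda>i. (V i w)\<^sup>2)"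
  proof -
    have "(\<integral>\<^sup>+w. (\<Sum>i. ennreal ((V i w)\<^sup>2)) \<partial>gauss_seq) = (\<Sum>i. \<integral>\<^sup>+w. ennreal ((V i w)\<^sup>2) \<partial>gauss_seq)"
      by (rule nn_integral_suminf) measurable
    also have "\<dots> = (\<Sum>i. ennreal (A i i))"
      using V2 by (simp add: nn_integral_eq_integral)
    also have "\<dots> \<noteq> \<infinity>"
      using trace psd_diag_nonneg[OF \<open>psd A\<close>] unfolding A_def[symmetric]
      by (simp add: ennreal_suminf_neq_top)
    finally have "AE w in gauss_seq. (\<Sum>i. ennreal ((V i w)\<^sup>2)) \<noteq> \<infinity>"
      by (intro nn_integral_PInf_AE) auto
    then show ?thesis
      by (rule AE_mp) (auto intro!: AE_I2 summable_suminf_not_top)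
  qed
  define Y where "Y w = (\<Sum>i. V i w *\<^sub>R e (Suc i))" for w
  have Y[measurable]: "Y \<in> borel_measurable gauss_seq" unfolding Y_def[abs_def] by measurable
  have Ye: "AE w in gauss_seq. \<forall>j. Y w \<bullet> e (Suc j) = V j w"
    using ae by eventually_elim (simp add: Y_def inner_basis_expansion)
  define \<nu> where "\<nu> = distr gauss_seq borel Y"
  have "is_normal_law e \<sigma> \<nu>"
    unfolding is_normal_law_def
  proof (intro conjI allI impI)
    show "prob_space \<nu>" unfolding \<nu>_def by (rule prob_space_distr) measurable
    show "sets \<nu> = sets borel" by (simp add: \<nu>_def)
    fix m and r :: "nat \<Rightarrow> real"
    define d where "d k = (\<Sum>i<m. r (Suc i) * c i k)" for k
    have lin: "(\<Sum>i<m. r (Suc i) * V i w) = (\<Sum>k<m. d k * w k)" for w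
    proof -
      have "(\<Sum>i<m. r (Suc i) * V i w) = (\<Sum>i<m. \<Sum>k<m. r (Suc i) * c i k * w k)"
        by (intro sum.cong refl) (simp add: V_eq[of _ m] sum_distrib_left mult.assoc)
      also have "\<dots> = (\<Sum>k<m. d k * w k)"
        unfolding d_def sum_distrib_right by (rule sum.swap)
      finally show ?thesis .
    qed
    show "centered_normal \<nu> (\<lambda>y. \<Sum>i=1..m. r i * (y \<bullet> e i))"
      unfolding \<nu>_def
    proof (rule centered_normal_distr[OF Y _ gauss_seq_linear_combination[of d m]])
      show "AE w in gauss_seq. (\<Sum>i=1..m. r i * (Y w \<bullet> e i)) = (\<Sum>k<m. d k * w k)"
        using Ye by eventually_elim (simp add: sum.atLeast1_atMost_eq lin)
    qed measurable
  next
    fix i j :: nat assume "1 \<le> i" "1 \<le> j"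
    then obtain i' j' where ij: "i = Suc i'" "j = Suc j'" by (auto simp: Suc_le_eq gr0_conv_Suc)
    have "(\<integral>y. (y \<bullet> e i) * (y \<bullet> e j) \<partial>\<nu>) = (\<integral>w. (Y w \<bullet> e i) * (Y w \<bullet> e j) \<partial>gauss_seq)"
      unfolding \<nu>_def by (rule integral_distr) measurable
    also have "\<dots> = (\<integral>w. V i' w * V j' w \<partial>gauss_seq)"
      by (rule integral_cong_AE) (use Ye in \<open>auto simp: ij\<close>)
    also have "\<dots> = \<sigma> i j" unfolding VV(2) A_def ij ..
    finally show "(\<integral>y. (y \<bullet> e i) * (y \<bullet> e j) \<partial>\<nu>) = \<sigma> i j" .
  qed
  then show ?thesis by (rule that)
qed

end

section \<open>The central limit theorem in Hilbert space\<close>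

text \<open>Dominated convergence and Levy's theorem are about sequences; this carries their conclusions over to the limit along
rectangles.\<close>

lemma tendsto_min_at_top_sequentially:
  fixes F :: "nat ^ 'd \<Rightarrow> 'a::metric_space"
  assumes seq: "\<And>Ls. (\<And>n v. n < Ls n $ v) \<Longrightarrow> (\<lambda>n. F (Ls n)) \<longlonglongrightarrow> l"
  shows "(F \<longlongrightarrow> l) min_at_top"
proof (rule tendstoI, rule ccontr)
  fix r :: real assume r: "0 < r" and "\<not> eventually (\<lambda>L. dist (F L) l < r) min_at_top"
  then have "\<forall>n. \<exists>L. (\<forall>v. Suc n \<le> L $ v) \<and> \<not> dist (F L) l < r"
    unfolding eventually_min_at_top by blast
  then obtain Ls where Ls: "\<And>n. (\<forall>v. Suc n \<le> Ls n $ v) \<and> \<not> dist (F (Ls n)) l < r" by metis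
  have "(\<lambda>n. F (Ls n)) \<longlonglongrightarrow> l" by (rule seq) (use Ls in \<open>auto simp: Suc_le_eq\<close>)
  then have "eventually (\<lambda>n. dist (F (Ls n)) l < r) sequentially" using r by (rule tendstoD)
  then show False using Ls by (auto simp: eventually_sequentially)
qed

lemma filterlim_min_at_top:
  fixes Ls :: "nat \<Rightarrow> nat ^ 'd"
  assumes "\<And>n v. n < Ls n $ v"
  shows "filterlim Ls min_at_top sequentially"
  unfolding filterlim_iff eventually_min_at_top eventually_sequentially
proof (intro allI impI)
  fix P :: "nat ^ 'd \<Rightarrow> bool" assume "\<exists>N. \<forall>L. (\<forall>v. N \<le> L $ v) \<longrightarrow> P L"
  then obtain N where N: "\<And>L. (\<forall>v. N \<le> L $ v) \<Longrightarrow> P L" by blast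
  have "P (Ls n)" if "N \<le> n" for n
    by (rule N) (use assms[of n] that in \<open>auto intro: less_imp_le order_trans\<close>)
  then show "\<exists>N. \<forall>n\<ge>N. P (Ls n)" by blast
qed

locale hilbert_field = mixing_field M X + onb e
  for M :: "'w measure"
    and X :: "int ^ 'd \<Rightarrow> 'w \<Rightarrow> 'h::{real_inner, banach, second_countable_topology}"
    and e :: "nat \<Rightarrow> 'h" +
  assumes mean0: "(\<integral>w. X 0 w \<partial>M) = 0"
    and square_integrable: "integrable M (\<lambda>w. (norm (X 0 w))\<^sup>2)"
begin

lemma integrable_X0: "integrable M (X 0)"
proof -
  have "(\<lambda>w. norm (X 0 w)) \<in> L2_real M M"
    using square_integrable by (intro L2_realI) auto
  from L2_real_integrable[OF this] show ?thesis
    by (rule Bochner_Integration.integrable_bound) auto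
qed

lemma centred_inner: "centred (\<lambda>x. x \<bullet> h)"
  unfolding centred_def
proof (intro conjI)
  show "(\<lambda>w. X 0 w \<bullet> h) \<in> L2_real M M"
  proof (rule L2_realI)
    have "(X 0 w \<bullet> h)\<^sup>2 \<le> (norm (X 0 w))\<^sup>2 * (norm h)\<^sup>2" for w
      using Cauchy_Schwarz_ineq[of "X 0 w" h] by (simp add: power2_norm_eq_inner)
    then show "integrable M (\<lambda>w. (X 0 w \<bullet> h)\<^sup>2)"
      by (intro Bochner_Integration.integrable_bound[OF integrable_mult_left[OF square_integrable, of "(norm h)\<^sup>2"]]) auto
  qed measurable
  show "(\<integral>w. X 0 w \<bullet> h \<partial>M) = 0"
    using integral_inner_left[OF _, of h M "X 0"] integrable_X0 mean0 by (cases "h = 0") auto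
qed measurable

abbreviation var_inner :: "'h \<Rightarrow> nat ^ 'd \<Rightarrow> real" where
  "var_inner h \<equiv> var_rect (\<lambda>x. x \<bullet> h)"

lemma psum_inner: "psum (\<lambda>x. x \<bullet> h) (rect L) w = rect_sum X L w \<bullet> h"
  by (simp add: psum_def rect_sum_def inner_sum_left)

lemma rect_sum_measurable [measurable]: "rect_sum X L \<in> borel_measurable M"
  unfolding rect_sum_def[abs_def] by measurable

lemma L2_rect_sum: "(\<lambda>w. rect_sum X L w \<bullet> h) \<in> L2_real M M"
  using psum_L2[OF centred_inner, of h "rect L"] by (simp add: psum_inner[abs_def])

text \<open>The quadratic form of the limit covariance: the asymptotic variance of the functional \<open>x \<bullet> h\<close>.\<close>

definition qform :: "'h \<Rightarrow> real" where
  "qform h = Lim min_at_top (\<lambda>L. var_inner h L / vol L)"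

lemma var_inner_tendsto: "((\<lambda>L. var_inner h L / vol L) \<longlongrightarrow> qform h) min_at_top"
  and qform_nonneg: "0 \<le> qform h"
proof -
  obtain s where s: "0 \<le> s" "((\<lambda>L. var_inner h L / vol L) \<longlongrightarrow> s) min_at_top"
    by (rule var_rect_tendsto[OF centred_inner])
  then have "qform h = s" unfolding qform_def by (intro tendsto_Lim min_at_top_neq_bot)
  with s show "((\<lambda>L. var_inner h L / vol L) \<longlongrightarrow> qform h) min_at_top" "0 \<le> qform h" by simp_all
qed

lemma norm_var_eq: "norm_var M X e i = (\<lambda>L. var_inner (e i) L / vol L)"
  by (rule ext) (simp add: norm_var_def var_rect_def coord_sum_def psum_def)

lemma norm_var_diff_eq: "norm_var_diff M X e i j = (\<lambda>L. var_inner (e i - e j) L / vol L)"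
  by (rule ext) (simp add: norm_var_diff_def var_rect_def coord_sum_def psum_def inner_diff_right sum_subtractf)

text \<open>The two cases in the definition of the matrix agree: on the diagonal the last term is \<open>qform 0 = 0\<close>. So the matrix is
obtained from \<open>qform\<close> by polarisation.\<close>

lemma Sigma_lim_eq: "Sigma_lim M X e i j = (qform (e i) + qform (e j) - qform (e i - e j)) / 2"
proof -
  have "var_inner 0 L = 0" for L by (simp add: var_rect_def psum_def)
  then have eq: "(\<lambda>L. var_inner 0 L / vol L) = (\<lambda>_. 0)" by (simp only: div_0)
  have "qform 0 = 0"
    by (rule tendsto_unique[OF min_at_top_neq_bot var_inner_tendsto[of 0, unfolded eq] tendsto_const])
  then show ?thesis
    by (simp add: Sigma_lim_def norm_var_eq norm_var_diff_eq qform_def)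
qed

lemma cov_tendsto:
  "((\<lambda>L. (\<integral>w. (rect_sum X L w \<bullet> e i) * (rect_sum X L w \<bullet> e j) \<partial>M) / vol L) \<longlongrightarrow> Sigma_lim M X e i j) min_at_top"
proof -
  have "(\<integral>w. (rect_sum X L w \<bullet> e i) * (rect_sum X L w \<bullet> e j) \<partial>M) / vol L
      = (var_inner (e i) L / vol L + var_inner (e j) L / vol L - var_inner (e i - e j) L / vol L) / 2" for L
  proof -
    have "var_inner (e i - e j) L = (\<integral>w. (rect_sum X L w \<bullet> e i + (-1) * (rect_sum X L w \<bullet> e j))\<^sup>2 \<partial>M)"
      unfolding var_rect_def psum_inner by (simp add: inner_diff_right)
    also have "\<dots> = var_inner (e i) L + var_inner (e j) L - 2 * (\<integral>w. (rect_sum X L w \<bullet> e i) * (rect_sum X L w \<bullet> e j) \<partial>M)"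
      unfolding l2norm_add_power2[OF L2_rect_sum L2_real_cmult[OF L2_rect_sum]]
      by (simp add: var_rect_def psum_inner)
    finally show ?thesis by (simp add: diff_divide_distrib add_divide_distrib)
  qed
  then show ?thesis
    unfolding Sigma_lim_eq by (simp only:) (intro tendsto_intros var_inner_tendsto, simp)
qed

lemma qform_linear_combination:
  "qform (\<Sum>i=1..m. r i *\<^sub>R e i) = (\<Sum>i=1..m. \<Sum>j=1..m. r i * r j * Sigma_lim M X e i j)"
proof -
  let ?u = "\<Sum>i=1..m. r i *\<^sub>R e i"
  have "var_inner ?u L / vol L = (\<Sum>i=1..m. \<Sum>j=1..m. r i * r j *
      ((\<integral>w. (rect_sum X L w \<bullet> e i) * (rect_sum X L w \<bullet> e j) \<partial>M) / vol L))" for L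
  proof -
    have "var_inner ?u L = (\<integral>w. (\<Sum>i=1..m. \<Sum>j=1..m. r i * r j * ((rect_sum X L w \<bullet> e i) * (rect_sum X L w \<bullet> e j))) \<partial>M)"
      unfolding var_rect_def psum_inner unfolding inner_sum_right power2_eq_square sum_product
      by (intro Bochner_Integration.integral_cong sum.cong refl) (simp add: mult_ac)
    also have "\<dots> = (\<Sum>i=1..m. \<Sum>j=1..m. r i * r j * (\<integral>w. (rect_sum X L w \<bullet> e i) * (rect_sum X L w \<bullet> e j) \<partial>M))"
      by (simp add: Bochner_Integration.integral_sum integrable_L2_mult L2_rect_sum)
    finally show ?thesis by (simp add: sum_divide_distrib)
  qed
  then have "((\<lambda>L. var_inner ?u L / vol L) \<longlongrightarrow> (\<Sum>i=1..m. \<Sum>j=1..m. r i * r j * Sigma_lim M X e i j)) min_at_top"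
    by (simp only:) (intro tendsto_sum tendsto_mult tendsto_const cov_tendsto)
  then show ?thesis by (rule tendsto_unique[OF min_at_top_neq_bot var_inner_tendsto])
qed

text \<open>A summable bound for the variances of the coordinates of all normalised sums at once.\<close>

definition coord_var :: "nat \<Rightarrow> real" where
  "coord_var i = var_const * variance0 (\<lambda>x. x \<bullet> e (Suc i))"


lemma summable_coord_var: "summable coord_var"
proof -
  have "summable (\<lambda>i. variance0 (\<lambda>x. x \<bullet> e (Suc i)))"
  proof (rule summableI_nonneg_bounded)
    fix n
    have "(\<Sum>i<n. variance0 (\<lambda>x. x \<bullet> e (Suc i))) = (\<integral>w. (\<Sum>i<n. (X 0 w \<bullet> e (Suc i))\<^sup>2) \<partial>M)"
      unfolding variance0_def using L2_realD(2)[OF centredD(2)[OF centred_inner]]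
      by (simp add: Bochner_Integration.integral_sum)
    also have "\<dots> \<le> (\<integral>w. (norm (X 0 w))\<^sup>2 \<partial>M)"
    proof (rule integral_mono)
      show "integrable M (\<lambda>w. \<Sum>i<n. (X 0 w \<bullet> e (Suc i))\<^sup>2)"
        using L2_realD(2)[OF centredD(2)[OF centred_inner]] by simp
      fix w
      have "(\<Sum>i<n. (X 0 w \<bullet> e (Suc i))\<^sup>2) = (norm (proj e n (X 0 w)))\<^sup>2"
        unfolding norm_proj by (simp add: sum.atLeast1_atMost_eq)
      also have "\<dots> \<le> (norm (X 0 w))\<^sup>2" by (intro power_mono norm_proj_le) simp
      finally show "(\<Sum>i<n. (X 0 w \<bullet> e (Suc i))\<^sup>2) \<le> (norm (X 0 w))\<^sup>2" .
    qed (rule square_integrable)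
    finally show "(\<Sum>i<n. variance0 (\<lambda>x. x \<bullet> e (Suc i))) \<le> (\<integral>w. (norm (X 0 w))\<^sup>2 \<partial>M)" .
  qed simp
  then show ?thesis unfolding coord_var_def[abs_def] by (rule summable_mult)
qed

lemma var_inner_le_coord_var: "(\<And>v. 1 \<le> L $ v) \<Longrightarrow> var_inner (e (Suc i)) L / vol L \<le> coord_var i"
  using var_rect_le[OF centred_inner, of "e (Suc i)" L] vol_pos[of L]
  by (simp add: coord_var_def pos_divide_le_eq mult_ac)

lemma Sigma_lim_diag: "Sigma_lim M X e i i = qform (e i)"
  by (simp add: Sigma_lim_def norm_var_eq qform_def)

lemma Sigma_lim_le_coord_var: "Sigma_lim M X e (Suc i) (Suc i) \<le> coord_var i"
  unfolding Sigma_lim_diag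
proof (rule tendsto_upperbound[OF var_inner_tendsto _ min_at_top_neq_bot])
  show "eventually (\<lambda>L. var_inner (e (Suc i)) L / vol L \<le> coord_var i) min_at_top"
    unfolding eventually_min_at_top by (intro exI[of _ 1] allI impI var_inner_le_coord_var) auto
qed

lemma summable_Sigma_lim: "summable (\<lambda>i. Sigma_lim M X e (Suc i) (Suc i))"
  by (rule summable_comparison_test'[OF summable_coord_var, of 0])
    (use Sigma_lim_le_coord_var in \<open>simp add: Sigma_lim_diag qform_nonneg\<close>)

lemma symmetric_Sigma_lim: "symmetric_matrix (Sigma_lim M X e)"
proof -
  have "var_inner (- h) L = var_inner h L" for h L unfolding var_rect_def psum_inner by simp
  then have "qform (- h) = qform h" for h by (simp add: qform_def)
  from this[of "e j - e i" for i j] show ?thesis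
    by (simp add: symmetric_matrix_def Sigma_lim_eq)
qed

lemma nonneg_definite_Sigma_lim: "nonneg_definite (Sigma_lim M X e)"
  unfolding nonneg_definite_def qform_linear_combination[symmetric] using qform_nonneg by blast

lemma finite_trace_Sigma_lim: "finite_trace (Sigma_lim M X e)"
proof -
  have "(\<lambda>i. Sigma_lim M X e (Suc i) (Suc i)) summable_on UNIV"
    by (rule summable_nonneg_imp_summable_on[OF summable_Sigma_lim])
      (simp add: Sigma_lim_diag qform_nonneg)
  then have "(\<lambda>i. Sigma_lim M X e i i) summable_on (Suc ` UNIV)"
    by (subst summable_on_reindex) (auto simp: o_def)
  moreover have "Suc ` UNIV = {1..}" by (auto simp: image_iff Suc_le_eq gr0_conv_Suc)
  ultimately show ?thesis by (simp add: finite_trace_def)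
qed

abbreviation normalised :: "nat ^ 'd \<Rightarrow> 'w \<Rightarrow> 'h" where
  "normalised L w \<equiv> rect_sum X L w /\<^sub>R sqrt (vol L)"

text \<open>The tails of the normalised sums are small uniformly in the rectangle; this is the tightness of their laws.\<close>

lemma normalised_moments:
  assumes L: "\<And>v. 1 \<le> L $ v"
  shows "integrable M (\<lambda>w. (norm (normalised L w - proj e m (normalised L w)))\<^sup>2)"
    "(\<integral>w. (norm (normalised L w - proj e m (normalised L w)))\<^sup>2 \<partial>M) \<le> (\<Sum>i. coord_var (i + m))"
proof -
  have ZL: "normalised L \<in> borel_measurable M" by measurable
  have sq: "(normalised L w \<bullet> h)\<^sup>2 = (rect_sum X L w \<bullet> h)\<^sup>2 / vol L" for w h
    by (simp add: power_mult_distrib divide_inverse power_inverse mult.commute)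
  have int: "integrable M (\<lambda>w. (normalised L w \<bullet> e (Suc i))\<^sup>2)" for i
    unfolding sq using L2_realD(2)[OF L2_rect_sum] by simp
  have E: "(\<integral>w. (normalised L w \<bullet> e (Suc i))\<^sup>2 \<partial>M) = var_inner (e (Suc i)) L / vol L" for i
    unfolding sq by (simp add: var_rect_def psum_inner)
  have sm: "summable (\<lambda>i. \<integral>w. (normalised L w \<bullet> e (Suc i))\<^sup>2 \<partial>M)"
    unfolding E
    by (rule summable_comparison_test'[OF summable_coord_var, of 0])
      (use var_inner_le_coord_var[OF L] in \<open>simp add: abs_of_nonneg\<close>)
  show "integrable M (\<lambda>w. (norm (normalised L w - proj e m (normalised L w)))\<^sup>2)"
    by (rule integral_tail(1)[OF ZL int sm])
  have "(\<integral>w. (norm (normalised L w - proj e m (normalised L w)))\<^sup>2 \<partial>M) = (\<Sum>i. var_inner (e (Suc (i + m))) L / vol L)"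
    unfolding integral_tail(2)[OF ZL int sm] E ..
  also have "\<dots> \<le> (\<Sum>i. coord_var (i + m))"
    using summable_ignore_initial_segment[OF sm, of m] summable_ignore_initial_segment[OF summable_coord_var, of m]
    unfolding E by (intro suminf_le var_inner_le_coord_var L)
  finally show "(\<integral>w. (norm (normalised L w - proj e m (normalised L w)))\<^sup>2 \<partial>M) \<le> (\<Sum>i. coord_var (i + m))" .
qed

lemma normal_law_props:
  assumes \<nu>: "is_normal_law e (Sigma_lim M X e) \<nu>"
  shows "integrable \<nu> (\<lambda>y. (norm (y - proj e m y))\<^sup>2)"
    "(\<integral>y. (norm (y - proj e m y))\<^sup>2 \<partial>\<nu>) \<le> (\<Sum>i. coord_var (i + m))"
    "u \<in> span (e ` {1..}) \<Longrightarrow> (\<integral>y. iexp (u \<bullet> y) \<partial>\<nu>) = complex_of_real (exp (- qform u / 2))"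
proof -
  interpret N: prob_space \<nu> using \<nu> by (simp add: is_normal_law_def)
  have [measurable_cong]: "sets \<nu> = sets borel" using \<nu> by (simp add: is_normal_law_def)
  have normal: "centered_normal \<nu> (\<lambda>y. \<Sum>i=1..m. r i * (y \<bullet> e i))" if "1 \<le> m" for m r
    using \<nu> that by (simp add: is_normal_law_def)
  have cov: "(\<integral>y. (y \<bullet> e i) * (y \<bullet> e j) \<partial>\<nu>) = Sigma_lim M X e i j" if "1 \<le> i" "1 \<le> j" for i j
    using \<nu> that by (simp add: is_normal_law_def)
  have int1: "integrable \<nu> (\<lambda>y. (y \<bullet> e i)\<^sup>2)" if i: "1 \<le> i" for i
  proof -
    have "(\<Sum>k=1..i. (if k = i then 1 else 0) * (y \<bullet> e k)) = y \<bullet> e i" for y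
    proof -
      have "(\<Sum>k=1..i. (if k = i then 1 else 0) * (y \<bullet> e k)) = (\<Sum>k=1..i. if k = i then y \<bullet> e i else 0)"
        by (intro sum.cong) auto
      then show ?thesis using i by simp
    qed
    then have "centered_normal \<nu> (\<lambda>y. y \<bullet> e i)" using normal[OF i, of "\<lambda>k. if k = i then 1 else 0"] by simp
    then show ?thesis by (rule centered_normal_moments(1)[OF N.prob_space_axioms])
  qed
  have L2: "(\<lambda>y. y \<bullet> e i) \<in> L2_real \<nu> \<nu>" if "1 \<le> i" for i
    by (rule L2_realI[OF _ int1[OF that]]) measurable
  have id: "(\<lambda>y. y) \<in> borel_measurable \<nu>" by measurable
  have E: "(\<integral>y. (y \<bullet> e (Suc i))\<^sup>2 \<partial>\<nu>) = Sigma_lim M X e (Suc i) (Suc i)" for i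
    using cov[of "Suc i" "Suc i"] by (simp add: power2_eq_square)
  have int: "integrable \<nu> (\<lambda>y. (y \<bullet> e (Suc i))\<^sup>2)" for i by (rule int1) simp
  have sm: "summable (\<lambda>i. \<integral>y. (y \<bullet> e (Suc i))\<^sup>2 \<partial>\<nu>)"
    unfolding E by (rule summable_Sigma_lim)
  show "integrable \<nu> (\<lambda>y. (norm (y - proj e m y))\<^sup>2)"
    by (rule integral_tail(1)[OF id int sm])
  have "(\<integral>y. (norm (y - proj e m y))\<^sup>2 \<partial>\<nu>) = (\<Sum>i. Sigma_lim M X e (Suc (i + m)) (Suc (i + m)))"
    unfolding integral_tail(2)[OF id int sm] E ..
  also have "\<dots> \<le> (\<Sum>i. coord_var (i + m))"
    using summable_ignore_initial_segment[OF summable_Sigma_lim, of m] summable_ignore_initial_segment[OF summable_coord_var, of m]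
    by (intro suminf_le Sigma_lim_le_coord_var)
  finally show "(\<integral>y. (norm (y - proj e m y))\<^sup>2 \<partial>\<nu>) \<le> (\<Sum>i. coord_var (i + m))" .
  assume "u \<in> span (e ` {1..})"
  then obtain m0 where m0: "\<And>m. m0 \<le> m \<Longrightarrow> proj e m u = u" using proj_eventually_id by blast
  define m where "m = max 1 m0"
  define r where "r i = u \<bullet> e i" for i
  have m: "1 \<le> m" by (simp add: m_def)
  have u: "(\<Sum>i=1..m. r i *\<^sub>R e i) = u" using m0[of m] by (simp add: m_def proj_def r_def)
  have uy: "u \<bullet> y = (\<Sum>i=1..m. r i * (y \<bullet> e i))" for y
    by (subst u[symmetric], subst inner_commute) (simp add: inner_sum_right)
  have "(\<integral>y. (u \<bullet> y)\<^sup>2 \<partial>\<nu>) = (\<integral>y. (\<Sum>i=1..m. \<Sum>j=1..m. r i * r j * ((y \<bullet> e i) * (y \<bullet> e j))) \<partial>\<nu>)"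
    unfolding uy power2_eq_square sum_product by (simp add: mult_ac)
  also have "\<dots> = (\<Sum>i=1..m. \<Sum>j=1..m. r i * r j * (\<integral>y. (y \<bullet> e i) * (y \<bullet> e j) \<partial>\<nu>))"
  proof -
    have I: "integrable \<nu> (\<lambda>y. r i * r j * ((y \<bullet> e i) * (y \<bullet> e j)))" if "i \<in> {1..m}" "j \<in> {1..m}" for i j
      using that by (intro integrable_mult_right integrable_L2_mult L2) auto
    have "(\<integral>y. (\<Sum>i=1..m. \<Sum>j=1..m. r i * r j * ((y \<bullet> e i) * (y \<bullet> e j))) \<partial>\<nu>)
        = (\<Sum>i=1..m. \<integral>y. (\<Sum>j=1..m. r i * r j * ((y \<bullet> e i) * (y \<bullet> e j))) \<partial>\<nu>)"
      by (intro Bochner_Integration.integral_sum Bochner_Integration.integrable_sum I)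
    also have "\<dots> = (\<Sum>i=1..m. \<Sum>j=1..m. \<integral>y. r i * r j * ((y \<bullet> e i) * (y \<bullet> e j)) \<partial>\<nu>)"
      by (intro sum.cong refl Bochner_Integration.integral_sum I)
    finally show ?thesis by simp
  qed
  also have "\<dots> = (\<Sum>i=1..m. \<Sum>j=1..m. r i * r j * Sigma_lim M X e i j)"
    by (intro sum.cong refl) (simp add: cov)
  also have "\<dots> = qform u" unfolding qform_linear_combination[symmetric] u ..
  finally have "(\<integral>y. (u \<bullet> y)\<^sup>2 \<partial>\<nu>) = qform u" .
  moreover have "centered_normal \<nu> (\<lambda>y. u \<bullet> y)" unfolding uy by (rule normal[OF m])
  ultimately show "(\<integral>y. iexp (u \<bullet> y) \<partial>\<nu>) = complex_of_real (exp (- qform u / 2))"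
    using centered_normal_moments(2)[OF N.prob_space_axioms, of "\<lambda>y. u \<bullet> y"] by simp
qed

text \<open>Along a sequence of rectangles, the laws of the normalised sums and the normal law satisfy the hypotheses of the
continuity theorem: the tail bounds come from \<open>coord_var\<close>, and the characteristic functionals converge by the real
central limit theorem applied to \<open>x \<bullet> u\<close>.\<close>

theorem converges_to_normal_law:
  assumes \<nu>: "is_normal_law e (Sigma_lim M X e) \<nu>"
  shows "conv_in_distr M normalised \<nu> min_at_top"
  unfolding conv_in_distr_def
proof (intro allI impI, elim conjE)
  fix f :: "'h \<Rightarrow> real" assume f: "continuous_on UNIV f" "bounded (range f)"
  have fm[measurable]: "f \<in> borel_measurable borel" using f(1) by (rule borel_measurable_continuous_onI)
  show "((\<lambda>L. \<integral>w. f (normalised L w) \<partial>M) \<longlongrightarrow> (\<integral>y. f y \<partial>\<nu>)) min_at_top"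
  proof (rule tendsto_min_at_top_sequentially)
    fix Ls :: "nat \<Rightarrow> nat ^ 'd" assume Ls: "\<And>n v. n < Ls n $ v"
    then have L1: "1 \<le> Ls n $ v" for n v by (metis One_nat_def Suc_leI gr_zeroI not_less_zero)
    have lim: "filterlim Ls min_at_top sequentially" by (rule filterlim_min_at_top[OF Ls])
    define \<mu> where "\<mu> n = distr M borel (normalised (Ls n))" for n
    define t where "t m = (\<Sum>i. coord_var (i + m))" for m
    have Zm[measurable]: "normalised L \<in> borel_measurable M" for L by measurable
    have int_\<mu>: "(\<integral>x. F x \<partial>\<mu> n) = (\<integral>w. F (normalised (Ls n) w) \<partial>M)"
      if "F \<in> borel_measurable borel" for n and F :: "'h \<Rightarrow> 'b::{banach, second_countable_topology}"
      unfolding \<mu>_def by (rule integral_distr[OF Zm that])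
    have norm_m: "(\<lambda>x. (norm (x - proj e m x))\<^sup>2) \<in> borel_measurable borel" for m by measurable
    have int2: "integrable (\<mu> n) (\<lambda>x. (norm (x - proj e m x))\<^sup>2)" for n m
      unfolding \<mu>_def by (subst integrable_distr_eq[OF Zm norm_m]) (rule normalised_moments(1)[OF L1])
    have tail: "(\<integral>x. (norm (x - proj e m x))\<^sup>2 \<partial>\<mu> n) \<le> t m" for n m
      unfolding int_\<mu>[OF norm_m] t_def by (rule normalised_moments(2)[OF L1])
    interpret char_convergence e \<mu> \<nu> "t 0" t
    proof (intro char_convergence.intro char_convergence_axioms.intro onb_axioms)
      show "prob_space (\<mu> n)" for n unfolding \<mu>_def by (rule prob_space_distr) measurable
      show "sets (\<mu> n) = sets borel" for n by (simp add: \<mu>_def)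
      show "prob_space \<nu>" "sets \<nu> = sets borel" using \<nu> by (auto simp: is_normal_law_def)
      show "integrable (\<mu> n) (\<lambda>x. (norm x)\<^sup>2)" "(\<integral>x. (norm x)\<^sup>2 \<partial>\<mu> n) \<le> t 0" for n
        using int2[of n 0] tail[of n 0] by simp_all
      show "integrable \<nu> (\<lambda>x. (norm x)\<^sup>2)" "(\<integral>x. (norm x)\<^sup>2 \<partial>\<nu>) \<le> t 0"
        using normal_law_props(1,2)[OF \<nu>, where m = 0] by (simp_all add: t_def)
      show "(\<integral>x. (norm (x - proj e m x))\<^sup>2 \<partial>\<mu> n) \<le> t m" for n m by (rule tail)
      show "(\<integral>x. (norm (x - proj e m x))\<^sup>2 \<partial>\<nu>) \<le> t m" for m
        unfolding t_def by (rule normal_law_props(2)[OF \<nu>])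
      show "t \<longlonglongrightarrow> 0"
        unfolding t_def[abs_def] by (rule suminf_exist_split2[OF summable_coord_var])
      fix u assume u: "u \<in> span (e ` {1..})"
      have um: "(\<lambda>x. iexp (u \<bullet> x)) \<in> borel_measurable borel" by measurable
      have "((\<lambda>L. \<integral>w. iexp (1 * (psum (\<lambda>x. x \<bullet> u) (rect L) w / sqrt (vol L))) \<partial>M)
          \<longlongrightarrow> complex_of_real (exp (- (1\<^sup>2 * qform u) / 2))) min_at_top"
        by (rule central_limit_real[OF centred_inner var_inner_tendsto])
      from filterlim_compose[OF this lim]
      have conv: "(\<lambda>n. \<integral>w. iexp (1 * (psum (\<lambda>x. x \<bullet> u) (rect (Ls n)) w / sqrt (vol (Ls n)))) \<partial>M)
          \<longlonglongrightarrow> complex_of_real (exp (- (1\<^sup>2 * qform u) / 2))" .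
      have eq: "1 * (psum (\<lambda>x. x \<bullet> u) (rect L) w / sqrt (vol L)) = u \<bullet> normalised L w" for L w
        by (simp add: psum_inner divide_inverse mult.commute inner_commute)
      show "(\<lambda>n. \<integral>x. iexp (u \<bullet> x) \<partial>\<mu> n) \<longlonglongrightarrow> (\<integral>x. iexp (u \<bullet> x) \<partial>\<nu>)"
        unfolding int_\<mu>[OF um] normal_law_props(3)[OF \<nu> u]
        using conv unfolding eq by (simp only: power_one mult_1)
    qed
    show "(\<lambda>n. \<integral>w. f (normalised (Ls n) w) \<partial>M) \<longlonglongrightarrow> (\<integral>y. f y \<partial>\<nu>)"
      using bounded_continuous_convergence[OF f] unfolding int_\<mu>[OF fm] .
  qed
qed

end

theorem theorem3p3:
  fixes M :: "'w measure"
    and X :: "int ^ 'd \<Rightarrow> 'w \<Rightarrow> 'h::{real_inner, banach, second_countable_topology}"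
    and e :: "nat \<Rightarrow> 'h"
  assumes "prob_space M"
    and "\<And>k. X k \<in> borel_measurable M"
    and "strictly_stationary M X"
    and "rho_prime_mixing M X"
    and "(\<integral>\<omega>. X 0 \<omega> \<partial>M) = 0"
    and "integrable M (\<lambda>\<omega>. (norm (X 0 \<omega>))\<^sup>2)"
    and "orthonormal_basis e"
  shows "(\<forall>i\<ge>1. \<exists>s\<ge>0. (norm_var M X e i \<longlongrightarrow> s) min_at_top) \<and>
    (\<forall>i\<ge>1. \<forall>j\<ge>1. i \<noteq> j \<longrightarrow> (\<exists>g\<ge>0. (norm_var_diff M X e i j \<longlongrightarrow> g) min_at_top)) \<and>
    symmetric_matrix (Sigma_lim M X e) \<and>
    nonneg_definite (Sigma_lim M X e) \<and>
    finite_trace (Sigma_lim M X e) \<and>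
    (\<exists>\<nu>. is_normal_law e (Sigma_lim M X e) \<nu> \<and>
         conv_in_distr M (\<lambda>L \<omega>. rect_sum X L \<omega> /\<^sub>R sqrt (vol L)) \<nu> min_at_top)"
proof -
  interpret prob_space M by fact
  interpret hilbert_field M X e
    by unfold_locales (use assms in auto)
  obtain \<nu> where \<nu>: "is_normal_law e (Sigma_lim M X e) \<nu>"
    by (rule normal_law_exists[OF symmetric_Sigma_lim nonneg_definite_Sigma_lim summable_Sigma_lim])
  show ?thesis
    using var_inner_tendsto qform_nonneg symmetric_Sigma_lim nonneg_definite_Sigma_lim finite_trace_Sigma_lim
      \<nu> converges_to_normal_law[OF \<nu>]
    unfolding norm_var_eq norm_var_diff_eq by blast
qed

end
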